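(* Let $a\ge b>0$, $r>0$, $\varepsilon=\sqrt{a^2-b^2}/a$. Let $K_0\subset\mathbb{R}^2$ be a fixed closed disk of radius $r$ with boundary circle $C_0$, and let $K_1^*$ be the closed region bounded by an ellipse $C_1^*$ with semi-axes $a$ and $b$ and center $M_1$, where $C_1^*$ is moved by translations only (its direction is fixed). Define $$A_{\mathrm i}^{01}=A(\{M_1: C_0\subset K_1^*\}),\quad A_{\mathrm i}^{10}=A(\{M_1: C_1^*\subset K_0\}),\quad A_{2j}=A(\{M_1:\#(C_0\cap C_1^* )=2j\}),\ j\in\{1,2\}.$$ Put $$F(\phi)=2r^2\phi+2ab\arctan\Big(\frac ba\tan\phi\Big)-4ra\,E(\phi,\varepsilon)+\frac{ra\,\varepsilon^2\sin 2\phi}{\sqrt{1-\varepsilon^2\sin^2\phi}},$$ $$A^*=F(\pi/2)=\pi r^2+\pi ab-4ra\,E(\varepsilon),\qquad \widetilde F(\phi)=A^*-F(\phi),$$ $$\alpha=\arctan\frac{\sqrt{r^2a^2-b^4}}{b\sqrt{b^2-r^2}},\qquad \beta=\arctan\frac{a\sqrt{r^2-a^2}}{\sqrt{a^4-r^2b^2}}$$ (where $\alpha$ is used only in Case 2 and $\beta$ only in Case 4). Then: Case 1. If $0<r\le b^2/a$: $A_{\mathrm i}^{01}=A^*$, $A_{\mathrm i}^{10}=0$, $A_2=8ra\,E(\varepsilon)$, $A_4=0$. Case 2. If $b^2/a<r<b$: $A_{\mathrm i}^{01}=\widetilde F(\alpha)$, $A_{\mathrm i}^{10}=0$, $A_2=2\pi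 r^2+2\pi ab-2\widetilde F(\alpha)$, $A_4=\widetilde F(\alpha)-A^*$. Case 3. If $b\le r\le a$: $A_{\mathrm i}^{01}=0$, $A_{\mathrm i}^{10}=0$, $A_2=2\pi r^2+2\pi ab$, $A_4=-A^*$. Case 4. If $a<r<a^2/b$: $A_{\mathrm i}^{01}=0$, $A_{\mathrm i}^{10}=F(\beta)$, $A_2=2\pi r^2+2\pi ab-2F(\beta)$, $A_4=F(\beta)-A^*$. Case 5. If $a^2/b\le r<\infty$: $A_{\mathrm i}^{01}=0$, $A_{\mathrm i}^{10}=A^*$, $A_2=8ra\,E(\varepsilon)$, $A_4=0$.
   Context: $A(\cdot)$ denotes area (Lebesgue measure in $\mathbb{R}^2$) of a set of positions of the center $M_1$. $\#(C_0\cap C_1^* )$ is the number of real intersection points of $C_0$ and $C_1^*$, counted with intersection multiplicity. The semi-major axis of the ellipse has length $a$ and the semi-minor axis has length $b$; $\varepsilon$ is its eccentricity. $E(\phi,\varepsilon)=\int_0^{\phi}\sqrt{1-\varepsilon^2\sin^2\theta}\,\mathrm d\theta$ is the incomplete elliptic integral of the second kind and $E(\varepsilon)=E(\pi/2,\varepsilon)$ the complete one. In $F(\pi/2)$, the term $\arctan(\frac ba\tan\phi)$ is understood as its limit $\pi/2$ as $\phi\to\pi/2^-$. *)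

theory Defs
  imports
    "HOL-Analysis.Analysis"
    "HOL-Computational_Algebra.Polynomial"
    "HOL-Computational_Algebra.Fraction_Field"
begin

section \<open>Intersection multiplicity of real plane curves\<close>

text \<open>
  A polynomial in two variables is an element of \<open>\<real>[X][Y]\<close>: the coefficients of the outer
  polynomial (in \<open>Y\<close>) are polynomials in \<open>X\<close>.
\<close>

type_synonym poly2 = "real poly poly"

definition Const2 :: "real \<Rightarrow> poly2" where
  "Const2 k = [:[:k:]:]"

definition X2 :: poly2 where
  "X2 = [:[:0, 1:]:]"

definition Y2 :: poly2 where
  "Y2 = [:0, 1:]"

definition eval2 :: "poly2 \<Rightarrow> real ^ 2 \<Rightarrow> real" where
  "eval2 f p = poly (poly f [:p $ 2:]) (p $ 1)"

definition local_ring :: "real ^ 2 \<Rightarrow> poly2 fract set" where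
  "local_ring p = {Fract u v | u v. eval2 v p \<noteq> 0}"

definition local_ideal :: "poly2 \<Rightarrow> poly2 \<Rightarrow> real ^ 2 \<Rightarrow> poly2 fract set" where
  "local_ideal f g p =
     {s * Fract f 1 + t * Fract g 1 | s t. s \<in> local_ring p \<and> t \<in> local_ring p}"

text \<open>
  The intersection multiplicity at \<open>p\<close> is the real dimension of the quotient of the local ring
  at \<open>p\<close> by the ideal generated by \<open>f\<close> and \<open>g\<close>. The dimension of the quotient is the largest
  number of elements of the local ring that are linearly independent modulo the ideal
  (\<open>\<infinity>\<close> if there is no bound).
\<close>

definition intersection_mult :: "poly2 \<Rightarrow> poly2 \<Rightarrow> real ^ 2 \<Rightarrow> enat" where
  "intersection_mult f g p =
     (SUP B \<in> {B. finite B \<and> B \<subseteq> local_ring p \<and>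
                  (\<forall>k. (\<Sum>q\<in>B. Fract (Const2 (k q)) 1 * q) \<in> local_ideal f g p
                       \<longrightarrow> (\<forall>q\<in>B. k q = 0))}.
        enat (card B))"

definition num_real_intersections :: "poly2 \<Rightarrow> poly2 \<Rightarrow> enat" where
  "num_real_intersections f g =
     (let S = {p. eval2 f p = 0 \<and> eval2 g p = 0}
      in if finite S then \<Sum>p\<in>S. intersection_mult f g p else \<infinity>)"


section \<open>The circle and the translated ellipse\<close>

text \<open>
  The direction of the ellipse is the angle \<open>\<theta>\<close> between its major axis and the first coordinate
  axis; \<open>m\<close> is its center. The coordinates of \<open>x\<close> along the two axes of the ellipse are:
\<close>

definition major_coord :: "real \<Rightarrow> real ^ 2 \<Rightarrow> real ^ 2 \<Rightarrow> real" where
  "major_coord \<theta> m x = cos \<theta> * (x $ 1 - m $ 1) + sin \<theta> * (x $ 2 - m $ 2)"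

definition minor_coord :: "real \<Rightarrow> real ^ 2 \<Rightarrow> real ^ 2 \<Rightarrow> real" where
  "minor_coord \<theta> m x = - sin \<theta> * (x $ 1 - m $ 1) + cos \<theta> * (x $ 2 - m $ 2)"

definition ellipse :: "real \<Rightarrow> real \<Rightarrow> real \<Rightarrow> real ^ 2 \<Rightarrow> (real ^ 2) set" where
  "ellipse a b \<theta> m = {x. (major_coord \<theta> m x / a)\<^sup>2 + (minor_coord \<theta> m x / b)\<^sup>2 = 1}"

definition ellipse_region :: "real \<Rightarrow> real \<Rightarrow> real \<Rightarrow> real ^ 2 \<Rightarrow> (real ^ 2) set" where
  "ellipse_region a b \<theta> m = {x. (major_coord \<theta> m x / a)\<^sup>2 + (minor_coord \<theta> m x / b)\<^sup>2 \<le> 1}"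

definition circle_poly :: "real ^ 2 \<Rightarrow> real \<Rightarrow> poly2" where
  "circle_poly c r = (X2 - Const2 (c $ 1))\<^sup>2 + (Y2 - Const2 (c $ 2))\<^sup>2 - Const2 (r\<^sup>2)"

definition ellipse_poly :: "real \<Rightarrow> real \<Rightarrow> real \<Rightarrow> real ^ 2 \<Rightarrow> poly2" where
  "ellipse_poly a b \<theta> m =
     Const2 (1 / a\<^sup>2) *
       (Const2 (cos \<theta>) * (X2 - Const2 (m $ 1)) + Const2 (sin \<theta>) * (Y2 - Const2 (m $ 2)))\<^sup>2
   + Const2 (1 / b\<^sup>2) *
       (Const2 (- sin \<theta>) * (X2 - Const2 (m $ 1)) + Const2 (cos \<theta>) * (Y2 - Const2 (m $ 2)))\<^sup>2
   - 1"

lemma eval2_simps [simp]: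
  "eval2 (f + g) p = eval2 f p + eval2 g p"
  "eval2 (f - g) p = eval2 f p - eval2 g p"
  "eval2 (f * g) p = eval2 f p * eval2 g p"
  "eval2 (f ^ n) p = eval2 f p ^ n"
  "eval2 1 p = 1"
  "eval2 (Const2 k) p = k"
  "eval2 X2 p = p $ 1"
  "eval2 Y2 p = p $ 2"
  by (simp_all add: eval2_def Const2_def X2_def Y2_def)

lemma zero_set_circle_poly:
  assumes "r > 0"
  shows "{p. eval2 (circle_poly c r) p = 0} = sphere c r"
proof -
  have "dist c p = r \<longleftrightarrow> (p $ 1 - c $ 1)\<^sup>2 + (p $ 2 - c $ 2)\<^sup>2 = r\<^sup>2" for p
  proof -
    have "dist c p = sqrt ((p $ 1 - c $ 1)\<^sup>2 + (p $ 2 - c $ 2)\<^sup>2)"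
      by (simp add: dist_vec_def L2_set_def sum_2 dist_real_def power2_commute)
    then show ?thesis
      using assms real_sqrt_eq_iff[of "(p $ 1 - c $ 1)\<^sup>2 + (p $ 2 - c $ 2)\<^sup>2" "r\<^sup>2"] by simp
  qed
  moreover have "eval2 (circle_poly c r) p = (p $ 1 - c $ 1)\<^sup>2 + (p $ 2 - c $ 2)\<^sup>2 - r\<^sup>2" for p
    by (simp only: circle_poly_def eval2_simps)
  ultimately show ?thesis
    by (simp add: sphere_def)
qed

lemma zero_set_ellipse_poly:
  "{p. eval2 (ellipse_poly a b \<theta> m) p = 0} = ellipse a b \<theta> m"
proof -
  have "eval2 (ellipse_poly a b \<theta> m) p =
          1 / a\<^sup>2 * (major_coord \<theta> m p)\<^sup>2 + 1 / b\<^sup>2 * (minor_coord \<theta> m p)\<^sup>2 - 1" for p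
    by (simp only: ellipse_poly_def major_coord_def minor_coord_def eval2_simps)
  moreover have "1 / a\<^sup>2 * (major_coord \<theta> m p)\<^sup>2 + 1 / b\<^sup>2 * (minor_coord \<theta> m p)\<^sup>2 - 1 =
          (major_coord \<theta> m p / a)\<^sup>2 + (minor_coord \<theta> m p / b)\<^sup>2 - 1" for p
    by (simp only: power_divide times_divide_eq_left mult_1_left)
  ultimately show ?thesis
    by (simp only: ellipse_def right_minus_eq)
qed


section \<open>Sets of positions of the ellipse\<close>

text \<open>
  \<open>c\<close> and \<open>r\<close> are center and radius of the fixed disk. The areas are the Lebesgue measures of
  these sets of positions of the center \<open>m\<close>.
\<close>

definition positions_circle_inside ::
    "real \<Rightarrow> real \<Rightarrow> real \<Rightarrow> real ^ 2 \<Rightarrow> real \<Rightarrow> (real ^ 2) set" where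
  "positions_circle_inside a b \<theta> c r = {m. sphere c r \<subseteq> ellipse_region a b \<theta> m}"

definition positions_ellipse_inside ::
    "real \<Rightarrow> real \<Rightarrow> real \<Rightarrow> real ^ 2 \<Rightarrow> real \<Rightarrow> (real ^ 2) set" where
  "positions_ellipse_inside a b \<theta> c r = {m. ellipse a b \<theta> m \<subseteq> cball c r}"

definition positions_intersections ::
    "real \<Rightarrow> real \<Rightarrow> real \<Rightarrow> real ^ 2 \<Rightarrow> real \<Rightarrow> nat \<Rightarrow> (real ^ 2) set" where
  "positions_intersections a b \<theta> c r n =
     {m. num_real_intersections (circle_poly c r) (ellipse_poly a b \<theta> m) = enat n}"


section \<open>The area functions\<close>

definition eccentricity :: "real \<Rightarrow> real \<Rightarrow> real" where
  "eccentricity a b = sqrt (a\<^sup>2 - b\<^sup>2) / a"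

definition ell_E :: "real \<Rightarrow> real \<Rightarrow> real" where
  "ell_E \<phi> e = integral {0..\<phi>} (\<lambda>\<theta>. sqrt (1 - e\<^sup>2 * (sin \<theta>)\<^sup>2))"

definition complete_ell_E :: "real \<Rightarrow> real" where
  "complete_ell_E e = ell_E (pi / 2) e"

text \<open>
  At \<open>\<phi> = \<pi>/2\<close> the library has \<open>tan \<phi> = 0\<close>; the intended value of the arctangent term
  there is its limit from the left.
\<close>

definition F :: "real \<Rightarrow> real \<Rightarrow> real \<Rightarrow> real \<Rightarrow> real" where
  "F a b r \<phi> =
     (let e = eccentricity a b in
      2 * r\<^sup>2 * \<phi>
      + 2 * a * b * (if \<phi> = pi / 2 then pi / 2 else arctan (b / a * tan \<phi>))
      - 4 * r * a * ell_E \<phi> e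
      + r * a * e\<^sup>2 * sin (2 * \<phi>) / sqrt (1 - e\<^sup>2 * (sin \<phi>)\<^sup>2))"

definition A_star :: "real \<Rightarrow> real \<Rightarrow> real \<Rightarrow> real" where
  "A_star a b r = F a b r (pi / 2)"

definition F_tilde :: "real \<Rightarrow> real \<Rightarrow> real \<Rightarrow> real \<Rightarrow> real" where
  "F_tilde a b r \<phi> = A_star a b r - F a b r \<phi>"

definition alpha :: "real \<Rightarrow> real \<Rightarrow> real \<Rightarrow> real" where
  "alpha a b r = arctan (sqrt (r\<^sup>2 * a\<^sup>2 - b ^ 4) / (b * sqrt (b\<^sup>2 - r\<^sup>2)))"

definition beta :: "real \<Rightarrow> real \<Rightarrow> real \<Rightarrow> real" where
  "beta a b r = arctan (a * sqrt (r\<^sup>2 - a\<^sup>2) / sqrt (a ^ 4 - r\<^sup>2 * b\<^sup>2))"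

end

theory Submission
  imports Defs
begin

text \<open>
  The areas of the positions with two and with four intersections are found from two linear
  equations for them: the area of all positions at which the curves meet, and the
  integral of the number of intersections over all positions.

  Positions are given by the center \<open>w\<close> of the ellipse relative to the center of the circle, in
  coordinates along the axes of the ellipse. Let \<open>h\<close> be the support function of the ellipse and
  \<open>\<rho>\<close> its radius of curvature, as functions of the normal angle. The circle lies in the elliptic
  region iff \<open>w \<bullet> u \<le> h - r\<close> for all unit vectors \<open>u\<close>, the ellipse lies in the disk iff
  \<open>w \<bullet> u \<le> r - h\<close>, and the two regions meet iff \<open>w \<bullet> u \<le> h + r\<close>. By connectedness
  (\<open>no_contact_cases\<close>) the curves meet in the third body minus the other two, up to a null set. Each
  body is bounded by arcs of the curve with support function \<open>\<plusminus>(h - r)\<close>, where \<open>-r\<close>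
  in the place of \<open>r\<close> gives the third body. Such an arc sweeps out a sector about the origin of area
  \<open>\<integral> (h - r) (\<rho> - r) / 2\<close>, and \<open>F(\<phi>)\<close> is four times this area for the angles from \<open>0\<close> to \<open>\<phi>\<close>
  (\<open>F_has_integral\<close>). If \<open>r\<close> is at most the smallest or at least the largest radius of curvature,
  the arc for the angles from \<open>0\<close> to \<open>\<pi>/2\<close> lies in one quadrant. If \<open>r\<close> is larger than the
  former but less than \<open>b\<close>, or less than the latter but larger than \<open>a\<close>, this arc has a cusp and
  crosses an axis at the angle \<open>\<alpha>\<close> or \<open>\<beta>\<close>, and the boundary loses the part with the cusp
  (\<open>measure_parallel_body_quadrant\<close>). For \<open>r\<close> between \<open>b\<close> and \<open>a\<close>, the first two bodies are
  null sets. The body with \<open>h + r\<close> has the area \<open>A\<^sup>*\<close> with \<open>-r\<close> for \<open>r\<close>, which is Steiner's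
  formula.

  The point of the circle at the angle \<open>s\<close> and the point of the ellipse with the parameter \<open>t\<close>
  coincide iff \<open>w = G(s, t)\<close> for an explicit map \<open>G\<close> of the torus. By the area formula, the number
  of contacts has the integral \<open>\<integral> \<bar>det G'\<bar> = 16 r a E(\<epsilon>)\<close> (\<open>nn_integral_card_contacts\<close>).

  The critical values of \<open>G\<close>, which are the positions with a tangential contact, form a null set by
  Sard's theorem. At any other position, the gradients of the two curves are linearly independent at
  every contact, so that the contact has multiplicity \<open>1\<close> (\<open>intersection_mult_transversal\<close>), and
  the contacts correspond to the roots of a real quartic, all of them simple. So
  their number is \<open>0\<close>, \<open>2\<close> or \<open>4\<close> (\<open>card_contacts\<close>).
\<close>

section \<open>Transversal intersections have multiplicity one\<close>

text \<open>Division with remainder, first by \<open>Y - p\<^sub>2\<close> and then by \<open>X - p\<^sub>1\<close>.\<close>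

lemma poly2_linear_remainder:
  obtains S T where "u = S * (X2 - Const2 (p $ 1)) + T * (Y2 - Const2 (p $ 2)) + Const2 (eval2 u p)"
proof -
  define v where "v = poly u [:p $ 2:]"
  define S where "S = [:synthetic_div v (p $ 1):]"
  define T where "T = synthetic_div u [:p $ 2:]"
  have "u = (Y2 - Const2 (p $ 2)) * T + [:v:]"
    using synthetic_div_correct' [of "[:p $ 2:]" u] by (simp add: v_def T_def Y2_def Const2_def)
  also have "[:v:] = [:[:- (p $ 1), 1:] * synthetic_div v (p $ 1) + [:poly v (p $ 1):]:]"
    by (simp only: synthetic_div_correct')
  also have "\<dots> = S * (X2 - Const2 (p $ 1)) + Const2 (eval2 u p)"
    by (simp add: S_def X2_def Const2_def eval2_def v_def)
  finally have "u = S * (X2 - Const2 (p $ 1)) + T * (Y2 - Const2 (p $ 2)) + Const2 (eval2 u p)"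
    by (simp only: ac_simps)
  then show thesis by (rule that)
qed

lemma eval2_nonzero: "eval2 v p \<noteq> 0 \<Longrightarrow> v \<noteq> 0"
  by (auto simp: eval2_def)

lemma local_ringI: "eval2 v p \<noteq> 0 \<Longrightarrow> Fract u v \<in> local_ring p"
  unfolding local_ring_def by blast

lemma local_idealI:
  "s \<in> local_ring p \<Longrightarrow> t \<in> local_ring p \<Longrightarrow> s * Fract f 1 + t * Fract g 1 \<in> local_ideal f g p"
  unfolding local_ideal_def by blast

lemma Fract_combination:
  fixes f g s t w :: "'a :: idom"
  assumes "w \<noteq> 0"
  shows "Fract s w * Fract f 1 + Fract t w * Fract g 1 = Fract (s * f + t * g) w"
  using assms by (simp add: eq_fract algebra_simps)

lemma Fract_cross_sum:
  fixes c d u1 v1 u2 v2 :: "'a :: idom"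
  assumes "v1 \<noteq> 0" "v2 \<noteq> 0"
  shows "Fract c 1 * Fract u1 v1 + Fract d 1 * Fract u2 v2 = Fract (c * u1 * v2 + d * u2 * v1) (v1 * v2)"
  using assms by simp

lemma Fract_sum_eqD:
  fixes f g u1 v1 u2 v2 :: "'a :: idom"
  assumes "Fract k 1 = Fract u1 v1 * Fract f 1 + Fract u2 v2 * Fract g 1" "v1 \<noteq> 0" "v2 \<noteq> 0"
  shows "k * (v1 * v2) = u1 * f * v2 + u2 * g * v1"
  using assms by (simp add: eq_fract)

lemma cramer_combination:
  fixes A B C D S T x y :: "'a :: comm_ring_1"
  shows "(S * D - T * C) * (A * x + B * y) + (T * A - S * B) * (C * x + D * y) = (A * D - B * C) * (S * x + T * y)"
  by (simp add: algebra_simps)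

lemma vanishing_in_local_ideal:
  assumes f: "f = A * (X2 - Const2 (p $ 1)) + B * (Y2 - Const2 (p $ 2))"
    and g: "g = C * (X2 - Const2 (p $ 1)) + D * (Y2 - Const2 (p $ 2))"
    and det: "eval2 (A * D - B * C) p \<noteq> 0"
    and v: "eval2 v p \<noteq> 0" and u: "eval2 u p = 0"
  shows "Fract u v \<in> local_ideal f g p"
proof -
  obtain S T where u_eq: "u = S * (X2 - Const2 (p $ 1)) + T * (Y2 - Const2 (p $ 2)) + Const2 (eval2 u p)"
    by (rule poly2_linear_remainder)
  have "Const2 (eval2 u p) = 0"
    unfolding u by (simp add: Const2_def)
  then have u': "u = S * (X2 - Const2 (p $ 1)) + T * (Y2 - Const2 (p $ 2))"
    using u_eq unfolding u add_0_right by (simp only: add_0_right)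
  define \<Delta> where "\<Delta> = A * D - B * C"
  \<comment> \<open>Cramer's rule for the two linear forms.\<close>
  have eq: "(S * D - T * C) * f + (T * A - S * B) * g = \<Delta> * u"
    unfolding f g u' \<Delta>_def by (rule cramer_combination)
  have nz: "eval2 (v * \<Delta>) p \<noteq> 0"
    using v det by (simp only: \<Delta>_def eval2_simps mult_eq_0_iff simp_thms)
  have nz': "v * \<Delta> \<noteq> 0" "v \<noteq> 0" "\<Delta> \<noteq> 0"
    using eval2_nonzero [OF nz] by auto
  have "Fract (S * D - T * C) (v * \<Delta>) * Fract f 1 + Fract (T * A - S * B) (v * \<Delta>) * Fract g 1
      = Fract (\<Delta> * u) (v * \<Delta>)"
    using Fract_combination [OF nz'(1), of "S * D - T * C" f "T * A - S * B" g] unfolding eq .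
  also have "\<dots> = Fract u v"
    using mult_fract_cancel [OF nz'(3), of u v] by (simp only: mult.commute)
  finally have eq_uv: "Fract (S * D - T * C) (v * \<Delta>) * Fract f 1 + Fract (T * A - S * B) (v * \<Delta>) * Fract g 1
      = Fract u v" .
  have "Fract (S * D - T * C) (v * \<Delta>) * Fract f 1 + Fract (T * A - S * B) (v * \<Delta>) * Fract g 1
      \<in> local_ideal f g p"
    by (rule local_idealI [OF local_ringI [OF nz] local_ringI [OF nz]])
  then show ?thesis
    unfolding eq_uv .
qed

text \<open>
  The determinant is a unit of the local ring, so by Cramer's rule \<open>f\<close> and \<open>g\<close> generate the maximal
  ideal. Two elements of the local ring are therefore linearly dependent modulo the ideal as soon as
  their values at \<open>p\<close> are, and these are real numbers.
\<close>

lemma intersection_mult_transversal: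
  assumes f: "f = A * (X2 - Const2 (p $ 1)) + B * (Y2 - Const2 (p $ 2))"
    and g: "g = C * (X2 - Const2 (p $ 1)) + D * (Y2 - Const2 (p $ 2))"
    and det: "eval2 (A * D - B * C) p \<noteq> 0"
  shows "intersection_mult f g p = 1"
proof -
  define indep where "indep Q \<longleftrightarrow> (\<forall>k. (\<Sum>q\<in>Q. Fract (Const2 (k q)) 1 * q) \<in> local_ideal f g p
      \<longrightarrow> (\<forall>q\<in>Q. k q = 0))" for Q
  have upper: "card Q \<le> 1" if Q: "finite Q" "Q \<subseteq> local_ring p" "indep Q" for Q
  proof (rule ccontr)
    assume "\<not> card Q \<le> 1"
    then obtain q1 q2 where q: "q1 \<in> Q" "q2 \<in> Q" "q1 \<noteq> q2"
      by (metis card_le_Suc0_iff_eq One_nat_def Q(1))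
    then obtain u1 v1 u2 v2 where uv: "q1 = Fract u1 v1" "eval2 v1 p \<noteq> 0" "q2 = Fract u2 v2" "eval2 v2 p \<noteq> 0"
      using Q(2) unfolding local_ring_def by blast
    have nz: "v1 \<noteq> 0" "v2 \<noteq> 0"
      using uv eval2_nonzero by auto
    \<comment> \<open>The condition says that the combination of the two elements vanishes at \<open>p\<close>.\<close>
    have no_combination: "c1 = 0 \<and> c2 = 0"
      if c: "c1 * eval2 u1 p * eval2 v2 p + c2 * eval2 u2 p * eval2 v1 p = 0" for c1 c2
    proof -
      define k where "k q = (if q = q1 then c1 else if q = q2 then c2 else 0)" for q
      have "(\<Sum>q\<in>Q. Fract (Const2 (k q)) 1 * q) = (\<Sum>q\<in>{q1,q2}. Fract (Const2 (k q)) 1 * q)"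
        using q Q(1) by (intro sum.mono_neutral_right) (auto simp: k_def Const2_def Zero_fract_def [symmetric])
      also have "\<dots> = Fract (Const2 c1 * u1 * v2 + Const2 c2 * u2 * v1) (v1 * v2)"
        using q(3) Fract_cross_sum [OF nz, of "Const2 c1" u1 "Const2 c2" u2] by (simp add: k_def uv(1,3))
      also have "\<dots> \<in> local_ideal f g p"
      proof (rule vanishing_in_local_ideal [OF f g det])
        show "eval2 (v1 * v2) p \<noteq> 0"
          using uv(2,4) by (simp only: eval2_simps mult_eq_0_iff simp_thms)
        show "eval2 (Const2 c1 * u1 * v2 + Const2 c2 * u2 * v1) p = 0"
          using c by (simp only: eval2_simps)
      qed
      finally have "\<forall>q\<in>Q. k q = 0"
        using Q(3) by (auto simp: indep_def)
      then have "k q1 = 0" "k q2 = 0" using q by auto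
      then show ?thesis using q(3) by (simp add: k_def)
    qed
    show False
    proof (cases "eval2 u1 p = 0")
      case True
      then show False using no_combination [of 1 0] by simp
    next
      case False
      then show False
        using no_combination [of "eval2 u2 p * eval2 v1 p" "- (eval2 u1 p * eval2 v2 p)"] uv by simp
    qed
  qed
  have one: "indep {1}"
    unfolding indep_def
  proof (intro allI impI)
    fix k :: "poly2 fract \<Rightarrow> real"
    assume "(\<Sum>q\<in>{1}. Fract (Const2 (k q)) 1 * q) \<in> local_ideal f g p"
    then have "Fract (Const2 (k 1)) 1 \<in> local_ideal f g p"
      by simp
    then obtain u1 v1 u2 v2 where uv: "eval2 v1 p \<noteq> 0" "eval2 v2 p \<noteq> 0"
      and "Fract (Const2 (k 1)) 1 = Fract u1 v1 * Fract f 1 + Fract u2 v2 * Fract g 1"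
      unfolding local_ideal_def local_ring_def by auto
    moreover have "v1 \<noteq> 0" "v2 \<noteq> 0"
      using uv eval2_nonzero by auto
    ultimately have "Const2 (k 1) * (v1 * v2) = u1 * f * v2 + u2 * g * v1"
      by (intro Fract_sum_eqD)
    then have "eval2 (Const2 (k 1) * (v1 * v2)) p = eval2 (u1 * f * v2 + u2 * g * v1) p"
      by (rule arg_cong)
    moreover have "eval2 f p = 0" "eval2 g p = 0"
      by (simp_all only: f g eval2_simps diff_self mult_zero_right add_0)
    ultimately have "k 1 * (eval2 v1 p * eval2 v2 p) = 0"
      by (simp only: eval2_simps mult_zero_left mult_zero_right add_0)
    then show "\<forall>q\<in>{1}. k q = 0"
      using uv by simp
  qed
  have "Fract 1 1 \<in> local_ring p"
    by (rule local_ringI) (simp only: eval2_simps one_neq_zero not_False_eq_True)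
  then have "1 \<in> local_ring p"
    by (simp only: One_fract_def)
  then have "{1} \<in> {Q. finite Q \<and> Q \<subseteq> local_ring p \<and> indep Q}"
    using one by blast
  then have "enat (card {1::poly2 fract}) \<le> (SUP Q \<in> {Q. finite Q \<and> Q \<subseteq> local_ring p \<and> indep Q}. enat (card Q))"
    by (rule SUP_upper)
  moreover have "(SUP Q \<in> {Q. finite Q \<and> Q \<subseteq> local_ring p \<and> indep Q}. enat (card Q)) \<le> enat 1"
    using upper by (intro SUP_least) simp
  moreover have "intersection_mult f g p =
      (SUP Q \<in> {Q. finite Q \<and> Q \<subseteq> local_ring p \<and> indep Q}. enat (card Q))"
    unfolding intersection_mult_def indep_def ..
  ultimately show ?thesis
    by (simp add: one_enat_def)
qed

section \<open>The area formula for local diffeomorphisms\<close>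

lemma locally_injective_if_det_nonzero:
  fixes g :: "real^'n::{finite,wellorder} \<Rightarrow> real^'n::_"
  assumes U: "open U" and der: "\<And>x. x \<in> U \<Longrightarrow> (g has_derivative g' x) (at x)"
    and cont: "continuous_on U (\<lambda>x. matrix (g' x))"
    and a: "a \<in> U" "det (matrix (g' a)) \<noteq> 0"
  obtains e where "e > 0" "ball a e \<subseteq> U" "inj_on g (ball a e)"
proof -
  let ?M = "\<lambda>x. matrix (g' x)"
  have M: "g' x v = ?M x *v v" if "x \<in> U" for x v
    using der [OF that] by (simp add: has_derivative_linear matrix_works)
  obtain B where inv: "B ** ?M a = mat 1"
    using a(2) unfolding invertible_det_nz [symmetric] invertible_def by blast
  have id: "(*v) B \<circ> g' a = id"
    by (auto simp: fun_eq_iff M [OF a(1)] matrix_vector_mul_assoc inv)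
  have close: "\<exists>d>0. \<forall>x. dist a x < d \<longrightarrow> onorm (\<lambda>v. g' x v - g' a v) < e" if "e > 0" for e
  proof -
  define n where "n = real (CARD('n)) * real (CARD('n))"
  have "n > 0"
    by (simp add: n_def)
  then have "e / (2 * n) > 0"
    using \<open>e > 0\<close> by simp
  then obtain d1 where d1: "d1 > 0" "\<And>x. x \<in> U \<Longrightarrow> dist x a < d1 \<Longrightarrow> dist (?M x) (?M a) < e / (2 * n)"
    using cont a(1) unfolding continuous_on_iff by metis
  obtain d2 where d2: "d2 > 0" "ball a d2 \<subseteq> U"
    using U a(1) open_contains_ball by metis
  show ?thesis
  proof (intro exI conjI allI impI)
    show "min d1 d2 > 0"
      using d1 d2 by simp
    fix x assume x: "dist a x < min d1 d2"
    then have xU: "x \<in> U"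
      using d2 by auto
    have "\<bar>(?M x - ?M a) $ i $ j\<bar> \<le> e / (2 * n)" for i j
    proof -
      have "\<bar>(?M x - ?M a) $ i $ j\<bar> \<le> norm ((?M x - ?M a) $ i)"
        by (rule component_le_norm_cart)
      also have "\<dots> \<le> norm (?M x - ?M a)"
        by (rule Finite_Cartesian_Product.norm_nth_le)
      also have "\<dots> < e / (2 * n)"
        using d1(2) [OF xU] x by (simp add: dist_commute [of a] dist_norm [symmetric])
      finally show ?thesis by simp
    qed
    then have "onorm ((*v) (?M x - ?M a)) \<le> n * (e / (2 * n))"
      unfolding n_def by (rule onorm_le_matrix_component)
    also have "\<dots> < e"
      using \<open>n > 0\<close> \<open>e > 0\<close> by simp
    also have "(*v) (?M x - ?M a) = (\<lambda>v. g' x v - g' a v)"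
      by (rule ext) (simp add: M [OF xU] M [OF a(1)] matrix_vector_mult_diff_rdistrib)
    finally show "onorm (\<lambda>v. g' x v - g' a v) < e" .
  qed
  qed
  show thesis
    using has_derivative_locally_injective [OF a(1) U matrix_vector_mul_bounded_linear id der close] that
    by blast
qed

text \<open>
  By Lindelof's theorem, countably many open sets on which \<open>g\<close> is injective cover \<open>U\<close>. Cutting
  them down to disjoint pieces, the number of preimages is the sum of the indicator functions of the
  images of the pieces, and the change of variables formula applies to each piece.
\<close>

theorem area_formula:
  fixes g :: "real^'n::{finite,wellorder} \<Rightarrow> real^'n::_"
  assumes U: "open U" and der: "\<And>x. x \<in> U \<Longrightarrow> (g has_derivative g' x) (at x)"
    and cont: "continuous_on U (\<lambda>x. matrix (g' x))"
    and nz: "\<And>x. x \<in> U \<Longrightarrow> det (matrix (g' x)) \<noteq> 0"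
    and I: "((\<lambda>x. \<bar>det (matrix (g' x))\<bar>) has_integral I) U"
  shows "(\<lambda>w. emeasure (count_space UNIV) {x \<in> U. g x = w}) \<in> borel_measurable lebesgue"
    and "(\<integral>\<^sup>+w. emeasure (count_space UNIV) {x \<in> U. g x = w} \<partial>lebesgue) = ennreal I"
proof -
  let ?J = "\<lambda>x. \<bar>det (matrix (g' x))\<bar>"
  define \<F> where "\<F> = {V. open V \<and> V \<subseteq> U \<and> inj_on g V}"
  obtain \<F>' where \<F>': "\<F>' \<subseteq> \<F>" "countable \<F>'" "\<Union>\<F>' = \<Union>\<F>"
    using Lindelof [of \<F>] by (auto simp: \<F>_def)
  have "\<Union>\<F> = U"
  proof
    show "U \<subseteq> \<Union>\<F>"
    proof
      fix x assume "x \<in> U"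
      with locally_injective_if_det_nonzero [OF U der cont this nz [OF this]]
      obtain e where "e > 0" "ball x e \<subseteq> U" "inj_on g (ball x e)" by metis
      then show "x \<in> \<Union>\<F>"
        by (auto simp: \<F>_def intro!: exI [of _ "ball x e"])
    qed
  qed (auto simp: \<F>_def)
  define V where "V = from_nat_into (insert {} \<F>')"
  have V: "V i \<in> \<F>" for i
    using from_nat_into [of "insert {} \<F>'" i] \<F>'(1) by (auto simp: V_def \<F>_def)
  have UV: "(\<Union>i. V i) = U"
    unfolding V_def using range_from_nat_into [of "insert {} \<F>'"] \<F>' \<open>\<Union>\<F> = U\<close> by simp
  define E where "E = disjointed V"
  have EV: "E i \<subseteq> V i" for i
    unfolding E_def by (rule disjointed_subset)
  have E_un: "(\<Union>i. E i) = U"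
    unfolding E_def UN_disjointed_eq UV ..
  have E_disj: "disjoint_family E"
    unfolding E_def by (rule disjoint_family_disjointed)
  have EU: "E i \<subseteq> U" for i
    using EV V by (force simp: \<F>_def)
  have inj: "inj_on g (E i)" for i
    using V [of i] EV [of i] by (auto simp: \<F>_def intro: inj_on_subset)
  have E_meas: "E i \<in> sets lebesgue" for i
  proof -
    have "range V \<subseteq> sets lebesgue"
      using V by (auto simp: \<F>_def)
    then show ?thesis
      unfolding E_def using sets.range_disjointed_sets by blast
  qed
  have der': "(g has_derivative g' x) (at x within E i)" if "x \<in> E i" for x i
    using der EU that by (meson has_derivative_at_withinI subsetD)
  have J_abs: "?J absolutely_integrable_on U"
    using I by (intro nonnegative_absolutely_integrable_1) (auto simp: has_integral_iff)
  have image: "g ` E i \<in> lmeasurable"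
    "emeasure lebesgue (g ` E i) = (\<integral>\<^sup>+x. ennreal (?J x) * indicator (E i) x \<partial>lebesgue)" for i
  proof -
    have "?J absolutely_integrable_on E i"
      using J_abs E_meas EU by (rule set_integrable_subset)
    then have J: "(?J has_integral integral (E i) ?J) (E i)"
      using set_lebesgue_integral_eq_integral(1) by blast
    with has_measure_differentiable_image [OF E_meas der' inj, of i "integral (E i) ?J"]
    have *: "g ` E i \<in> lmeasurable" "measure lebesgue (g ` E i) = integral (E i) ?J"
      by auto
    show "g ` E i \<in> lmeasurable" by fact
    have "emeasure lebesgue (g ` E i) = ennreal (integral (E i) ?J)"
      unfolding *(2) [symmetric] using fmeasurableD2 [OF *(1)] by (rule emeasure_eq_ennreal_measure)
    also have "\<dots> = (\<integral>\<^sup>+x. ennreal (?J x) * indicator (E i) x \<partial>lborel)"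
      by (rule nn_integral_has_integral_lebesgue' [OF _ J, symmetric]) simp
    also have "\<dots> = (\<integral>\<^sup>+x. ennreal (?J x) * indicator (E i) x \<partial>lebesgue)"
      by (rule nn_integral_completion [symmetric])
    finally show "emeasure lebesgue (g ` E i) = (\<integral>\<^sup>+x. ennreal (?J x) * indicator (E i) x \<partial>lebesgue)" .
  qed
  have J_meas: "(\<lambda>x. ennreal (?J x) * indicator (E i) x) \<in> borel_measurable lebesgue" for i
  proof -
    have "?J absolutely_integrable_on E i"
      using J_abs E_meas EU by (rule set_integrable_subset)
    then have "(\<lambda>x. indicator (E i) x *\<^sub>R ?J x) \<in> borel_measurable lebesgue"
      unfolding set_integrable_def by (rule borel_measurable_integrable)
    then have "(\<lambda>x. ennreal (indicator (E i) x *\<^sub>R ?J x)) \<in> borel_measurable lebesgue"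
      by measurable
    also have "(\<lambda>x. ennreal (indicator (E i) x *\<^sub>R ?J x)) = (\<lambda>x. ennreal (?J x) * indicator (E i) x)"
      by (auto simp: indicator_def)
    finally show ?thesis .
  qed
  have count: "emeasure (count_space UNIV) {x \<in> U. g x = w} = (\<Sum>i. indicator (g ` E i) w)" for w
  proof -
    have "{x \<in> U. g x = w} = (\<Union>i. {x \<in> E i. g x = w})"
      using E_un by auto
    also have "emeasure (count_space UNIV) \<dots> = (\<Sum>i. emeasure (count_space UNIV) {x \<in> E i. g x = w})"
      using E_disj by (intro suminf_emeasure [symmetric]) (auto simp: disjoint_family_on_def)
    also have "\<dots> = (\<Sum>i. indicator (g ` E i) w)"
    proof (rule arg_cong [where f = suminf], rule ext)
      fix i
      show "emeasure (count_space UNIV) {x \<in> E i. g x = w} = indicator (g ` E i) w"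
      proof (cases "w \<in> g ` E i")
        case True
        then obtain x where "x \<in> E i" "g x = w" by auto
        then have "{x \<in> E i. g x = w} = {x}"
          using inj [of i] by (auto simp: inj_on_def)
        then show ?thesis using True by simp
      next
        case False
        then have "{x \<in> E i. g x = w} = {}" by auto
        then have "emeasure (count_space UNIV) {x \<in> E i. g x = w} = 0"
          by (simp only: emeasure_empty)
        moreover have "indicator (g ` E i) w = (0 :: ennreal)"
          using False by (rule indicator_simps(2))
        ultimately show ?thesis by (simp only:)
      qed
    qed
    finally show ?thesis .
  qed
  show "(\<lambda>w. emeasure (count_space UNIV) {x \<in> U. g x = w}) \<in> borel_measurable lebesgue"
    unfolding count
    using fmeasurableD [OF image(1)] by (intro borel_measurable_suminf_order borel_measurable_indicator)
  have "(\<integral>\<^sup>+w. emeasure (count_space UNIV) {x \<in> U. g x = w} \<partial>lebesgue)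
      = (\<Sum>i. \<integral>\<^sup>+w. indicator (g ` E i) w \<partial>lebesgue)"
    unfolding count using fmeasurableD [OF image(1)] by (intro nn_integral_suminf borel_measurable_indicator)
  also have "\<dots> = (\<Sum>i. \<integral>\<^sup>+x. ennreal (?J x) * indicator (E i) x \<partial>lebesgue)"
    using fmeasurableD [OF image(1)] by (simp only: nn_integral_indicator image(2))
  also have "\<dots> = (\<integral>\<^sup>+x. (\<Sum>i. ennreal (?J x) * indicator (E i) x) \<partial>lebesgue)"
    using J_meas by (intro nn_integral_suminf [symmetric])
  also have "\<dots> = (\<integral>\<^sup>+x. ennreal (?J x) * indicator U x \<partial>lebesgue)"
    using suminf_indicator [OF E_disj] E_un by simp
  also have "\<dots> = (\<integral>\<^sup>+x. ennreal (?J x) * indicator U x \<partial>lborel)"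
    by (rule nn_integral_completion)
  also have "\<dots> = ennreal I"
    by (rule nn_integral_has_integral_lebesgue' [OF _ I]) simp
  finally show "(\<integral>\<^sup>+w. emeasure (count_space UNIV) {x \<in> U. g x = w} \<partial>lebesgue) = ennreal I" .
qed

section \<open>Integration and differentiation in coordinates of the plane\<close>

lemma vector_2_eta: "vector [z $ 1, z $ 2] = (z :: real^2)"
  by (simp add: vec_eq_iff forall_2)

lemma vector_2_eq_basis: "vector [x, y] = x *\<^sub>R axis 1 1 + y *\<^sub>R (axis 2 1 :: real^2)"
  by (simp add: vec_eq_iff forall_2 axis_def)

lemma vector_2_measurable:
  "(\<lambda>(x, y). vector [x, y] :: real^2) \<in> borel_measurable (lborel \<Otimes>\<^sub>M lborel)"
proof -
  have "continuous_on UNIV (\<lambda>p. vector [fst p, snd p] :: real^2)"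
    unfolding vector_2_eq_basis by (intro continuous_intros)
  then have "(\<lambda>p. vector [fst p, snd p] :: real^2) \<in> borel_measurable borel"
    by (rule borel_measurable_continuous_onI)
  then show ?thesis
    by (simp add: lborel_prod case_prod_beta)
qed

text \<open>This transfers Tonelli's theorem from pairs of reals to vectors.\<close>

lemma lborel_eq_distr_vector_2:
  "(lborel :: (real^2) measure) = distr (lborel \<Otimes>\<^sub>M lborel) borel (\<lambda>(x, y). vector [x, y])"
proof (rule lborel_eqI)
  fix l u :: "real^2"
  assume le: "\<And>b. b \<in> Basis \<Longrightarrow> l \<bullet> b \<le> u \<bullet> b"
  have Basis: "Basis = {axis 1 1, axis 2 1 :: real^2}"
    by (auto simp: Basis_vec_def UNIV_2)
  have ne: "axis 1 1 \<noteq> (axis 2 1 :: real^2)"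
    by (simp add: axis_eq_axis)
  have le': "l $ 1 \<le> u $ 1" "l $ 2 \<le> u $ 2"
    using le [of "axis 1 1"] le [of "axis 2 1"] by (auto simp: Basis inner_axis)
  have "(\<lambda>(x, y). vector [x, y]) -` box l u \<inter> space (lborel \<Otimes>\<^sub>M lborel)
      = {l $ 1 <..< u $ 1} \<times> {l $ 2 <..< u $ 2}"
    by (auto simp: mem_box_cart forall_2 space_pair_measure)
  then have "emeasure (distr (lborel \<Otimes>\<^sub>M lborel) borel (\<lambda>(x, y). vector [x, y])) (box l u)
      = emeasure (lborel \<Otimes>\<^sub>M lborel) ({l $ 1 <..< u $ 1} \<times> {l $ 2 <..< u $ 2})"
    using vector_2_measurable by (simp add: emeasure_distr)
  also have "\<dots> = ennreal (u $ 1 - l $ 1) * ennreal (u $ 2 - l $ 2)"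
    using le' by (simp add: lborel.emeasure_pair_measure_Times)
  also have "\<dots> = ennreal (\<Prod>b\<in>Basis. (u - l) \<bullet> b)"
    using le' ne by (simp add: Basis inner_axis ennreal_mult')
  finally show "emeasure (distr (lborel \<Otimes>\<^sub>M lborel) borel (\<lambda>(x, y). vector [x, y])) (box l u)
      = ennreal (\<Prod>b\<in>Basis. (u - l) \<bullet> b)" .
qed simp

lemma has_integral_Tonelli_vector_2:
  fixes f :: "real \<Rightarrow> real \<Rightarrow> real"
  assumes meas: "(\<lambda>z::real^2. f (z $ 1) (z $ 2)) \<in> borel_measurable borel"
    and A: "A \<in> sets borel" and B: "B \<in> sets borel"
    and nonneg: "\<And>x y. x \<in> A \<Longrightarrow> y \<in> B \<Longrightarrow> 0 \<le> f x y"
    and inner: "\<And>y. y \<in> B \<Longrightarrow> ((\<lambda>x. f x y) has_integral k y) A"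
    and outer: "(k has_integral I) B"
  shows "((\<lambda>z::real^2. f (z $ 1) (z $ 2)) has_integral I) {z. z $ 1 \<in> A \<and> z $ 2 \<in> B}"
proof -
  let ?P = "{z::real^2. z $ 1 \<in> A \<and> z $ 2 \<in> B}"
  define h where "h z = (if z \<in> ?P then f (z $ 1) (z $ 2) else 0)" for z :: "real^2"
  have P: "?P \<in> sets borel"
  proof -
    have "(\<lambda>z::real^2. z $ 1) \<in> borel_measurable borel" "(\<lambda>z::real^2. z $ 2) \<in> borel_measurable borel"
      by (auto intro!: borel_measurable_continuous_onI continuous_intros)
    from measurable_sets [OF this(1) A] measurable_sets [OF this(2) B]
    have "(\<lambda>z::real^2. z $ 1) -` A \<inter> (\<lambda>z::real^2. z $ 2) -` B \<in> sets borel"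
      by (auto intro: sets.Int)
    then show ?thesis
      by (simp add: vimage_def Collect_conj_eq)
  qed
  have h_meas: "h \<in> borel_measurable borel"
    unfolding h_def by (intro measurable_If_set meas) (use P in simp_all)
  have h0: "0 \<le> h z" for z
    using nonneg by (simp add: h_def)
  have k0: "0 \<le> k y" if "y \<in> B" for y
    using inner [OF that] nonneg [OF _ that] by (rule has_integral_nonneg)
  have I0: "0 \<le> I"
    using outer k0 by (rule has_integral_nonneg)
  have hv_meas: "(\<lambda>p. ennreal (h (case p of (x, y) \<Rightarrow> vector [x, y]))) \<in> borel_measurable (lborel \<Otimes>\<^sub>M lborel)"
    using measurable_compose [OF vector_2_measurable h_meas] by measurable
  have "(\<integral>\<^sup>+z. ennreal (h z) \<partial>lborel)
      = (\<integral>\<^sup>+p. ennreal (h (case p of (x, y) \<Rightarrow> vector [x, y])) \<partial>(lborel \<Otimes>\<^sub>M lborel))"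
    unfolding lborel_eq_distr_vector_2
    using h_meas vector_2_measurable by (subst nn_integral_distr) auto
  also have "\<dots> = (\<integral>\<^sup>+y. \<integral>\<^sup>+x. ennreal (h (vector [x, y])) \<partial>lborel \<partial>lborel)"
    using lborel_pair.nn_integral_snd [OF hv_meas] by simp
  also have "\<dots> = (\<integral>\<^sup>+y. ennreal (k y) * indicator B y \<partial>lborel)"
  proof (rule nn_integral_cong)
    fix y
    show "(\<integral>\<^sup>+x. ennreal (h (vector [x, y])) \<partial>lborel) = ennreal (k y) * indicator B y"
    proof (cases "y \<in> B")
      case True
      have "(\<integral>\<^sup>+x. ennreal (h (vector [x, y])) \<partial>lborel) = (\<integral>\<^sup>+x. ennreal (f x y) * indicator A x \<partial>lborel)"
        using True by (intro nn_integral_cong) (auto simp: h_def indicator_def)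
      also have "\<dots> = ennreal (k y)"
        using nonneg [OF _ True] inner [OF True] by (rule nn_integral_has_integral_lebesgue')
      finally show ?thesis using True by simp
    next
      case False
      then show ?thesis by (simp add: h_def)
    qed
  qed
  also have "\<dots> = ennreal I"
    using k0 outer by (rule nn_integral_has_integral_lebesgue')
  finally have "(h has_integral I) UNIV"
    using h_meas h0 I0 by (intro nn_integral_has_integral) auto
  then show ?thesis
    unfolding h_def by (simp only: has_integral_restrict_UNIV)
qed

lemma vec_nth_has_derivative: "((\<lambda>z. z $ k) has_derivative (\<lambda>h. h $ k)) net"
  by (rule bounded_linear_imp_has_derivative [OF bounded_linear_vec_nth])

lemma has_derivative_vector_2:
  assumes "(f has_derivative f') (at x within S)" "(g has_derivative g') (at x within S)"
  shows "((\<lambda>z. vector [f z, g z] :: real^2) has_derivative (\<lambda>h. vector [f' h, g' h])) (at x within S)"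
  unfolding vector_2_eq_basis using assms by (intro derivative_intros)

lemma det_matrix_vector_2:
  "det (matrix (\<lambda>h::real^2. vector [p * h $ 1 + q * h $ 2, u * h $ 1 + v * h $ 2] :: real^2)) = p * v - q * u"
  by (simp add: det_2 matrix_def axis_def)

section \<open>The support function of the ellipse\<close>

definition ell_support :: "real \<Rightarrow> real \<Rightarrow> real \<Rightarrow> real" where
  "ell_support a b \<phi> = sqrt (a\<^sup>2 * (cos \<phi>)\<^sup>2 + b\<^sup>2 * (sin \<phi>)\<^sup>2)"

definition ell_curv_radius :: "real \<Rightarrow> real \<Rightarrow> real \<Rightarrow> real" where
  "ell_curv_radius a b \<phi> = a\<^sup>2 * b\<^sup>2 / ell_support a b \<phi> ^ 3"

lemma cos_sq_sin_sq: "(cos \<phi>)\<^sup>2 = 1 - (sin \<phi> :: real)\<^sup>2"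
  by (simp add: cos_squared_eq)

lemma ell_support_sq: "(ell_support a b \<phi>)\<^sup>2 = a\<^sup>2 * (cos \<phi>)\<^sup>2 + b\<^sup>2 * (sin \<phi>)\<^sup>2"
  unfolding ell_support_def by simp

lemma ell_support_bounds:
  assumes "0 < b" "b \<le> a"
  shows "b \<le> ell_support a b \<phi>" "ell_support a b \<phi> \<le> a" "0 < ell_support a b \<phi>"
proof -
  have ab: "b\<^sup>2 \<le> a\<^sup>2"
    using assms by (intro power_mono) auto
  have "b\<^sup>2 = b\<^sup>2 * (cos \<phi>)\<^sup>2 + b\<^sup>2 * (sin \<phi>)\<^sup>2"
    by (simp add: cos_sq_sin_sq algebra_simps)
  also have "\<dots> \<le> a\<^sup>2 * (cos \<phi>)\<^sup>2 + b\<^sup>2 * (sin \<phi>)\<^sup>2"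
    using ab by (intro add_mono mult_right_mono) auto
  finally show "b \<le> ell_support a b \<phi>"
    unfolding ell_support_def by (rule real_le_rsqrt)
  then show "0 < ell_support a b \<phi>"
    using assms by linarith
  have "a\<^sup>2 * (cos \<phi>)\<^sup>2 + b\<^sup>2 * (sin \<phi>)\<^sup>2 \<le> a\<^sup>2 * (cos \<phi>)\<^sup>2 + a\<^sup>2 * (sin \<phi>)\<^sup>2"
    using ab by (intro add_mono mult_right_mono) auto
  also have "\<dots> = a\<^sup>2"
    by (simp add: cos_sq_sin_sq algebra_simps)
  finally show "ell_support a b \<phi> \<le> a"
    unfolding ell_support_def using assms by (intro real_le_lsqrt) auto
qed

lemma ell_support_DERIV:
  assumes "0 < b" "b \<le> a"
  shows "(ell_support a b has_real_derivative
    - (a\<^sup>2 - b\<^sup>2) * sin \<phi> * cos \<phi> / ell_support a b \<phi>) (at \<phi>)"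
proof -
  have "0 < ell_support a b \<phi>"
    by (rule ell_support_bounds(3) [OF assms])
  then show ?thesis
    unfolding ell_support_def
    by (auto intro!: derivative_eq_intros simp: divide_simps) (simp add: algebra_simps)
qed

text \<open>
  The square of the support function is \<open>(a\<^sup>2 - b\<^sup>2) cos\<^sup>2 \<psi> + b\<^sup>2 = a\<^sup>2 - (a\<^sup>2 - b\<^sup>2) sin\<^sup>2 \<psi>\<close>. The
  lower bound is the Cauchy-Schwarz inequality for the vectors \<open>(c cos \<psi>, b)\<close> with
  \<open>c\<^sup>2 = a\<^sup>2 - b\<^sup>2\<close>, and the upper bound the reversed inequality for the vectors
  \<open>(a, c sin \<psi>)\<close> and the Lorentzian form.
\<close>

lemma ell_support_mult_ge:
  assumes "0 < b" "b \<le> a"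
  shows "(a\<^sup>2 - b\<^sup>2) * cos \<psi> * cos \<phi> + b\<^sup>2 \<le> ell_support a b \<psi> * ell_support a b \<phi>"
proof (rule power2_le_imp_le)
  have ab: "b\<^sup>2 \<le> a\<^sup>2"
    using assms by (intro power_mono) auto
  have "0 \<le> (a\<^sup>2 - b\<^sup>2) * b\<^sup>2 * (cos \<psi> - cos \<phi>)\<^sup>2"
    using ab by simp
  then show "((a\<^sup>2 - b\<^sup>2) * cos \<psi> * cos \<phi> + b\<^sup>2)\<^sup>2 \<le> (ell_support a b \<psi> * ell_support a b \<phi>)\<^sup>2"
    unfolding power_mult_distrib ell_support_sq sin_squared_eq
    by (simp add: power2_eq_square algebra_simps)
  show "0 \<le> ell_support a b \<psi> * ell_support a b \<phi>"
    unfolding ell_support_def by simp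
qed

lemma ell_support_mult_le:
  assumes "0 < b" "b \<le> a"
  shows "ell_support a b \<psi> * ell_support a b \<phi> \<le> a\<^sup>2 - (a\<^sup>2 - b\<^sup>2) * sin \<psi> * sin \<phi>"
proof (rule power2_le_imp_le)
  have ab: "b\<^sup>2 \<le> a\<^sup>2"
    using assms by (intro power_mono) auto
  have "0 \<le> (a\<^sup>2 - b\<^sup>2) * a\<^sup>2 * (sin \<psi> - sin \<phi>)\<^sup>2"
    using ab by simp
  then show "(ell_support a b \<psi> * ell_support a b \<phi>)\<^sup>2 \<le> (a\<^sup>2 - (a\<^sup>2 - b\<^sup>2) * sin \<psi> * sin \<phi>)\<^sup>2"
    unfolding power_mult_distrib ell_support_sq cos_squared_eq
    by (simp add: power2_eq_square algebra_simps)
  have "\<bar>sin \<psi> * sin \<phi>\<bar> \<le> 1 * 1"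
    unfolding abs_mult by (intro mult_mono) auto
  then have "(a\<^sup>2 - b\<^sup>2) * (sin \<psi> * sin \<phi>) \<le> (a\<^sup>2 - b\<^sup>2) * 1"
    using ab by (intro mult_left_mono) auto
  then show "0 \<le> a\<^sup>2 - (a\<^sup>2 - b\<^sup>2) * sin \<psi> * sin \<phi>"
    by (simp add: mult.assoc) (smt (verit) zero_le_power2)
qed


section \<open>Bodies bounded by parallel curves of the ellipse\<close>

text \<open>
  For \<open>s = 1\<close> these are the positions at which the elliptic region contains the disk (or, with
  \<open>-r\<close> instead of \<open>r\<close>, meets it), for \<open>s = -1\<close> those at which it is contained in the disk.
\<close>

definition parallel_body :: "real \<Rightarrow> real \<Rightarrow> real \<Rightarrow> real \<Rightarrow> (real^2) set" where
  "parallel_body s a b r = {w. \<forall>\<phi>. w $ 1 * cos \<phi> + w $ 2 * sin \<phi> \<le> s * (ell_support a b \<phi> - r)}"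

text \<open>
  The point of the ellipse with normal angle \<open>\<psi>\<close> is \<open>(a\<^sup>2 cos \<psi>, b\<^sup>2 sin \<psi>)\<close> divided by the support.
  The parallel curve is at distance \<open>r\<close> from it on the inner normal; for \<open>s = -1\<close> the curve is
  reflected in the origin, so that \<open>\<psi>\<close> remains the normal angle of the body.
\<close>

definition parallel_curve1 :: "real \<Rightarrow> real \<Rightarrow> real \<Rightarrow> real \<Rightarrow> real \<Rightarrow> real" where
  "parallel_curve1 s a b r \<psi> = s * (cos \<psi> * (a\<^sup>2 / ell_support a b \<psi> - r))"

definition parallel_curve2 :: "real \<Rightarrow> real \<Rightarrow> real \<Rightarrow> real \<Rightarrow> real \<Rightarrow> real" where
  "parallel_curve2 s a b r \<psi> = s * (sin \<psi> * (b\<^sup>2 / ell_support a b \<psi> - r))"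

lemma parallel_body_reflect:
  assumes i: "i = 1 \<or> i = -1" and j: "j = 1 \<or> j = -1"
  shows "vector [i * w $ 1, j * w $ 2] \<in> parallel_body s a b r \<longleftrightarrow> w \<in> parallel_body s a b r"
proof -
  have flip: "vector [i * w $ 1, j * w $ 2] \<in> parallel_body s a b r"
    if w: "w \<in> parallel_body s a b r" and ij: "i = 1 \<or> i = -1" "j = 1 \<or> j = -1" for i j w
  proof -
    have "i * w $ 1 * cos \<phi> + j * w $ 2 * sin \<phi> \<le> s * (ell_support a b \<phi> - r)" for \<phi>
    proof -
      obtain \<phi>' where \<phi>': "cos \<phi>' = i * cos \<phi>" "sin \<phi>' = j * sin \<phi>"
      proof -
        have "cos (pi - \<phi>) = - cos \<phi>" "sin (pi - \<phi>) = sin \<phi>" "cos (pi + \<phi>) = - cos \<phi>" "sin (pi + \<phi>) = - sin \<phi>"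
          by (simp_all add: cos_diff sin_diff cos_add sin_add)
        then show thesis
          using ij that [of \<phi>] that [of "- \<phi>"] that [of "pi - \<phi>"] that [of "pi + \<phi>"] by auto
      qed
      have "i\<^sup>2 = 1" "j\<^sup>2 = 1"
        using ij by auto
      then have "ell_support a b \<phi>' = ell_support a b \<phi>"
        by (simp add: ell_support_def \<phi>' power_mult_distrib)
      then show ?thesis
        using w \<phi>' unfolding parallel_body_def mem_Collect_eq by (metis mult.assoc mult.commute)
    qed
    then show ?thesis
      by (simp add: parallel_body_def)
  qed
  let ?v = "vector [i * w $ 1, j * w $ 2] :: real^2"
  have "i * (i * w $ 1) = w $ 1" "j * (j * w $ 2) = w $ 2"
    using i j by auto
  then have "vector [i * ?v $ 1, j * ?v $ 2] = w"
    by (simp only: vector_2 vector_2_eta)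
  then show ?thesis
    using flip [OF _ i j, of w] flip [OF _ i j, of ?v] by metis
qed

lemma parallel_curve_support:
  assumes "0 < b" "b \<le> a"
  shows "parallel_curve1 s a b r \<psi> * cos \<psi> + parallel_curve2 s a b r \<psi> * sin \<psi>
    = s * (ell_support a b \<psi> - r)"
proof -
  have h: "0 < ell_support a b \<psi>"
    by (rule ell_support_bounds(3) [OF assms])
  have "parallel_curve1 s a b r \<psi> * cos \<psi> + parallel_curve2 s a b r \<psi> * sin \<psi>
    = s * ((a\<^sup>2 * (cos \<psi>)\<^sup>2 + b\<^sup>2 * (sin \<psi>)\<^sup>2) / ell_support a b \<psi> - r * ((cos \<psi>)\<^sup>2 + (sin \<psi>)\<^sup>2))"
    by (simp add: parallel_curve1_def parallel_curve2_def power2_eq_square algebra_simps add_divide_distrib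
        del: sin_cos_squared_add sin_cos_squared_add2 sin_cos_squared_add3)
  also have "\<dots> = s * (ell_support a b \<psi> - r)"
    unfolding ell_support_sq [symmetric] sin_cos_squared_add2 using h by (simp add: power2_eq_square)
  finally show ?thesis .
qed

text \<open>
  Under this condition, the point of the curve lies in the closed quadrant of the direction \<open>\<psi>\<close>.
  The claim is strongest for \<open>r\<close> at the bound, where it is, up to the factor
  \<open>ell_support a b \<psi>\<close>, one of the two inequalities above.
\<close>

lemma parallel_curve_le:
  assumes ab: "0 < b" "b \<le> a"
    and s: "s = 1 \<and> r * ell_support a b \<psi> \<le> b\<^sup>2 \<or> s = -1 \<and> a\<^sup>2 \<le> r * ell_support a b \<psi>"
  shows "parallel_curve1 s a b r \<psi> * cos \<phi> + parallel_curve2 s a b r \<psi> * sin \<phi>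
    \<le> s * (ell_support a b \<phi> - r)"
proof -
  define h where "h = ell_support a b"
  define k where "k = 1 - (cos \<psi> * cos \<phi> + sin \<psi> * sin \<phi>)"
  have h: "0 < h \<psi>"
    unfolding h_def by (rule ell_support_bounds(3) [OF ab])
  have k: "0 \<le> k"
    using cos_diff [of \<psi> \<phi>] cos_le_one [of "\<psi> - \<phi>"] by (simp add: k_def)
  have *: "h \<psi> * (s * (h \<phi> - r) - (parallel_curve1 s a b r \<psi> * cos \<phi> + parallel_curve2 s a b r \<psi> * sin \<phi>))
      = s * (h \<psi> * h \<phi> - (a\<^sup>2 * cos \<psi> * cos \<phi> + b\<^sup>2 * sin \<psi> * sin \<phi>) - r * h \<psi> * k)"
    using h unfolding parallel_curve1_def parallel_curve2_def k_def h_def [symmetric]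
    by (simp add: field_simps)
  have "0 \<le> s * (h \<psi> * h \<phi> - (a\<^sup>2 * cos \<psi> * cos \<phi> + b\<^sup>2 * sin \<psi> * sin \<phi>) - r * h \<psi> * k)"
    using s
  proof
    assume s: "s = 1 \<and> r * ell_support a b \<psi> \<le> b\<^sup>2"
    then have "r * h \<psi> * k \<le> b\<^sup>2 * k"
      using k by (intro mult_right_mono) (auto simp: h_def)
    then show ?thesis
      using s ell_support_mult_ge [OF ab, of \<psi> \<phi>] by (simp add: h_def k_def algebra_simps)
  next
    assume s: "s = -1 \<and> a\<^sup>2 \<le> r * ell_support a b \<psi>"
    then have "a\<^sup>2 * k \<le> r * h \<psi> * k"
      using k by (intro mult_right_mono) (auto simp: h_def)
    then show ?thesis
      using s ell_support_mult_le [OF ab, of \<psi> \<phi>] by (simp add: h_def k_def algebra_simps)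
  qed
  then show ?thesis
    unfolding * [symmetric] using h by (simp add: zero_le_mult_iff h_def)
qed

lemma parallel_curve_DERIV:
  assumes ab: "0 < b" "b \<le> a"
  shows "(parallel_curve1 s a b r has_real_derivative - s * (ell_curv_radius a b \<psi> - r) * sin \<psi>) (at \<psi>)"
    and "(parallel_curve2 s a b r has_real_derivative s * (ell_curv_radius a b \<psi> - r) * cos \<psi>) (at \<psi>)"
proof -
  define h where "h = ell_support a b \<psi>"
  have h: "0 < h"
    unfolding h_def by (rule ell_support_bounds(3) [OF ab])
  have h2: "h\<^sup>2 = a\<^sup>2 * (cos \<psi>)\<^sup>2 + b\<^sup>2 * (sin \<psi>)\<^sup>2"
    unfolding h_def by (rule ell_support_sq)
  have "a\<^sup>2 * (- sin \<psi> * h\<^sup>2 + cos \<psi> * ((a\<^sup>2 - b\<^sup>2) * sin \<psi> * cos \<psi>)) = - a\<^sup>2 * b\<^sup>2 * sin \<psi>"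
    using h2 sin_cos_squared_add [of \<psi>] by algebra
  moreover have "s * (- sin \<psi> * (a\<^sup>2 / h - r) + cos \<psi> * (a\<^sup>2 * ((a\<^sup>2 - b\<^sup>2) * sin \<psi> * cos \<psi> / h) / h\<^sup>2))
      = s * (a\<^sup>2 * (- sin \<psi> * h\<^sup>2 + cos \<psi> * ((a\<^sup>2 - b\<^sup>2) * sin \<psi> * cos \<psi>)) / h ^ 3 + r * sin \<psi>)"
    using h by (simp add: field_simps power2_eq_square power3_eq_cube)
  ultimately have 1: "s * (- sin \<psi> * (a\<^sup>2 / h - r) + cos \<psi> * (a\<^sup>2 * ((a\<^sup>2 - b\<^sup>2) * sin \<psi> * cos \<psi> / h) / h\<^sup>2))
      = - s * (a\<^sup>2 * b\<^sup>2 / h ^ 3 - r) * sin \<psi>"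
    by (simp only:) (simp add: algebra_simps)
  show "(parallel_curve1 s a b r has_real_derivative - s * (ell_curv_radius a b \<psi> - r) * sin \<psi>) (at \<psi>)"
    unfolding parallel_curve1_def ell_curv_radius_def h_def [symmetric] 1 [symmetric]
    using h ell_support_DERIV [OF ab, of \<psi>]
    by (auto intro!: derivative_eq_intros simp: h_def power2_eq_square) (simp_all add: field_simps)
  have "b\<^sup>2 * (cos \<psi> * h\<^sup>2 + sin \<psi> * ((a\<^sup>2 - b\<^sup>2) * sin \<psi> * cos \<psi>)) = a\<^sup>2 * b\<^sup>2 * cos \<psi>"
    using h2 sin_cos_squared_add [of \<psi>] by algebra
  moreover have "s * (cos \<psi> * (b\<^sup>2 / h - r) + sin \<psi> * (b\<^sup>2 * ((a\<^sup>2 - b\<^sup>2) * sin \<psi> * cos \<psi> / h) / h\<^sup>2))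
      = s * (b\<^sup>2 * (cos \<psi> * h\<^sup>2 + sin \<psi> * ((a\<^sup>2 - b\<^sup>2) * sin \<psi> * cos \<psi>)) / h ^ 3 - r * cos \<psi>)"
    using h by (simp add: field_simps power2_eq_square power3_eq_cube)
  ultimately have 2: "s * (cos \<psi> * (b\<^sup>2 / h - r) + sin \<psi> * (b\<^sup>2 * ((a\<^sup>2 - b\<^sup>2) * sin \<psi> * cos \<psi> / h) / h\<^sup>2))
      = s * (a\<^sup>2 * b\<^sup>2 / h ^ 3 - r) * cos \<psi>"
    by (simp only:) (simp add: algebra_simps)
  show "(parallel_curve2 s a b r has_real_derivative s * (ell_curv_radius a b \<psi> - r) * cos \<psi>) (at \<psi>)"
    unfolding parallel_curve2_def ell_curv_radius_def h_def [symmetric] 2 [symmetric]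
    using h ell_support_DERIV [OF ab, of \<psi>]
    by (auto intro!: derivative_eq_intros simp: h_def power2_eq_square) (simp_all add: field_simps)
qed

text \<open>
  In the open quadrant of the direction \<open>\<psi>\<close> the curve also stays away from its cusps, where \<open>r\<close> is
  the radius of curvature: the product of support and radius of curvature lies between \<open>b\<^sup>2\<close> and
  \<open>a\<^sup>2\<close>.
\<close>

lemma parallel_curve_pos:
  assumes ab: "0 < b" "b \<le> a" and \<psi>: "0 < \<psi>" "\<psi> < pi / 2"
    and s: "s = 1 \<and> r * ell_support a b \<psi> < b\<^sup>2 \<or> s = -1 \<and> a\<^sup>2 < r * ell_support a b \<psi>"
  shows "0 < parallel_curve1 s a b r \<psi>" "0 < parallel_curve2 s a b r \<psi>"
    "0 < s * (ell_curv_radius a b \<psi> - r)"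
proof -
  define h where "h = ell_support a b \<psi>"
  have h: "0 < h" "b \<le> h" "h \<le> a"
    unfolding h_def using ell_support_bounds [OF ab] by auto
  have trig: "0 < cos \<psi>" "0 < sin \<psi>"
    using \<psi> by (auto intro: cos_gt_zero sin_gt_zero)
  have sq: "b\<^sup>2 \<le> h\<^sup>2" "h\<^sup>2 \<le> a\<^sup>2"
    using h ab by (auto intro!: power_mono)
  have \<rho>: "ell_curv_radius a b \<psi> * h = a\<^sup>2 * b\<^sup>2 / h\<^sup>2"
    using h by (simp add: ell_curv_radius_def h_def [symmetric] power2_eq_square power3_eq_cube)
  have \<rho>_ge: "b\<^sup>2 \<le> ell_curv_radius a b \<psi> * h"
    unfolding \<rho> using sq h ab by (simp add: divide_simps mult.commute mult_left_mono)
  have \<rho>_le: "ell_curv_radius a b \<psi> * h \<le> a\<^sup>2"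
    unfolding \<rho> using sq h ab by (simp add: divide_simps mult_left_mono)
  have "0 < s * (a\<^sup>2 / h - r) \<and> 0 < s * (b\<^sup>2 / h - r) \<and> 0 < s * (ell_curv_radius a b \<psi> - r)"
    using s
  proof
    assume s: "s = 1 \<and> r * ell_support a b \<psi> < b\<^sup>2"
    then have "r * h < a\<^sup>2" "r * h < b\<^sup>2" "r * h < ell_curv_radius a b \<psi> * h"
      using sq \<rho>_ge by (auto simp: h_def)
    then show ?thesis
      using s h by (auto simp: field_simps mult_less_cancel_right)
  next
    assume s: "s = -1 \<and> a\<^sup>2 < r * ell_support a b \<psi>"
    then have "a\<^sup>2 < r * h" "b\<^sup>2 < r * h" "ell_curv_radius a b \<psi> * h < r * h"
      using sq \<rho>_le by (auto simp: h_def)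
    then show ?thesis
      using s h by (auto simp: field_simps mult_less_cancel_right)
  qed
  then show "0 < parallel_curve1 s a b r \<psi>" "0 < parallel_curve2 s a b r \<psi>"
    "0 < s * (ell_curv_radius a b \<psi> - r)"
    using trig by (auto simp: parallel_curve1_def parallel_curve2_def h_def [symmetric] mult.left_commute [of s])
qed

lemma continuous_on_ell_support: "continuous_on A (ell_support a b)"
  unfolding ell_support_def by (intro continuous_intros)

lemma continuous_on_ell_curv_radius:
  assumes "0 < b" "b \<le> a"
  shows "continuous_on A (ell_curv_radius a b)"
  unfolding ell_curv_radius_def
  using ell_support_bounds(3) [OF assms] by (intro continuous_intros continuous_on_ell_support) (auto simp: less_imp_neq [THEN not_sym])

text \<open>
  An open quadrant of the body is swept out radially by the arc of the parallel curve in that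
  quadrant: the ray through a point of the quadrant meets the arc by the intermediate value
  theorem, and the support inequality at the point where it does so gives the factor at most \<open>1\<close>.
  The support inequality also determines that factor, and the angle is determined by the
  monotonicity of the first coordinate, so the parametrization is injective.
\<close>

lemma measure_parallel_body_quadrant:
  assumes ab: "0 < b" "b \<le> a"
    and \<psi>: "0 \<le> \<psi>0" "\<psi>0 < \<psi>1" "\<psi>1 \<le> pi / 2"
    and pos: "\<And>\<phi>. 0 < s * (ell_support a b \<phi> - r)"
    and range: "\<And>\<psi>. \<psi>0 < \<psi> \<Longrightarrow> \<psi> < \<psi>1 \<Longrightarrow>
      s = 1 \<and> r * ell_support a b \<psi> < b\<^sup>2 \<or> s = -1 \<and> a\<^sup>2 < r * ell_support a b \<psi>"
    and ends: "parallel_curve2 s a b r \<psi>0 = 0" "parallel_curve1 s a b r \<psi>1 = 0"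
    and J: "((\<lambda>\<psi>. (ell_support a b \<psi> - r) * (ell_curv_radius a b \<psi> - r)) has_integral J) {\<psi>0..\<psi>1}"
    and ij: "i = 1 \<or> i = -1" "j = 1 \<or> j = -1"
  shows "parallel_body s a b r \<inter> {w. 0 < i * w $ 1 \<and> 0 < j * w $ 2} \<in> lmeasurable"
    "measure lebesgue (parallel_body s a b r \<inter> {w. 0 < i * w $ 1 \<and> 0 < j * w $ 2}) = J / 2"
proof -
  define x y where "x = parallel_curve1 s a b r" and "y = parallel_curve2 s a b r"
  define p where "p \<phi> = s * (ell_support a b \<phi> - r)" for \<phi>
  define \<rho> where "\<rho> = ell_curv_radius a b"
  define K where "K = parallel_body s a b r"
  define R where "R = {z::real^2. z $ 1 \<in> {0<..1} \<and> z $ 2 \<in> {\<psi>0<..<\<psi>1}}"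
  define \<Phi> where "\<Phi> z = (vector [i * (z $ 1 * x (z $ 2)), j * (z $ 1 * y (z $ 2))] :: real^2)" for z :: "real^2"
  let ?Q = "{w. 0 < i * w $ 1 \<and> 0 < j * w $ 2}"
  define \<Phi>' where "\<Phi>' z = (\<lambda>h::real^2. (vector
      [i * x (z $ 2) * h $ 1 + i * z $ 1 * (- s * (\<rho> (z $ 2) - r) * sin (z $ 2)) * h $ 2,
       j * y (z $ 2) * h $ 1 + j * z $ 1 * (s * (\<rho> (z $ 2) - r) * cos (z $ 2)) * h $ 2] :: real^2))" for z :: "real^2"
  have s: "s = 1 \<or> s = -1"
    using range [of "(\<psi>0 + \<psi>1) / 2"] \<psi> by (auto simp: field_simps)
  have ii: "i * i = 1" "j * j = 1" "s * s = 1"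
    using ij s by auto
  have support: "x \<psi> * cos \<psi> + y \<psi> * sin \<psi> = p \<psi>" for \<psi>
    unfolding x_def y_def p_def by (rule parallel_curve_support [OF ab])
  have le: "x \<psi> * cos \<phi> + y \<psi> * sin \<phi> \<le> p \<phi>" if "\<psi>0 < \<psi>" "\<psi> < \<psi>1" for \<psi> \<phi>
    unfolding x_def y_def p_def using range [OF that] by (intro parallel_curve_le [OF ab]) auto
  have xy_pos: "0 < x \<psi>" "0 < y \<psi>" "0 < s * (\<rho> \<psi> - r)" if "\<psi>0 < \<psi>" "\<psi> < \<psi>1" for \<psi>
    unfolding x_def y_def \<rho>_def using parallel_curve_pos [OF ab _ _ range [OF that]] that \<psi> by auto
  have x_DERIV: "(x has_real_derivative - s * (\<rho> \<psi> - r) * sin \<psi>) (at \<psi>)"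
    and y_DERIV: "(y has_real_derivative s * (\<rho> \<psi> - r) * cos \<psi>) (at \<psi>)" for \<psi>
    unfolding x_def y_def \<rho>_def by (rule parallel_curve_DERIV [OF ab])+
  have x_anti: "x v < x u" if "\<psi>0 < u" "u < v" "v < \<psi>1" for u v
  proof (rule DERIV_neg_imp_decreasing [OF \<open>u < v\<close>])
    fix t assume t: "u \<le> t" "t \<le> v"
    then have "0 < sin t" "0 < s * (\<rho> t - r)"
      using that \<psi> xy_pos(3) [of t] by (auto intro: sin_gt_zero)
    then have "- s * (\<rho> t - r) * sin t < 0"
      by (simp add: zero_less_mult_iff mult_less_0_iff)
    then show "\<exists>d. (x has_real_derivative d) (at t) \<and> d < 0"
      using x_DERIV by blast
  qed
  \<comment> \<open>The support inequality at \<open>\<psi>'\<close>, applied to the common point of the two rays.\<close>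
  have scale: "\<mu> \<le> l" if "0 \<le> l" and \<psi>: "\<psi>0 < \<psi>" "\<psi> < \<psi>1"
    and eq: "l * x \<psi> = \<mu> * x \<psi>'" "l * y \<psi> = \<mu> * y \<psi>'" for l \<mu> \<psi> \<psi>'
  proof -
    have "\<mu> * p \<psi>' = l * (x \<psi> * cos \<psi>' + y \<psi> * sin \<psi>')"
      unfolding support [symmetric] using eq by (simp add: distrib_left mult.assoc [symmetric])
    also have "\<dots> \<le> l * p \<psi>'"
      using le [OF \<psi>] \<open>0 \<le> l\<close> by (rule mult_left_mono)
    finally show ?thesis
      by (rule mult_right_le_imp_le) (use pos [of \<psi>'] in \<open>simp add: p_def\<close>)
  qed
  have inj: "inj_on \<Phi> R"
  proof (rule inj_onI)
    fix z z' assume z: "z \<in> R" "z' \<in> R" and eq: "\<Phi> z = \<Phi> z'"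
    from eq have "i * (i * (z $ 1 * x (z $ 2))) = i * (i * (z' $ 1 * x (z' $ 2)))"
        "j * (j * (z $ 1 * y (z $ 2))) = j * (j * (z' $ 1 * y (z' $ 2)))"
      unfolding \<Phi>_def vec_eq_iff forall_2 vector_2 by auto
    then have eq: "z $ 1 * x (z $ 2) = z' $ 1 * x (z' $ 2)" "z $ 1 * y (z $ 2) = z' $ 1 * y (z' $ 2)"
      unfolding mult.assoc [symmetric] ii by auto
    have "z $ 1 = z' $ 1"
      using scale [of "z $ 1" "z $ 2", OF _ _ _ eq] scale [of "z' $ 1" "z' $ 2", OF _ _ _ eq [symmetric]] z
      by (auto simp: R_def)
    with eq z have "x (z $ 2) = x (z' $ 2)"
      by (auto simp: R_def)
    then have "z $ 2 = z' $ 2"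
      using x_anti [of "z $ 2" "z' $ 2"] x_anti [of "z' $ 2" "z $ 2"] z by (fastforce simp: R_def)
    with \<open>z $ 1 = z' $ 1\<close> show "z = z'"
      by (simp add: vec_eq_iff forall_2)
  qed
  have image: "\<Phi> ` R = K \<inter> ?Q"
  proof (intro equalityI subsetI)
    fix w assume "w \<in> \<Phi> ` R"
    then obtain z where z: "z \<in> R" and w: "w = \<Phi> z" by auto
    then have z': "0 < z $ 1" "z $ 1 \<le> 1" "\<psi>0 < z $ 2" "z $ 2 < \<psi>1"
      by (auto simp: R_def)
    have "vector [z $ 1 * x (z $ 2), z $ 1 * y (z $ 2)] \<in> K"
      unfolding K_def parallel_body_def
    proof (intro CollectI allI)
      fix \<phi>
      have "z $ 1 * (x (z $ 2) * cos \<phi> + y (z $ 2) * sin \<phi>) \<le> z $ 1 * p \<phi>"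
        using z' by (intro mult_left_mono le) auto
      also have "\<dots> \<le> 1 * p \<phi>"
        using z' pos [of \<phi>] by (intro mult_right_mono) (auto simp: p_def)
      finally show "(vector [z $ 1 * x (z $ 2), z $ 1 * y (z $ 2)] :: real^2) $ 1 * cos \<phi>
          + (vector [z $ 1 * x (z $ 2), z $ 1 * y (z $ 2)] :: real^2) $ 2 * sin \<phi> \<le> s * (ell_support a b \<phi> - r)"
        by (simp add: p_def algebra_simps)
    qed
    then have "w \<in> K"
      using parallel_body_reflect [OF ij, of "vector [z $ 1 * x (z $ 2), z $ 1 * y (z $ 2)]"]
      by (simp add: K_def w \<Phi>_def)
    moreover have "0 < i * w $ 1" "0 < j * w $ 2"
      using ii z' xy_pos [OF z'(3,4)] by (simp_all add: w \<Phi>_def mult.assoc [symmetric])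
    ultimately show "w \<in> K \<inter> ?Q" by simp
  next
    fix w assume w: "w \<in> K \<inter> ?Q"
    define u v where "u = i * w $ 1" and "v = j * w $ 2"
    have uv: "0 < u" "0 < v"
      using w by (auto simp: u_def v_def)
    have uv_K: "vector [u, v] \<in> K"
      using w parallel_body_reflect [OF ij, of w] by (simp add: u_def v_def K_def)
    \<comment> \<open>A zero of \<open>c\<close> is an angle at which the curve meets the line through the origin and \<open>(u, v)\<close>.\<close>
    define c where "c \<psi> = v * x \<psi> - u * y \<psi>" for \<psi>
    have cont: "continuous_on {\<psi>0..\<psi>1} c"
      unfolding c_def using x_DERIV y_DERIV
      by (intro continuous_intros) (meson DERIV_isCont continuous_at_imp_continuous_on)+
    have "0 < x \<psi>0"
    proof -
      have "x \<psi>0 * cos \<psi>0 = p \<psi>0"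
        using support [of \<psi>0] ends by (simp add: y_def)
      moreover have "0 \<le> cos \<psi>0"
        using \<psi> by (intro cos_ge_zero) auto
      ultimately show ?thesis
        using pos [of \<psi>0] unfolding p_def [symmetric] by (metis zero_less_mult_pos2 mult_zero_right order_le_less)
    qed
    then have c0: "0 < c \<psi>0"
      using uv ends by (simp add: c_def y_def)
    have "0 < y \<psi>1"
    proof -
      have "y \<psi>1 * sin \<psi>1 = p \<psi>1"
        using support [of \<psi>1] ends by (simp add: x_def)
      moreover have "0 \<le> sin \<psi>1"
        using \<psi> by (intro sin_ge_zero) auto
      ultimately show ?thesis
        using pos [of \<psi>1] unfolding p_def [symmetric] by (metis zero_less_mult_pos2 mult_zero_right order_le_less)
    qed
    then have c1: "c \<psi>1 < 0"
      using uv ends by (simp add: c_def x_def)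
    obtain \<psi> where "\<psi>0 \<le> \<psi>" "\<psi> \<le> \<psi>1" and c: "c \<psi> = 0"
      using IVT2' [of c \<psi>1 0 \<psi>0] c0 c1 cont \<psi> by auto
    then have \<psi>': "\<psi>0 < \<psi>" "\<psi> < \<psi>1"
      using c0 c1 by (auto simp: less_le)
    define l where "l = u / x \<psi>"
    have l: "0 < l" "u = l * x \<psi>"
      using uv xy_pos [OF \<psi>'] by (auto simp: l_def)
    have l': "v = l * y \<psi>"
      using c xy_pos [OF \<psi>'] by (simp add: c_def l_def field_simps)
    have "u * cos \<psi> + v * sin \<psi> \<le> p \<psi>"
      using uv_K by (simp add: K_def parallel_body_def p_def)
    also have "u * cos \<psi> + v * sin \<psi> = l * p \<psi>"
      unfolding support [symmetric] using l(2) l' by (simp add: algebra_simps)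
    finally have "l * p \<psi> \<le> 1 * p \<psi>"
      by simp
    then have "l \<le> 1"
      by (rule mult_right_le_imp_le) (use pos [of \<psi>] in \<open>simp add: p_def\<close>)
    then have "vector [l, \<psi>] \<in> R"
      using l \<psi>' by (simp add: R_def)
    moreover have "w = \<Phi> (vector [l, \<psi>])"
    proof -
      have "w $ 1 = i * u" "w $ 2 = j * v"
        by (simp_all add: u_def v_def mult.assoc [symmetric] ii)
      then show ?thesis
        by (simp add: \<Phi>_def vec_eq_iff forall_2 l(2) l')
    qed
    ultimately show "w \<in> \<Phi> ` R" by blast
  qed
  have \<Phi>_deriv: "(\<Phi> has_derivative \<Phi>' z) (at z within R)" for z
  proof -
    have x: "((\<lambda>z::real^2. x (z $ 2)) has_derivative (\<lambda>h. h $ 2 * (- s * (\<rho> (z $ 2) - r) * sin (z $ 2)))) (at z within R)"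
      by (rule DERIV_compose_FDERIV [OF x_DERIV vec_nth_has_derivative])
    have y: "((\<lambda>z::real^2. y (z $ 2)) has_derivative (\<lambda>h. h $ 2 * (s * (\<rho> (z $ 2) - r) * cos (z $ 2)))) (at z within R)"
      by (rule DERIV_compose_FDERIV [OF y_DERIV vec_nth_has_derivative])
    show ?thesis
      unfolding \<Phi>_def \<Phi>'_def
      by (rule has_derivative_eq_rhs [OF has_derivative_vector_2]) (auto intro!: derivative_eq_intros x y vec_nth_has_derivative simp: algebra_simps)
  qed
  have det: "\<bar>det (matrix (\<Phi>' z))\<bar> = z $ 1 * ((ell_support a b (z $ 2) - r) * (\<rho> (z $ 2) - r))" if "z \<in> R" for z
  proof -
    have "det (matrix (\<Phi>' z)) = i * j * (z $ 1 * (s * (\<rho> (z $ 2) - r)) * p (z $ 2))"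
      unfolding \<Phi>'_def det_matrix_vector_2 support [symmetric] by (simp add: algebra_simps)
    moreover have "0 < z $ 1 * (s * (\<rho> (z $ 2) - r)) * p (z $ 2)"
      unfolding p_def by (rule mult_pos_pos [OF mult_pos_pos [OF _ xy_pos(3)] pos]) (use that in \<open>auto simp: R_def\<close>)
    ultimately have "\<bar>det (matrix (\<Phi>' z))\<bar> = z $ 1 * (s * (\<rho> (z $ 2) - r)) * p (z $ 2)"
      using ij by (elim disjE) (simp_all only: mult_1 mult_minus1 mult_minus1_right abs_minus_cancel minus_minus abs_of_pos)
    also have "\<dots> = (s * s) * (z $ 1 * ((ell_support a b (z $ 2) - r) * (\<rho> (z $ 2) - r)))"
      by (simp add: p_def)
    finally show ?thesis
      by (simp add: ii)
  qed
  have "((\<lambda>z::real^2. z $ 1 * ((ell_support a b (z $ 2) - r) * (\<rho> (z $ 2) - r))) has_integral J / 2) R"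
    unfolding R_def
  proof (rule has_integral_Tonelli_vector_2 [where k = "\<lambda>t. (ell_support a b t - r) * (\<rho> t - r) / 2"])
    have "continuous_on UNIV (\<lambda>z::real^2. z $ 1 * ((ell_support a b (z $ 2) - r) * (\<rho> (z $ 2) - r)))"
      unfolding \<rho>_def
      by (intro continuous_intros continuous_on_compose2 [OF continuous_on_ell_support [of UNIV]]
        continuous_on_compose2 [OF continuous_on_ell_curv_radius [OF ab, of UNIV]]) auto
    then show "(\<lambda>z::real^2. z $ 1 * ((ell_support a b (z $ 2) - r) * (\<rho> (z $ 2) - r))) \<in> borel_measurable borel"
      by (rule borel_measurable_continuous_onI)
    fix t assume t: "t \<in> {\<psi>0<..<\<psi>1}"
    show "0 \<le> l * ((ell_support a b t - r) * (\<rho> t - r))" if l: "l \<in> {0<..1}" for l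
    proof -
      have "0 < (s * (ell_support a b t - r)) * (s * (\<rho> t - r))"
        by (rule mult_pos_pos [OF pos xy_pos(3)]) (use t in auto)
      also have "\<dots> = (s * s) * ((ell_support a b t - r) * (\<rho> t - r))"
        by (simp only: ac_simps)
      finally show ?thesis
        using l by (simp add: ii)
    qed
    define q where "q = (ell_support a b t - r) * (\<rho> t - r)"
    have "((\<lambda>l. l * q) has_integral q / 2) {0..1}"
    proof -
      have "((\<lambda>l. l * q) has_integral (1\<^sup>2 / 2 * q - 0\<^sup>2 / 2 * q)) {0..1::real}"
        by (rule fundamental_theorem_of_calculus)
          (auto intro!: derivative_eq_intros simp: has_real_derivative_iff_has_vector_derivative [symmetric])
      then show ?thesis by simp
    qed
    then show "((\<lambda>l. l * q) has_integral q / 2) {0<..1}"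
      by (rule iffD1 [OF has_integral_spike_set_eq, rotated 2]) (auto intro: negligible_subset [of "{0}"])
  next
    show "((\<lambda>t. (ell_support a b t - r) * (\<rho> t - r) / 2) has_integral J / 2) {\<psi>0<..<\<psi>1}"
      using has_integral_divide [OF J, of 2] unfolding has_integral_Icc_iff_Ioo \<rho>_def .
  qed auto
  then have "((\<lambda>z. \<bar>det (matrix (\<Phi>' z))\<bar>) has_integral J / 2) R"
    by (rule has_integral_eq [rotated]) (simp add: det)
  moreover have "R \<in> sets lebesgue"
  proof -
    have "R = {z. 0 < z $ 1} \<inter> {z. z $ 1 \<le> 1} \<inter> {z. \<psi>0 < z $ 2} \<inter> {z. z $ 2 < \<psi>1}"
      by (auto simp: R_def)
    also have "\<dots> \<in> sets borel"
      by (intro sets.Int borel_open borel_closed open_Collect_less closed_Collect_le continuous_intros)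
    finally show ?thesis by simp
  qed
  ultimately show "K \<inter> ?Q \<in> lmeasurable" "measure lebesgue (K \<inter> ?Q) = J / 2"
    using has_measure_differentiable_image [of R \<Phi> \<Phi>' "J / 2", OF _ \<Phi>_deriv inj] unfolding image by auto
qed

lemma negligible_vec_nth_zero: "negligible {w::real^'n. w $ k = 0}"
  using negligible_standard_hyperplane [of "axis k 1 :: real^'n" 0]
  by (simp add: inner_axis axis_in_Basis_iff Basis_real_def)

text \<open>The four open quadrants contribute equally, and the coordinate axes are negligible.\<close>

lemma measure_parallel_body:
  assumes ab: "0 < b" "b \<le> a"
    and \<psi>: "0 \<le> \<psi>0" "\<psi>0 < \<psi>1" "\<psi>1 \<le> pi / 2"
    and pos: "\<And>\<phi>. 0 < s * (ell_support a b \<phi> - r)"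
    and range: "\<And>\<psi>. \<psi>0 < \<psi> \<Longrightarrow> \<psi> < \<psi>1 \<Longrightarrow>
      s = 1 \<and> r * ell_support a b \<psi> < b\<^sup>2 \<or> s = -1 \<and> a\<^sup>2 < r * ell_support a b \<psi>"
    and ends: "parallel_curve2 s a b r \<psi>0 = 0" "parallel_curve1 s a b r \<psi>1 = 0"
    and J: "((\<lambda>\<psi>. (ell_support a b \<psi> - r) * (ell_curv_radius a b \<psi> - r)) has_integral J) {\<psi>0..\<psi>1}"
  shows "parallel_body s a b r \<in> lmeasurable" "measure lebesgue (parallel_body s a b r) = 2 * J"
proof -
  define Q where "Q ij = parallel_body s a b r \<inter> {w. 0 < fst ij * w $ 1 \<and> 0 < snd ij * w $ 2}" for ij :: "real \<times> real"
  define U where "U = (\<Union>ij\<in>{1, -1} \<times> {1, -1}. Q ij)"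
  have Q: "Q ij \<in> lmeasurable" "measure lebesgue (Q ij) = J / 2" if signs: "ij \<in> {1, -1} \<times> {1, -1}" for ij
  proof -
    obtain i j where ij: "ij = (i, j)" "i = 1 \<or> i = -1" "j = 1 \<or> j = -1"
      using signs by auto
    show "Q ij \<in> lmeasurable" "measure lebesgue (Q ij) = J / 2"
      unfolding Q_def ij(1) fst_conv snd_conv
      by (rule measure_parallel_body_quadrant [OF ab \<psi> pos range ends J ij(2,3)]; assumption)+
  qed
  have U: "U \<in> lmeasurable"
    unfolding U_def by (intro fmeasurable.finite_UN Q) auto
  have "measure lebesgue U = (\<Sum>ij\<in>{1, -1} \<times> {1, -1}. measure lebesgue (Q ij))"
    unfolding U_def
  proof (rule measure_finite_Union)
    show "disjoint_family_on Q ({1, - 1} \<times> {1, - 1})"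
      by (auto simp: disjoint_family_on_def Q_def)
    show "Q ` ({1, - 1} \<times> {1, - 1}) \<subseteq> sets lebesgue"
      using Q(1) by (auto simp: fmeasurable_def)
    show "emeasure lebesgue (Q ij) \<noteq> \<infinity>" if "ij \<in> {1, - 1} \<times> {1, - 1}" for ij
      using fmeasurableD2 [OF Q(1) [OF that]] by simp
  qed simp
  also have "\<dots> = (\<Sum>ij\<in>{1, -1::real} \<times> {1, -1::real}. J / 2)"
    using Q(2) by (intro sum.cong) auto
  also have "\<dots> = 2 * J"
    by (simp add: card_cartesian_product)
  finally have m: "measure lebesgue U = 2 * J" .
  have "parallel_body s a b r - U \<union> (U - parallel_body s a b r) \<subseteq> {w. w $ 1 = 0} \<union> {w. w $ 2 = 0}"
    by (auto simp: U_def Q_def)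
  then have neg: "negligible (parallel_body s a b r - U \<union> (U - parallel_body s a b r))"
    by (rule negligible_subset [rotated]) (intro negligible_Un negligible_vec_nth_zero)
  then show "parallel_body s a b r \<in> lmeasurable"
    using lmeasurable_negligible_symdiff [OF U] by (simp add: Un_commute)
  show "measure lebesgue (parallel_body s a b r) = 2 * J"
    using measure_negligible_symdiff [OF U] neg m by (simp add: Un_commute)
qed

section \<open>The area function as an antiderivative\<close>

lemma eccentricity_sq:
  assumes "0 < b" "b \<le> a"
  shows "a\<^sup>2 * (eccentricity a b)\<^sup>2 = a\<^sup>2 - b\<^sup>2"
  using assms by (simp add: eccentricity_def power_divide power_mono)

lemma mult_sqrt_eccentricity:
  assumes "0 < b" "b \<le> a"
  shows "a * sqrt (1 - (eccentricity a b)\<^sup>2 * (sin \<phi>)\<^sup>2) = ell_support a b \<phi>"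
proof -
  have "a * sqrt (1 - (eccentricity a b)\<^sup>2 * (sin \<phi>)\<^sup>2)
      = sqrt (a\<^sup>2 * (1 - (eccentricity a b)\<^sup>2 * (sin \<phi>)\<^sup>2))"
    using assms by (simp add: real_sqrt_mult)
  also have "a\<^sup>2 * (1 - (eccentricity a b)\<^sup>2 * (sin \<phi>)\<^sup>2) = a\<^sup>2 * (cos \<phi>)\<^sup>2 + b\<^sup>2 * (sin \<phi>)\<^sup>2"
    using eccentricity_sq [OF assms] sin_cos_squared_add [of \<phi>] by algebra
  finally show ?thesis
    by (simp add: ell_support_def)
qed

lemma mult_ell_E:
  assumes "0 < b" "b \<le> a"
  shows "a * ell_E \<phi> (eccentricity a b) = integral {0..\<phi>} (ell_support a b)"
  unfolding ell_E_def integral_mult_right [symmetric] mult_sqrt_eccentricity [OF assms] ..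

text \<open>
  Subtracting the angle \<open>\<phi>\<close> from the arctangent gives an expression without a pole at
  \<open>\<pi>/2\<close>, so the conventional value of \<open>F\<close> there is the continuous one.
\<close>

lemma arctan_mult_tan:
  assumes ab: "0 < b" "b \<le> a" and \<phi>: "0 \<le> \<phi>" "\<phi> < pi / 2"
  shows "arctan (b / a * tan \<phi>)
    = \<phi> - arctan ((a - b) * sin \<phi> * cos \<phi> / (a * (cos \<phi>)\<^sup>2 + b * (sin \<phi>)\<^sup>2))"
proof (rule arctan_unique)
  define q where "q = (a - b) * sin \<phi> * cos \<phi> / (a * (cos \<phi>)\<^sup>2 + b * (sin \<phi>)\<^sup>2)"
  have trig: "0 < cos \<phi>" "0 \<le> sin \<phi>"
    using \<phi> by (auto intro: cos_gt_zero_pi sin_ge_zero)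
  define t where "t = tan \<phi>"
  have t: "0 \<le> t" "sin \<phi> = t * cos \<phi>"
    using trig by (auto simp: t_def tan_def)
  have D: "0 < a + b * t\<^sup>2"
    using ab by (intro add_pos_nonneg) auto
  have "a * (cos \<phi>)\<^sup>2 + b * (sin \<phi>)\<^sup>2 = (a + b * t\<^sup>2) * (cos \<phi>)\<^sup>2"
    "(a - b) * sin \<phi> * cos \<phi> = ((a - b) * t) * (cos \<phi>)\<^sup>2"
    by (simp_all add: t(2) power2_eq_square algebra_simps)
  then have "q = ((a - b) * t * (cos \<phi>)\<^sup>2) / ((a + b * t\<^sup>2) * (cos \<phi>)\<^sup>2)"
    unfolding q_def by (simp only:)
  then have q: "q = (a - b) * t / (a + b * t\<^sup>2)"
    using trig by simp
  then have "0 \<le> q"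
    using ab D t by simp
  then show low: "- (pi / 2) < \<phi> - arctan q"
    using \<phi> arctan_ubound [of q] by linarith
  show up: "\<phi> - arctan q < pi / 2"
    using \<phi> \<open>0 \<le> q\<close> zero_le_arctan_iff [of q] by linarith
  have "tan (\<phi> - arctan q) = (t - q) / (1 + t * q)"
    using tan_diff [of \<phi> "arctan q"] trig cos_gt_zero_pi [OF low up] by (simp add: tan_arctan t_def)
  also have "\<dots> = (b * t * (1 + t\<^sup>2)) / (a * (1 + t\<^sup>2))"
  proof -
    have "1 + t * q = a * (1 + t\<^sup>2) / (a + b * t\<^sup>2)" "t - q = b * t * (1 + t\<^sup>2) / (a + b * t\<^sup>2)"
      unfolding q using D by (simp_all add: divide_simps) (simp_all add: algebra_simps power2_eq_square)
    then show ?thesis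
      using D by simp
  qed
  also have "\<dots> = b / a * tan \<phi>"
    using add_pos_nonneg [of 1 "t\<^sup>2"] by (simp add: t_def)
  finally show "tan (\<phi> - arctan q) = b / a * tan \<phi>" .
qed

lemma F_eq:
  assumes ab: "0 < b" "b \<le> a" and \<phi>: "0 \<le> \<phi>" "\<phi> \<le> pi / 2"
  shows "F a b r \<phi> = 2 * r\<^sup>2 * \<phi>
    + 2 * a * b * (\<phi> - arctan ((a - b) * sin \<phi> * cos \<phi> / (a * (cos \<phi>)\<^sup>2 + b * (sin \<phi>)\<^sup>2)))
    - 4 * r * integral {0..\<phi>} (ell_support a b)
    + 2 * r * (a\<^sup>2 - b\<^sup>2) * (sin \<phi> * cos \<phi> / ell_support a b \<phi>)"
proof -
  have "(if \<phi> = pi / 2 then pi / 2 else arctan (b / a * tan \<phi>))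
    = \<phi> - arctan ((a - b) * sin \<phi> * cos \<phi> / (a * (cos \<phi>)\<^sup>2 + b * (sin \<phi>)\<^sup>2))"
  proof (cases "\<phi> = pi / 2")
    case True
    then have "cos \<phi> = 0"
      by (simp only: cos_pi_half)
    with True show ?thesis by simp
  qed (use arctan_mult_tan [OF ab \<phi>(1)] \<phi>(2) in simp)
  moreover have "r * a * (eccentricity a b)\<^sup>2 * sin (2 * \<phi>) / sqrt (1 - (eccentricity a b)\<^sup>2 * (sin \<phi>)\<^sup>2)
      = 2 * r * (a\<^sup>2 - b\<^sup>2) * (sin \<phi> * cos \<phi> / ell_support a b \<phi>)"
    unfolding mult_sqrt_eccentricity [OF ab, symmetric] eccentricity_sq [OF ab, symmetric] sin_double
    using ab by (simp add: power2_eq_square)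
  moreover have "4 * r * a * ell_E \<phi> (eccentricity a b) = 4 * r * integral {0..\<phi>} (ell_support a b)"
    unfolding mult_ell_E [OF ab, symmetric] by simp
  ultimately show ?thesis
    unfolding F_def Let_def by (simp only:)
qed

lemma F_0: "F a b r 0 = 0"
  by (simp add: F_def ell_E_def)

lemma A_star_eq: "A_star a b r = pi * r\<^sup>2 + pi * a * b - 4 * r * a * complete_ell_E (eccentricity a b)"
  by (simp add: A_star_def F_def Let_def complete_ell_E_def)

text \<open>
  The integrand is twice the rate at which the parallel curve sweeps out area, so \<open>F\<close> is four times
  the signed area of the sector between the angles \<open>0\<close> and \<open>\<phi>\<close>.
\<close>

lemma F_has_integral:
  assumes ab: "0 < b" "b \<le> a" and uv: "0 \<le> u" "u \<le> v" "v \<le> pi / 2"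
  shows "((\<lambda>\<psi>. (ell_support a b \<psi> - r) * (ell_curv_radius a b \<psi> - r)) has_integral (F a b r v - F a b r u) / 2) {u..v}"
proof -
  have deriv: "(F a b r has_real_derivative 2 * ((ell_support a b \<psi> - r) * (ell_curv_radius a b \<psi> - r)))
      (at \<psi> within {0..pi / 2})" if \<psi>: "\<psi> \<in> {0..pi / 2}" for \<psi>
  proof -
    define h where "h = ell_support a b \<psi>"
    define S C where "S = sin \<psi>" and "C = cos \<psi>"
    define D where "D = a * C\<^sup>2 + b * S\<^sup>2"
    have h: "0 < h"
      unfolding h_def by (rule ell_support_bounds [OF ab])
    have h2: "h\<^sup>2 = a\<^sup>2 * C\<^sup>2 + b\<^sup>2 * S\<^sup>2"
      unfolding h_def S_def C_def by (rule ell_support_sq)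
    have SC: "S\<^sup>2 + C\<^sup>2 = 1"
      by (simp add: S_def C_def)
    have D: "0 < D"
    proof -
      have "b * (C\<^sup>2 + S\<^sup>2) \<le> D"
        unfolding D_def distrib_left using ab by (intro add_mono mult_right_mono) auto
      then show ?thesis using SC ab by (simp add: add.commute)
    qed
    have E: "((\<lambda>\<phi>. integral {0..\<phi>} (ell_support a b)) has_real_derivative h) (at \<psi> within {0..pi / 2})"
      unfolding h_def by (rule integral_has_real_derivative [OF continuous_on_ell_support \<psi>])
    have q: "((\<lambda>\<phi>. (a - b) * sin \<phi> * cos \<phi> / (a * (cos \<phi>)\<^sup>2 + b * (sin \<phi>)\<^sup>2)) has_real_derivative
        (a - b) * ((C\<^sup>2 - S\<^sup>2) * D + 2 * (a - b) * S\<^sup>2 * C\<^sup>2) / D\<^sup>2) (at \<psi> within {0..pi / 2})"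
      using D unfolding D_def S_def C_def
      by (auto intro!: derivative_eq_intros simp: field_simps power2_eq_square)
    have A: "((\<lambda>\<phi>. arctan ((a - b) * sin \<phi> * cos \<phi> / (a * (cos \<phi>)\<^sup>2 + b * (sin \<phi>)\<^sup>2))) has_real_derivative
        1 - a * b / h\<^sup>2) (at \<psi> within {0..pi / 2})"
    proof (rule DERIV_cong [OF DERIV_chain2 [OF DERIV_arctan q]])
      define w where "w = (a - b) * S * C"
      have "1 + (w / D)\<^sup>2 = (D\<^sup>2 + w\<^sup>2) / D\<^sup>2"
        using D by (simp add: power_divide add_divide_distrib)
      moreover have "D\<^sup>2 + w\<^sup>2 = h\<^sup>2"
        using h2 SC unfolding D_def w_def by algebra
      moreover have "(a - b) * ((C\<^sup>2 - S\<^sup>2) * D + 2 * (a - b) * S\<^sup>2 * C\<^sup>2) = h\<^sup>2 - a * b"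
        using h2 SC unfolding D_def by algebra
      ultimately have "inverse (1 + (w / D)\<^sup>2) * ((a - b) * ((C\<^sup>2 - S\<^sup>2) * D + 2 * (a - b) * S\<^sup>2 * C\<^sup>2) / D\<^sup>2)
          = inverse (h\<^sup>2 / D\<^sup>2) * ((h\<^sup>2 - a * b) / D\<^sup>2)"
        by (simp only:)
      also have "\<dots> = 1 - a * b / h\<^sup>2"
        using h D by (simp add: field_simps)
      finally show "inverse (1 + ((a - b) * sin \<psi> * cos \<psi> / (a * (cos \<psi>)\<^sup>2 + b * (sin \<psi>)\<^sup>2))\<^sup>2) *
          ((a - b) * ((C\<^sup>2 - S\<^sup>2) * D + 2 * (a - b) * S\<^sup>2 * C\<^sup>2) / D\<^sup>2) = 1 - a * b / h\<^sup>2"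
        unfolding w_def D_def S_def C_def .
    qed
    have sc: "((\<lambda>\<phi>. sin \<phi> * cos \<phi> / ell_support a b \<phi>) has_real_derivative
        ((C\<^sup>2 - S\<^sup>2) * h - S * C * (- (a\<^sup>2 - b\<^sup>2) * S * C / h)) / (h * h)) (at \<psi> within {0..pi / 2})"
      unfolding h_def S_def C_def
      by (rule DERIV_cong [OF DERIV_divide [OF DERIV_mult [OF DERIV_sin DERIV_cos, THEN has_field_derivative_at_within]
            ell_support_DERIV [OF ab, THEN has_field_derivative_at_within]]])
        (use h in \<open>auto simp: h_def power2_eq_square algebra_simps\<close>)
    have "((\<lambda>\<phi>. 2 * r\<^sup>2 * \<phi>
        + 2 * a * b * (\<phi> - arctan ((a - b) * sin \<phi> * cos \<phi> / (a * (cos \<phi>)\<^sup>2 + b * (sin \<phi>)\<^sup>2)))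
        - 4 * r * integral {0..\<phi>} (ell_support a b)
        + 2 * r * (a\<^sup>2 - b\<^sup>2) * (sin \<phi> * cos \<phi> / ell_support a b \<phi>)) has_real_derivative
        2 * r\<^sup>2 * 1 + 2 * a * b * (1 - (1 - a * b / h\<^sup>2)) - 4 * r * h
        + 2 * r * (a\<^sup>2 - b\<^sup>2) * (((C\<^sup>2 - S\<^sup>2) * h - S * C * (- (a\<^sup>2 - b\<^sup>2) * S * C / h)) / (h * h)))
        (at \<psi> within {0..pi / 2})"
      by (intro DERIV_add DERIV_diff DERIV_cmult DERIV_ident A E sc)
    moreover have "2 * r\<^sup>2 * 1 + 2 * a * b * (1 - (1 - a * b / h\<^sup>2)) - 4 * r * h
        + 2 * r * (a\<^sup>2 - b\<^sup>2) * (((C\<^sup>2 - S\<^sup>2) * h - S * C * (- (a\<^sup>2 - b\<^sup>2) * S * C / h)) / (h * h))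
        = 2 * ((h - r) * (a\<^sup>2 * b\<^sup>2 / h ^ 3 - r))"
    proof -
      have "h * (h * h ^ 2 - (a\<^sup>2 - b\<^sup>2) * (C\<^sup>2 - S\<^sup>2) * h) - (a\<^sup>2 - b\<^sup>2)\<^sup>2 * S\<^sup>2 * C\<^sup>2 = a\<^sup>2 * b\<^sup>2"
        using h2 SC by algebra
      then show ?thesis
        using h by (simp add: field_simps) algebra
    qed
    ultimately have "((\<lambda>\<phi>. 2 * r\<^sup>2 * \<phi>
        + 2 * a * b * (\<phi> - arctan ((a - b) * sin \<phi> * cos \<phi> / (a * (cos \<phi>)\<^sup>2 + b * (sin \<phi>)\<^sup>2)))
        - 4 * r * integral {0..\<phi>} (ell_support a b)
        + 2 * r * (a\<^sup>2 - b\<^sup>2) * (sin \<phi> * cos \<phi> / ell_support a b \<phi>)) has_real_derivative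
        2 * ((ell_support a b \<psi> - r) * (ell_curv_radius a b \<psi> - r))) (at \<psi> within {0..pi / 2})"
      by (simp only: h_def ell_curv_radius_def)
    then show ?thesis
      by (rule has_field_derivative_transform_within [where d = 1]) (use \<psi> F_eq [OF ab] in auto)
  qed
  have "((\<lambda>\<psi>. 2 * ((ell_support a b \<psi> - r) * (ell_curv_radius a b \<psi> - r))) has_integral F a b r v - F a b r u) {u..v}"
  proof (rule fundamental_theorem_of_calculus [OF uv(2)])
    fix \<psi> assume "\<psi> \<in> {u..v}"
    then have "(F a b r has_real_derivative 2 * ((ell_support a b \<psi> - r) * (ell_curv_radius a b \<psi> - r))) (at \<psi> within {u..v})"
      using uv by (intro has_field_derivative_subset [OF deriv]) auto
    then show "(F a b r has_vector_derivative 2 * ((ell_support a b \<psi> - r) * (ell_curv_radius a b \<psi> - r))) (at \<psi> within {u..v})"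
      by (simp add: has_real_derivative_iff_has_vector_derivative)
  qed
  from has_integral_mult_right [OF this, of "1 / 2"] show ?thesis
    by simp
qed

section \<open>Areas of the parallel bodies\<close>

lemma ell_support_strict:
  assumes ab: "0 < b" "b < a"
  shows "0 < sin \<phi> \<Longrightarrow> ell_support a b \<phi> < a" "0 < cos \<phi> \<Longrightarrow> b < ell_support a b \<phi>"
proof -
  have sq: "b\<^sup>2 < a\<^sup>2"
    using ab by (intro power_strict_mono) auto
  show "ell_support a b \<phi> < a" if "0 < sin \<phi>"
  proof (rule power_less_imp_less_base)
    have "b\<^sup>2 * (sin \<phi>)\<^sup>2 < a\<^sup>2 * (sin \<phi>)\<^sup>2"
      using sq that by (intro mult_strict_right_mono) auto
    then show "(ell_support a b \<phi>)\<^sup>2 < a\<^sup>2"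
      unfolding ell_support_sq cos_sq_sin_sq by (simp add: algebra_simps)
  qed (use ab in simp)
  show "b < ell_support a b \<phi>" if "0 < cos \<phi>"
  proof (rule power_less_imp_less_base)
    have "b\<^sup>2 * (cos \<phi>)\<^sup>2 < a\<^sup>2 * (cos \<phi>)\<^sup>2"
      using sq that by (intro mult_strict_right_mono) auto
    then show "b\<^sup>2 < (ell_support a b \<phi>)\<^sup>2"
      unfolding ell_support_sq sin_squared_eq by (simp add: algebra_simps)
  qed (simp add: ell_support_def)
qed

lemma ell_support_strict_anti:
  assumes ab: "0 < b" "b < a" and "0 \<le> \<phi>" "\<phi> < \<psi>" "\<psi> \<le> pi / 2"
  shows "ell_support a b \<psi> < ell_support a b \<phi>"
proof (rule power_less_imp_less_base)
  have sq: "b\<^sup>2 < a\<^sup>2"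
    using ab by (intro power_strict_mono) auto
  have "sin \<phi> < sin \<psi>"
    using assms by (intro sin_monotone_2pi) auto
  moreover have "0 \<le> sin \<phi>"
    using assms by (intro sin_ge_zero) auto
  ultimately have "(sin \<phi>)\<^sup>2 < (sin \<psi>)\<^sup>2"
    by (intro power_strict_mono) auto
  then have "(a\<^sup>2 - b\<^sup>2) * (sin \<phi>)\<^sup>2 < (a\<^sup>2 - b\<^sup>2) * (sin \<psi>)\<^sup>2"
    using sq by (intro mult_strict_left_mono) auto
  then show "(ell_support a b \<psi>)\<^sup>2 < (ell_support a b \<phi>)\<^sup>2"
    unfolding ell_support_sq cos_sq_sin_sq by (simp add: algebra_simps)
qed (simp add: ell_support_def)

text \<open>
  Up to the smallest radius of curvature \<open>b\<^sup>2/a\<close> the parallel curve has no self-crossing, and all of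
  it bounds the body. This includes the negative values of \<open>r\<close>, which give the outer parallel curves.
\<close>

lemma measure_parallel_body_inner_full:
  assumes ab: "0 < b" "b \<le> a" and r: "r * a \<le> b\<^sup>2" "r < b"
  shows "parallel_body 1 a b r \<in> lmeasurable" "measure lebesgue (parallel_body 1 a b r) = A_star a b r"
proof -
  have pos: "0 < 1 * (ell_support a b \<phi> - r)" for \<phi>
    using ell_support_bounds(1) [OF ab, of \<phi>] r by simp
  have range: "1 = (1::real) \<and> r * ell_support a b \<psi> < b\<^sup>2 \<or> 1 = (-1::real) \<and> a\<^sup>2 < r * ell_support a b \<psi>"
    if \<psi>: "0 < \<psi>" "\<psi> < pi / 2" for \<psi>
  proof -
    have "r * ell_support a b \<psi> < b\<^sup>2"
    proof (cases "0 < r")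
      case True
      show ?thesis
      proof (cases "b = a")
        case True
        then have "ell_support a b \<psi> = b"
          using ell_support_bounds [OF ab, of \<psi>] by simp
        then show ?thesis
          using r ab by (simp add: power2_eq_square)
      next
        case False
        have "0 < sin \<psi>"
          using \<psi> by (intro sin_gt_zero) auto
        then have "ell_support a b \<psi> < a"
          using ell_support_strict(1) [of b a] ab False by simp
        then have "r * ell_support a b \<psi> < r * a"
          using \<open>0 < r\<close> by simp
        then show ?thesis using r by simp
      qed
    next
      case False
      then have "r * ell_support a b \<psi> \<le> 0"
        using ell_support_bounds(3) [OF ab, of \<psi>] by (simp add: mult_nonpos_nonneg)
      then show ?thesis using ab zero_less_power [of b 2] by linarith
    qed
    then show ?thesis by simp
  qed
  have ends: "parallel_curve2 1 a b r 0 = 0" "parallel_curve1 1 a b r (pi / 2) = 0"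
    by (simp_all add: parallel_curve2_def parallel_curve1_def)
  note * = measure_parallel_body [OF ab _ _ _ pos range ends F_has_integral [OF ab]]
  show "parallel_body 1 a b r \<in> lmeasurable" "measure lebesgue (parallel_body 1 a b r) = A_star a b r"
    using * by (auto simp: A_star_def F_0)
qed

text \<open>
  For larger \<open>r\<close> the curve crosses the major axis at the angle \<open>\<alpha>\<close>, at which the support of the
  ellipse is \<open>b\<^sup>2/r\<close>, and the smaller angles give points beyond that axis.
\<close>

lemma measure_parallel_body_inner_partial:
  assumes ab: "0 < b" "b \<le> a" and r: "b\<^sup>2 < r * a" "r < b"
  shows "parallel_body 1 a b r \<in> lmeasurable"
    "measure lebesgue (parallel_body 1 a b r) = F_tilde a b r (alpha a b r)"
proof -
  have r0: "0 < r"
    using r(1) ab zero_less_power [of b 2] by (smt (verit) mult_nonpos_nonneg zero_less_mult_iff)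
  have "b < a"
  proof (rule ccontr)
    assume "\<not> b < a"
    then have "r * a < b * b" using ab r by auto
    then show False using r by (simp add: power2_eq_square)
  qed
  have sq: "r\<^sup>2 < b\<^sup>2" "b\<^sup>2 < a\<^sup>2"
    using r r0 ab \<open>b < a\<close> by (auto intro!: power_strict_mono)
  have "(b\<^sup>2)\<^sup>2 < (r * a)\<^sup>2"
    using r by (intro power_strict_mono) auto
  then have num: "b ^ 4 < r\<^sup>2 * a\<^sup>2"
    by (simp add: power_mult_distrib power_mult [symmetric])
  define \<alpha> where "\<alpha> = alpha a b r"
  define t where "t = sqrt (r\<^sup>2 * a\<^sup>2 - b ^ 4) / (b * sqrt (b\<^sup>2 - r\<^sup>2))"
  have t: "0 < t"
    unfolding t_def using num sq ab by simp
  have t2: "t\<^sup>2 = (r\<^sup>2 * a\<^sup>2 - b ^ 4) / (b\<^sup>2 * (b\<^sup>2 - r\<^sup>2))"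
    unfolding t_def using num sq ab by (simp add: power_divide power_mult_distrib)
  have \<alpha>: "0 < \<alpha>" "\<alpha> < pi / 2" "tan \<alpha> = t"
    using t arctan_ubound by (auto simp: \<alpha>_def alpha_def t_def [symmetric] tan_arctan)
  have cos\<alpha>: "0 < cos \<alpha>"
    using \<alpha> by (intro cos_gt_zero) auto
  have h\<alpha>: "r * ell_support a b \<alpha> = b\<^sup>2"
  proof (rule power2_eq_imp_eq)
    have "(sin \<alpha>)\<^sup>2 = t\<^sup>2 * (cos \<alpha>)\<^sup>2"
      using \<alpha>(3) cos\<alpha> by (simp add: tan_def field_simps)
    then have "(sin \<alpha>)\<^sup>2 * (b\<^sup>2 * (b\<^sup>2 - r\<^sup>2)) = (r\<^sup>2 * a\<^sup>2 - b ^ 4) * (cos \<alpha>)\<^sup>2"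
      unfolding t2 using sq ab by simp
    then show "(r * ell_support a b \<alpha>)\<^sup>2 = (b\<^sup>2)\<^sup>2"
      using sin_cos_squared_add [of \<alpha>] unfolding power_mult_distrib ell_support_sq by algebra
    show "0 \<le> r * ell_support a b \<alpha>"
      using r0 by (simp add: ell_support_def)
  qed simp
  have pos: "0 < 1 * (ell_support a b \<phi> - r)" for \<phi>
    using ell_support_bounds(1) [OF ab, of \<phi>] r by simp
  have range: "1 = (1::real) \<and> r * ell_support a b \<psi> < b\<^sup>2 \<or> 1 = (-1::real) \<and> a\<^sup>2 < r * ell_support a b \<psi>"
    if "\<alpha> < \<psi>" "\<psi> < pi / 2" for \<psi>
    using ell_support_strict_anti [OF ab(1) \<open>b < a\<close>, of \<alpha> \<psi>] that \<alpha> r0 unfolding h\<alpha> [symmetric] by simp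
  have ends: "parallel_curve2 1 a b r \<alpha> = 0" "parallel_curve1 1 a b r (pi / 2) = 0"
    unfolding parallel_curve2_def parallel_curve1_def h\<alpha> [symmetric]
    using ell_support_bounds(3) [OF ab, of \<alpha>] by simp_all
  note * = measure_parallel_body [OF ab _ _ _ pos range ends F_has_integral [OF ab]]
  show "parallel_body 1 a b r \<in> lmeasurable"
    "measure lebesgue (parallel_body 1 a b r) = F_tilde a b r (alpha a b r)"
    using * \<alpha> unfolding F_tilde_def A_star_def \<alpha>_def [symmetric] by auto
qed

text \<open>
  The positions of the ellipse in the disk are analogous, with the largest radius of curvature
  \<open>a\<^sup>2/b\<close>, the minor axis, and the angle \<open>\<beta>\<close> at which the support of the ellipse is \<open>a\<^sup>2/r\<close>.
\<close>

lemma measure_parallel_body_outer_full: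
  assumes ab: "0 < b" "b \<le> a" and r: "a\<^sup>2 \<le> r * b" "a < r"
  shows "parallel_body (-1) a b r \<in> lmeasurable" "measure lebesgue (parallel_body (-1) a b r) = A_star a b r"
proof -
  have pos: "0 < -1 * (ell_support a b \<phi> - r)" for \<phi>
    using ell_support_bounds(2) [OF ab, of \<phi>] r by simp
  have range: "-1 = (1::real) \<and> r * ell_support a b \<psi> < b\<^sup>2 \<or> -1 = (-1::real) \<and> a\<^sup>2 < r * ell_support a b \<psi>"
    if \<psi>: "0 < \<psi>" "\<psi> < pi / 2" for \<psi>
  proof -
    have "a\<^sup>2 < r * ell_support a b \<psi>"
    proof (cases "b = a")
      case True
      then have "ell_support a b \<psi> = a"
        using ell_support_bounds [OF ab, of \<psi>] by simp
      then show ?thesis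
        using r ab by (simp add: power2_eq_square)
    next
      case False
      have "0 < cos \<psi>"
        using \<psi> by (intro cos_gt_zero) auto
      then have "b < ell_support a b \<psi>"
        using ell_support_strict(2) [of b a] ab False by simp
      then have "r * b < r * ell_support a b \<psi>"
        using ab r by simp
      then show ?thesis using r by simp
    qed
    then show ?thesis by simp
  qed
  have ends: "parallel_curve2 (-1) a b r 0 = 0" "parallel_curve1 (-1) a b r (pi / 2) = 0"
    by (simp_all add: parallel_curve2_def parallel_curve1_def)
  note * = measure_parallel_body [OF ab _ _ _ pos range ends F_has_integral [OF ab]]
  show "parallel_body (-1) a b r \<in> lmeasurable" "measure lebesgue (parallel_body (-1) a b r) = A_star a b r"
    using * by (auto simp: A_star_def F_0)
qed

lemma measure_parallel_body_outer_partial: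
  assumes ab: "0 < b" "b \<le> a" and r: "r * b < a\<^sup>2" "a < r"
  shows "parallel_body (-1) a b r \<in> lmeasurable"
    "measure lebesgue (parallel_body (-1) a b r) = F a b r (beta a b r)"
proof -
  have r0: "0 < r"
    using r ab by simp
  have "b < a"
  proof (rule ccontr)
    assume "\<not> b < a"
    then have "a * a < r * b" using ab r by auto
    then show False using r by (simp add: power2_eq_square)
  qed
  have sq: "a\<^sup>2 < r\<^sup>2"
    using r ab by (auto intro!: power_strict_mono)
  have "(r * b)\<^sup>2 < (a\<^sup>2)\<^sup>2"
    using r r0 ab by (intro power_strict_mono) auto
  then have den: "r\<^sup>2 * b\<^sup>2 < a ^ 4"
    by (simp add: power_mult_distrib power_mult [symmetric])
  define \<beta> where "\<beta> = beta a b r"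
  define t where "t = a * sqrt (r\<^sup>2 - a\<^sup>2) / sqrt (a ^ 4 - r\<^sup>2 * b\<^sup>2)"
  have t: "0 < t"
    unfolding t_def using den sq ab by simp
  have t2: "t\<^sup>2 = a\<^sup>2 * (r\<^sup>2 - a\<^sup>2) / (a ^ 4 - r\<^sup>2 * b\<^sup>2)"
    unfolding t_def using den sq ab by (simp add: power_divide power_mult_distrib)
  have \<beta>: "0 < \<beta>" "\<beta> < pi / 2" "tan \<beta> = t"
    using t arctan_ubound by (auto simp: \<beta>_def beta_def t_def [symmetric] tan_arctan)
  have cos\<beta>: "0 < cos \<beta>"
    using \<beta> by (intro cos_gt_zero) auto
  have h\<beta>: "r * ell_support a b \<beta> = a\<^sup>2"
  proof (rule power2_eq_imp_eq)
    have "(sin \<beta>)\<^sup>2 = t\<^sup>2 * (cos \<beta>)\<^sup>2"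
      using \<beta>(3) cos\<beta> by (simp add: tan_def field_simps)
    then have "(sin \<beta>)\<^sup>2 * (a ^ 4 - r\<^sup>2 * b\<^sup>2) = a\<^sup>2 * (r\<^sup>2 - a\<^sup>2) * (cos \<beta>)\<^sup>2"
      unfolding t2 using den by simp
    then show "(r * ell_support a b \<beta>)\<^sup>2 = (a\<^sup>2)\<^sup>2"
      using sin_cos_squared_add [of \<beta>] unfolding power_mult_distrib ell_support_sq by algebra
    show "0 \<le> r * ell_support a b \<beta>"
      using r0 by (simp add: ell_support_def)
  qed simp
  have pos: "0 < -1 * (ell_support a b \<phi> - r)" for \<phi>
    using ell_support_bounds(2) [OF ab, of \<phi>] r by simp
  have range: "-1 = (1::real) \<and> r * ell_support a b \<psi> < b\<^sup>2 \<or> -1 = (-1::real) \<and> a\<^sup>2 < r * ell_support a b \<psi>"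
    if "0 < \<psi>" "\<psi> < \<beta>" for \<psi>
    using ell_support_strict_anti [OF ab(1) \<open>b < a\<close>, of \<psi> \<beta>] that \<beta> r0 unfolding h\<beta> [symmetric] by simp
  have ends: "parallel_curve2 (-1) a b r 0 = 0" "parallel_curve1 (-1) a b r \<beta> = 0"
    unfolding parallel_curve2_def parallel_curve1_def h\<beta> [symmetric]
    using ell_support_bounds(3) [OF ab, of \<beta>] by simp_all
  note * = measure_parallel_body [OF ab _ _ _ pos range ends F_has_integral [OF ab]]
  show "parallel_body (-1) a b r \<in> lmeasurable"
    "measure lebesgue (parallel_body (-1) a b r) = F a b r (beta a b r)"
    using * \<beta> unfolding \<beta>_def [symmetric] by (auto simp: F_0)
qed

lemma negligible_parallel_body_inner:
  assumes ab: "0 < b" and r: "b \<le> r"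
  shows "negligible (parallel_body 1 a b r)"
proof (rule negligible_subset [OF negligible_vec_nth_zero [of 2]])
  show "parallel_body 1 a b r \<subseteq> {w. w $ 2 = 0}"
  proof
    fix w assume "w \<in> parallel_body 1 a b r"
    then have w: "w $ 1 * cos \<phi> + w $ 2 * sin \<phi> \<le> ell_support a b \<phi> - r" for \<phi>
      by (auto simp: parallel_body_def)
    have "w $ 2 = 0"
      using w [of "pi / 2"] w [of "- (pi / 2)"] ab r by (simp add: ell_support_def)
    then show "w \<in> {w. w $ 2 = 0}" by simp
  qed
qed

lemma negligible_parallel_body_outer:
  assumes ab: "0 < a" and r: "r \<le> a"
  shows "negligible (parallel_body (-1) a b r)"
proof (rule negligible_subset [OF negligible_vec_nth_zero [of 1]])
  show "parallel_body (-1) a b r \<subseteq> {w. w $ 1 = 0}"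
  proof
    fix w assume "w \<in> parallel_body (-1) a b r"
    then have w: "w $ 1 * cos \<phi> + w $ 2 * sin \<phi> \<le> r - ell_support a b \<phi>" for \<phi>
      by (auto simp: parallel_body_def)
    have "w $ 1 = 0"
      using w [of 0] w [of pi] ab r by (simp add: ell_support_def)
    then show "w \<in> {w. w $ 1 = 0}" by simp
  qed
qed

lemma A_star_circle: "0 < a \<Longrightarrow> A_star a a a = 0"
  by (simp add: A_star_eq eccentricity_def complete_ell_E_def ell_E_def power2_eq_square)

section \<open>Parity of the number of simple real roots\<close>

lemma real_poly_odd_degree_root:
  fixes p :: "real poly"
  assumes "odd (degree p)"
  shows "\<exists>x. poly p x = 0"
proof -
  have root: "\<exists>x. poly p x = 0" if odd: "odd (degree p)" and lc: "0 < lead_coeff p" for p :: "real poly"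
  proof -
    obtain m where m: "\<And>x. m \<le> x \<Longrightarrow> lead_coeff p \<le> poly p x"
      using poly_pinfty_gt_lc [OF lc] by blast
    define q where "q = - pcompose p [:0, -1:]"
    have "lead_coeff q = lead_coeff p"
      unfolding q_def using odd by (simp add: lead_coeff_comp power_minus_odd lead_coeff_minus)
    then obtain n where n: "\<And>x. n \<le> x \<Longrightarrow> lead_coeff p \<le> poly q x"
      using poly_pinfty_gt_lc [of q] lc by auto
    define l where "l = max (max m n) 1"
    have l: "m \<le> l" "n \<le> l" "1 \<le> l"
      by (auto simp: l_def)
    have "0 < poly p l"
      using m [OF l(1)] lc by linarith
    moreover have "poly p (- l) < 0"
      using n [OF l(2)] lc by (simp add: q_def poly_pcompose)
    moreover have "- l < l"
      using l by simp
    ultimately show ?thesis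
      using poly_IVT_pos [of "- l" l p] by blast
  qed
  show ?thesis
  proof (cases "0 < lead_coeff p")
    case True
    with assms show ?thesis by (rule root)
  next
    case False
    have "p \<noteq> 0"
      using assms by auto
    then have "0 < lead_coeff (- p)"
      using False by (simp add: lead_coeff_minus not_less order_less_le)
    with root [of "- p"] assms show ?thesis
      by simp
  qed
qed

text \<open>Removing a simple root changes the degree and the number of roots by one.\<close>

lemma even_card_simple_roots:
  fixes p :: "real poly"
  assumes "p \<noteq> 0" and "\<And>x. poly p x = 0 \<Longrightarrow> poly (pderiv p) x \<noteq> 0"
  shows "even (card {x. poly p x = 0}) \<longleftrightarrow> even (degree p)"
  using assms
proof (induction "degree p" arbitrary: p)
  case 0
  then obtain c where "p = [:c:]"
    using degree_eq_zeroE by metis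
  with 0 show ?case by simp
next
  case (Suc n)
  show ?case
  proof (cases "\<exists>x. poly p x = 0")
    case False
    then show ?thesis
      using real_poly_odd_degree_root [of p] by auto
  next
    case True
    then obtain c where c: "poly p c = 0" by blast
    then obtain q where p: "p = [:- c, 1:] * q"
      by (metis dvdE poly_eq_0_iff_dvd)
    have q0: "q \<noteq> 0"
      using Suc.prems(1) p by auto
    have pd: "poly (pderiv p) x = poly q x + (x - c) * poly (pderiv q) x" for x
      unfolding p pderiv_mult by (simp add: pderiv_pCons left_diff_distrib)
    have qc: "poly q c \<noteq> 0"
      using Suc.prems(2) [OF c] pd by simp
    have deg: "degree p = Suc (degree q)"
      unfolding p using q0 by (subst degree_mult_eq) auto
    have "poly (pderiv q) x \<noteq> 0" if x: "poly q x = 0" for x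
      using Suc.prems(2) [of x] x pd by (simp add: p)
    then have "even (card {x. poly q x = 0}) \<longleftrightarrow> even (degree q)"
      using Suc.hyps deg q0 by auto
    moreover have "{x. poly p x = 0} = insert c {x. poly q x = 0}"
      by (auto simp: p)
    ultimately show ?thesis
      using qc deg poly_roots_finite [OF q0] by simp
  qed
qed


section \<open>The circle points and the ellipse points as a map of the torus\<close>

text \<open>
  The circle about the origin and the ellipse with center \<open>w\<close> have the point with angle \<open>s\<close> on the
  circle and parameter \<open>t\<close> on the ellipse in common iff this map sends \<open>(s, t)\<close> to \<open>w\<close>.
\<close>

definition torus_map :: "real \<Rightarrow> real \<Rightarrow> real \<Rightarrow> real^2 \<Rightarrow> real^2" where
  "torus_map a b r z = vector [r * cos (z $ 1) - a * cos (z $ 2), r * sin (z $ 1) - b * sin (z $ 2)]"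

definition torus_map' :: "real \<Rightarrow> real \<Rightarrow> real \<Rightarrow> real^2 \<Rightarrow> real^2 \<Rightarrow> real^2" where
  "torus_map' a b r z h = vector [- (r * sin (z $ 1)) * h $ 1 + a * sin (z $ 2) * h $ 2,
     r * cos (z $ 1) * h $ 1 + - (b * cos (z $ 2)) * h $ 2]"

definition torus_jac :: "real \<Rightarrow> real \<Rightarrow> real \<Rightarrow> real^2 \<Rightarrow> real" where
  "torus_jac a b r z = r * (b * cos (z $ 2) * sin (z $ 1) - a * sin (z $ 2) * cos (z $ 1))"

definition open_square :: "(real^2) set" where
  "open_square = {z. z $ 1 \<in> {-pi<..<pi} \<and> z $ 2 \<in> {-pi<..<pi}}"

definition contacts :: "real \<Rightarrow> real \<Rightarrow> real \<Rightarrow> real^2 \<Rightarrow> (real^2) set" where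
  "contacts a b r w = {z \<in> open_square. torus_map a b r z = w}"

text \<open>
  Apart from the positions with a tangential contact, those with a contact at the angle \<open>\<pi>\<close> are
  excluded, so that the contacts can be counted in the open square.
\<close>

definition exceptional :: "real \<Rightarrow> real \<Rightarrow> real \<Rightarrow> (real^2) set" where
  "exceptional a b r = torus_map a b r ` ({z. torus_jac a b r z = 0} \<union> {z. z $ 1 = pi} \<union> {z. z $ 2 = pi})"

lemma torus_map_derivative: "(torus_map a b r has_derivative torus_map' a b r z) (at z within S)"
  unfolding torus_map_def torus_map'_def
  by (rule has_derivative_eq_rhs [OF has_derivative_vector_2])
    (auto intro!: derivative_eq_intros vec_nth_has_derivative simp: algebra_simps)

lemma det_torus_map': "det (matrix (torus_map' a b r z)) = torus_jac a b r z"
  unfolding torus_map'_def det_matrix_vector_2 torus_jac_def by (simp add: algebra_simps)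

lemma negligible_critical_image:
  fixes g :: "real^'n::{finite,wellorder} \<Rightarrow> real^'n::_"
  assumes "\<And>z. z \<in> S \<Longrightarrow> (g has_derivative g' z) (at z within S)"
    and "\<And>z. z \<in> S \<Longrightarrow> det (matrix (g' z)) = 0"
  shows "negligible (g ` S)"
proof (rule baby_Sard [OF _ assms(1)])
  show "rank (matrix (g' z)) < CARD('n)" if "z \<in> S" for z
    using assms(2) [OF that]
    unfolding less_rank_noninjective matrix_left_invertible_injective [symmetric]
      invertible_left_inverse [symmetric] invertible_det_nz by simp
qed auto

text \<open>
  The maps that keep one angle at \<open>\<pi>\<close> are critical everywhere, so Sard's theorem covers all
  three parts.
\<close>

lemma negligible_exceptional: "negligible (exceptional a b r)"
proof -
  let ?f1 = "\<lambda>z::real^2. vector [r * cos pi - a * cos (z $ 2), r * sin pi - b * sin (z $ 2)] :: real^2"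
  let ?f2 = "\<lambda>z::real^2. vector [r * cos (z $ 1) - a * cos pi, r * sin (z $ 1) - b * sin pi] :: real^2"
  have "negligible (torus_map a b r ` {z. torus_jac a b r z = 0})"
    by (rule negligible_critical_image [OF torus_map_derivative]) (simp add: det_torus_map')
  moreover have "negligible (?f1 ` UNIV)"
  proof (rule negligible_critical_image)
    show "(?f1 has_derivative (\<lambda>h. vector [0 * h $ 1 + a * sin (z $ 2) * h $ 2, 0 * h $ 1 + - (b * cos (z $ 2)) * h $ 2])) (at z within UNIV)" for z
      by (rule has_derivative_eq_rhs [OF has_derivative_vector_2])
        (auto intro!: derivative_eq_intros vec_nth_has_derivative simp: algebra_simps)
  qed (rule trans [OF det_matrix_vector_2], simp)
  moreover have "negligible (?f2 ` UNIV)"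
  proof (rule negligible_critical_image)
    show "(?f2 has_derivative (\<lambda>h. vector [- (r * sin (z $ 1)) * h $ 1 + 0 * h $ 2, r * cos (z $ 1) * h $ 1 + 0 * h $ 2])) (at z within UNIV)" for z
      by (rule has_derivative_eq_rhs [OF has_derivative_vector_2])
        (auto intro!: derivative_eq_intros vec_nth_has_derivative simp: algebra_simps)
  qed (rule trans [OF det_matrix_vector_2], simp)
  moreover have "torus_map a b r ` {z. z $ 1 = pi} \<subseteq> ?f1 ` UNIV" "torus_map a b r ` {z. z $ 2 = pi} \<subseteq> ?f2 ` UNIV"
    by (auto simp: torus_map_def)
  ultimately show ?thesis
    unfolding exceptional_def image_Un by (meson negligible_Un negligible_subset)
qed

lemma cos_sin_angle:
  assumes "x\<^sup>2 + y\<^sup>2 = (1::real)"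
  obtains t where "-pi < t" "t \<le> pi" "x = cos t" "y = sin t"
proof -
  obtain u where "x = cos u" "y = sin u"
    using sincos_total_2pi [OF assms] by metis
  then show thesis
    using sincos_principal_value [of u] that by metis
qed

lemma cos_sin_inj:
  assumes "cos s = cos t" "sin s = sin t" "-pi < s" "s \<le> pi" "-pi < t" "t \<le> pi"
  shows "s = (t::real)"
proof -
  have "cos (s - t) = 1"
    using assms(1,2) by (simp add: cos_diff flip: power2_eq_square)
  then obtain k where k: "s - t = of_int k * 2 * pi"
    using cos_one_2pi_int by auto
  have "\<bar>s - t\<bar> < 2 * pi"
    using assms by linarith
  then have "\<bar>of_int k :: real\<bar> < 1"
    unfolding k by (simp add: abs_mult)
  then have "k = 0"
    by (simp flip: of_int_abs)
  then show ?thesis using k by simp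
qed

lemma ellipse_angle:
  assumes ab: "0 < b" "0 < a" and "((r * cos s - w $ 1) / a)\<^sup>2 + ((r * sin s - w $ 2) / b)\<^sup>2 = 1"
  obtains t where "-pi < t" "t \<le> pi" "torus_map a b r (vector [s, t]) = w"
proof -
  obtain t where "-pi < t" "t \<le> pi" "(r * cos s - w $ 1) / a = cos t" "(r * sin s - w $ 2) / b = sin t"
    using cos_sin_angle [OF assms(3)] by metis
  moreover from this ab have "torus_map a b r (vector [s, t]) = w"
    by (simp add: torus_map_def vec_eq_iff forall_2 field_simps)
  ultimately show thesis
    using that by blast
qed

lemma torus_map_ellipse:
  assumes ab: "0 < b" "0 < a" and "torus_map a b r z = w"
  shows "((r * cos (z $ 1) - w $ 1) / a)\<^sup>2 + ((r * sin (z $ 1) - w $ 2) / b)\<^sup>2 = 1"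
  using ab by (simp add: assms(3) [symmetric] torus_map_def)

lemma contacts_of_ellipse:
  assumes ab: "0 < b" "0 < a" and w: "w \<notin> exceptional a b r" and s: "-pi < s" "s \<le> pi"
    and "((r * cos s - w $ 1) / a)\<^sup>2 + ((r * sin s - w $ 2) / b)\<^sup>2 = 1"
  obtains t where "vector [s, t] \<in> contacts a b r w"
proof -
  obtain t where t: "-pi < t" "t \<le> pi" "torus_map a b r (vector [s, t]) = w"
    using ellipse_angle [OF ab assms(6)] by metis
  have "(vector [s, t] :: real^2) $ 1 \<noteq> pi" "(vector [s, t] :: real^2) $ 2 \<noteq> pi"
    using w t(3) unfolding exceptional_def image_Un by (metis (mono_tags) UnCI imageI mem_Collect_eq)+
  then show thesis
    using that [of t] s t by (auto simp: contacts_def open_square_def)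
qed

lemma contacts_bounds:
  assumes "z \<in> contacts a b r w"
  shows "-pi < z $ 1" "z $ 1 < pi" "-pi < z $ 2" "z $ 2 < pi"
  using assms by (simp_all add: contacts_def open_square_def)

lemma contacts_inj:
  assumes ab: "0 < b" "0 < a" and z: "z \<in> contacts a b r w" "z' \<in> contacts a b r w" "z $ 1 = z' $ 1"
  shows "z = z'"
proof -
  have "torus_map a b r z = torus_map a b r z'"
    using z by (simp add: contacts_def)
  then have "a * cos (z $ 2) = a * cos (z' $ 2)" "b * sin (z $ 2) = b * sin (z' $ 2)"
    using z(3) by (simp_all add: torus_map_def vec_eq_iff forall_2)
  then have "cos (z $ 2) = cos (z' $ 2)" "sin (z $ 2) = sin (z' $ 2)"
    using ab by simp_all
  moreover have "-pi < z $ 2" "z $ 2 \<le> pi" "-pi < z' $ 2" "z' $ 2 \<le> pi"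
    using contacts_bounds [OF z(1)] contacts_bounds [OF z(2)] by simp_all
  ultimately have "z $ 2 = z' $ 2"
    by (rule cos_sin_inj)
  with z(3) show ?thesis
    by (simp add: vec_eq_iff forall_2)
qed

section \<open>The number of contacts at a generic position\<close>

lemma ellipse_form_DERIV:
  assumes ab: "0 < b" "0 < a" and z: "torus_map a b r z = w"
  shows "((\<lambda>s. ((r * cos s - w $ 1) / a)\<^sup>2 + ((r * sin s - w $ 2) / b)\<^sup>2) has_real_derivative
    - 2 * torus_jac a b r z / (a * b)) (at (z $ 1))"
proof -
  have w: "(r * cos (z $ 1) - w $ 1) / a = cos (z $ 2)" "(r * sin (z $ 1) - w $ 2) / b = sin (z $ 2)"
    using ab by (simp_all add: z [symmetric] torus_map_def)
  have "((\<lambda>s. ((r * cos s - w $ 1) / a)\<^sup>2 + ((r * sin s - w $ 2) / b)\<^sup>2) has_real_derivative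
     2 * ((r * cos (z $ 1) - w $ 1) / a) * (- (r * sin (z $ 1)) / a)
     + 2 * ((r * sin (z $ 1) - w $ 2) / b) * (r * cos (z $ 1) / b)) (at (z $ 1))"
    using ab by (auto intro!: derivative_eq_intros simp: algebra_simps diff_divide_distrib)
  also have "2 * ((r * cos (z $ 1) - w $ 1) / a) * (- (r * sin (z $ 1)) / a)
     + 2 * ((r * sin (z $ 1) - w $ 2) / b) * (r * cos (z $ 1) / b) = - 2 * torus_jac a b r z / (a * b)"
    unfolding w torus_jac_def using ab by (simp add: field_simps)
  finally show ?thesis .
qed

lemma contacts_jac_nonzero:
  assumes "w \<notin> exceptional a b r" "z \<in> contacts a b r w"
  shows "torus_jac a b r z \<noteq> 0"
  using assms unfolding exceptional_def contacts_def by blast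

text \<open>
  The equation of the ellipse on the circle, in the rational parametrization of the circle by
  \<open>tan (s/2)\<close> and multiplied by the square of the denominator.
\<close>

definition contact_quartic :: "real \<Rightarrow> real \<Rightarrow> real \<Rightarrow> real^2 \<Rightarrow> real poly" where
  "contact_quartic a b r w = smult (1 / a\<^sup>2) ([:r - w $ 1, 0, - r - w $ 1:]\<^sup>2)
     + smult (1 / b\<^sup>2) ([:- w $ 2, 2 * r, - w $ 2:]\<^sup>2) - [:1, 0, 1:]\<^sup>2"

lemma cos_sin_double_arctan:
  "cos (2 * arctan x) = (1 - x\<^sup>2) / (1 + x\<^sup>2)" "sin (2 * arctan x) = 2 * x / (1 + x\<^sup>2)"
proof -
  have pos: "0 < 1 + x\<^sup>2"
    by (intro add_pos_nonneg) auto
  show "cos (2 * arctan x) = (1 - x\<^sup>2) / (1 + x\<^sup>2)"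
    using pos by (simp add: cos_double cos_arctan sin_arctan power_divide diff_divide_distrib)
  show "sin (2 * arctan x) = 2 * x / (1 + x\<^sup>2)"
    using pos by (simp add: sin_double cos_arctan sin_arctan)
qed

lemma poly_contact_quartic:
  assumes "0 < b" "0 < a"
  shows "poly (contact_quartic a b r w) x = (1 + x\<^sup>2)\<^sup>2 *
    (((r * cos (2 * arctan x) - w $ 1) / a)\<^sup>2 + ((r * sin (2 * arctan x) - w $ 2) / b)\<^sup>2 - 1)"
proof -
  define d where "d = 1 + x\<^sup>2"
  have d: "0 < d"
    unfolding d_def by (intro add_pos_nonneg) auto
  have c: "d * cos (2 * arctan x) = 1 - x\<^sup>2" and s: "d * sin (2 * arctan x) = 2 * x"
    unfolding cos_sin_double_arctan d_def [symmetric] using d by simp_all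
  have "poly (contact_quartic a b r w) x
      = ((r * (1 - x\<^sup>2) - w $ 1 * d) / a)\<^sup>2 + ((r * (2 * x) - w $ 2 * d) / b)\<^sup>2 - d\<^sup>2"
    by (simp add: contact_quartic_def d_def power_divide) (simp add: algebra_simps power2_eq_square)
  also have "r * (1 - x\<^sup>2) - w $ 1 * d = d * (r * cos (2 * arctan x) - w $ 1)"
    unfolding c [symmetric] by (simp add: algebra_simps)
  also have "r * (2 * x) - w $ 2 * d = d * (r * sin (2 * arctan x) - w $ 2)"
    unfolding s [symmetric] by (simp add: algebra_simps)
  finally have "poly (contact_quartic a b r w) x = (d * (r * cos (2 * arctan x) - w $ 1) / a)\<^sup>2
      + (d * (r * sin (2 * arctan x) - w $ 2) / b)\<^sup>2 - d\<^sup>2" .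
  moreover have "(d * A / a)\<^sup>2 + (d * B / b)\<^sup>2 - d\<^sup>2 = d\<^sup>2 * ((A / a)\<^sup>2 + (B / b)\<^sup>2 - 1)" for A B
    by (simp add: power_divide power_mult_distrib algebra_simps)
  ultimately show ?thesis
    unfolding d_def [symmetric] by simp
qed

text \<open>
  The quartic has degree \<open>4\<close> because the point of the circle at the angle \<open>\<pi>\<close>, the missing value
  of the parametrization, is no contact. Its roots are simple because no contact is
  tangential. So the number of contacts has the parity of \<open>4\<close>.
\<close>

lemma card_contacts:
  assumes ab: "0 < b" "0 < a" and w: "w \<notin> exceptional a b r"
  shows "finite (contacts a b r w)" "card (contacts a b r w) \<in> {0, 2, 4}"
proof -
  define Q where "Q = contact_quartic a b r w"
  define q where "q s = ((r * cos s - w $ 1) / a)\<^sup>2 + ((r * sin s - w $ 2) / b)\<^sup>2" for s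
  have Q: "poly Q x = (1 + x\<^sup>2)\<^sup>2 * (q (2 * arctan x) - 1)" for x
    unfolding Q_def q_def by (rule poly_contact_quartic [OF ab])
  have pos: "0 < 1 + x\<^sup>2" for x :: real
    by (intro add_pos_nonneg) auto
  have "degree Q \<le> 4"
    unfolding Q_def contact_quartic_def
    by (intro degree_diff_le degree_add_le degree_smult_le [THEN order_trans] degree_power_le [THEN order_trans]) simp_all
  moreover have "coeff Q 4 = q pi - 1"
    by (simp add: Q_def contact_quartic_def q_def power2_eq_square eval_nat_numeral)
  moreover have "q pi \<noteq> 1"
  proof
    assume "q pi = 1"
    then obtain t where "vector [pi, t] \<in> contacts a b r w"
      using contacts_of_ellipse [OF ab w, of pi] by (auto simp: q_def)
    then show False
      using contacts_bounds(2) by force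
  qed
  ultimately have deg: "degree Q = 4"
    by (metis le_antisym le_degree diff_eq_diff_eq diff_self)
  then have Q0: "Q \<noteq> 0"
    by auto
  have root: "\<exists>z. z \<in> contacts a b r w \<and> z $ 1 = 2 * arctan x" if "poly Q x = 0" for x
  proof -
    have "q (2 * arctan x) = 1"
      using that pos [of x] unfolding Q by simp
    then obtain t where "vector [2 * arctan x, t] \<in> contacts a b r w"
      using contacts_of_ellipse [OF ab w, of "2 * arctan x"] arctan_lbound [of x] arctan_ubound [of x]
      by (auto simp: q_def)
    then show ?thesis
      by (metis vector_2(1))
  qed
  have bij: "bij_betw (\<lambda>z. tan (z $ 1 / 2)) (contacts a b r w) {x. poly Q x = 0}"
    unfolding bij_betw_def
  proof (intro conjI inj_onI equalityI subsetI)
    have half: "2 * arctan (tan (z $ 1 / 2)) = z $ 1" if "z \<in> contacts a b r w" for z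
      using contacts_bounds(1,2) [OF that] arctan_tan [of "z $ 1 / 2"] by simp
    show "z = z'" if "z \<in> contacts a b r w" "z' \<in> contacts a b r w" "tan (z $ 1 / 2) = tan (z' $ 1 / 2)" for z z'
      by (rule contacts_inj [OF ab that(1,2)]) (metis half that)
    show "x \<in> {x. poly Q x = 0}" if "x \<in> (\<lambda>z. tan (z $ 1 / 2)) ` contacts a b r w" for x
    proof -
      obtain z where z: "z \<in> contacts a b r w" "x = tan (z $ 1 / 2)"
        using \<open>x \<in> _\<close> by auto
      then have "2 * arctan x = z $ 1"
        using half by simp
      moreover have "torus_map a b r z = w"
        using z(1) by (simp add: contacts_def)
      ultimately have "q (2 * arctan x) = 1"
        using torus_map_ellipse [OF ab] by (simp only: q_def)
      then show ?thesis
        by (simp add: Q)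
    qed
    show "x \<in> (\<lambda>z. tan (z $ 1 / 2)) ` contacts a b r w" if "x \<in> {x. poly Q x = 0}" for x
    proof -
      obtain z where "z \<in> contacts a b r w" "z $ 1 = 2 * arctan x"
        using root \<open>x \<in> _\<close> by auto
      moreover from this have "tan (z $ 1 / 2) = x"
        by (simp add: tan_arctan)
      ultimately show ?thesis by blast
    qed
  qed
  have simple: "poly (pderiv Q) x \<noteq> 0" if x: "poly Q x = 0" for x
  proof -
    obtain z where z: "z \<in> contacts a b r w" "z $ 1 = 2 * arctan x"
      using root [OF x] by blast
    define d where "d = - 2 * torus_jac a b r z / (a * b)"
    have "d \<noteq> 0"
      using contacts_jac_nonzero [OF w z(1)] ab by (simp add: d_def)
    have q_DERIV: "(q has_real_derivative d) (at (2 * arctan x))"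
    proof -
      have "torus_map a b r z = w"
        using z(1) by (simp add: contacts_def)
      from ellipse_form_DERIV [OF ab this] show ?thesis
        unfolding q_def [abs_def] d_def z(2) .
    qed
    have "((\<lambda>x. 2 * arctan x) has_real_derivative 2 * inverse (1 + x\<^sup>2)) (at x)"
      by (intro DERIV_cmult DERIV_arctan)
    from DERIV_chain2 [OF q_DERIV this]
    have "((\<lambda>x. q (2 * arctan x) - 1) has_real_derivative d * (2 * inverse (1 + x\<^sup>2))) (at x)"
      by (auto intro!: derivative_eq_intros)
    moreover have "((\<lambda>x. (1 + x\<^sup>2)\<^sup>2) has_real_derivative 2 * (1 + x\<^sup>2) * (2 * x)) (at x)"
      by (auto intro!: derivative_eq_intros)
    ultimately have "((\<lambda>x. (1 + x\<^sup>2)\<^sup>2 * (q (2 * arctan x) - 1)) has_real_derivative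
        2 * (1 + x\<^sup>2) * (2 * x) * (q (2 * arctan x) - 1) + d * (2 * inverse (1 + x\<^sup>2)) * (1 + x\<^sup>2)\<^sup>2) (at x)"
      by (rule DERIV_mult [rotated])
    then have "(poly Q has_real_derivative
        2 * (1 + x\<^sup>2) * (2 * x) * (q (2 * arctan x) - 1) + d * (2 * inverse (1 + x\<^sup>2)) * (1 + x\<^sup>2)\<^sup>2) (at x)"
      unfolding Q [symmetric] .
    then have "poly (pderiv Q) x
        = 2 * (1 + x\<^sup>2) * (2 * x) * (q (2 * arctan x) - 1) + d * (2 * inverse (1 + x\<^sup>2)) * (1 + x\<^sup>2)\<^sup>2"
      by (rule DERIV_unique [OF poly_DERIV])
    also have "q (2 * arctan x) - 1 = 0"
      using x pos [of x] unfolding Q by simp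
    finally show ?thesis
      using \<open>d \<noteq> 0\<close> pos [of x] by simp
  qed
  have fin: "finite {x. poly Q x = 0}"
    by (rule poly_roots_finite [OF Q0])
  then show "finite (contacts a b r w)"
    using bij bij_betw_finite by blast
  have "card (contacts a b r w) = card {x. poly Q x = 0}"
    by (rule bij_betw_same_card [OF bij])
  moreover have "even (card {x. poly Q x = 0})"
    using even_card_simple_roots [OF Q0 simple] deg by simp
  moreover have "card {x. poly Q x = 0} \<le> 4"
    using card_poly_roots_bound [OF Q0] deg by simp
  ultimately have "even (card (contacts a b r w))" "card (contacts a b r w) \<le> 4"
    by simp_all
  then show "card (contacts a b r w) \<in> {0, 2, 4}"
    by (auto elim!: evenE)
qed


section \<open>Contacts and intersection multiplicities\<close>

lemma Const2_hom:
  "Const2 (x + y) = Const2 x + Const2 y" "Const2 (x - y) = Const2 x - Const2 y"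
  "Const2 (x * y) = Const2 x * Const2 y" "Const2 0 = 0" "Const2 1 = 1"
  by (simp_all add: Const2_def one_pCons)

text \<open>
  A quadratic polynomial that vanishes at \<open>p\<close> is a combination of \<open>X - p\<^sub>1\<close> and \<open>Y - p\<^sub>2\<close> with
  linear coefficients: every square minus its value at \<open>p\<close> is a product.
\<close>

lemma circle_poly_linear:
  assumes "eval2 (circle_poly c r) p = 0"
  shows "circle_poly c r = ((X2 - Const2 (c $ 1)) + Const2 (p $ 1 - c $ 1)) * (X2 - Const2 (p $ 1))
    + ((Y2 - Const2 (c $ 2)) + Const2 (p $ 2 - c $ 2)) * (Y2 - Const2 (p $ 2))"
proof -
  have on: "(p $ 1 - c $ 1) * (p $ 1 - c $ 1) + (p $ 2 - c $ 2) * (p $ 2 - c $ 2) - r\<^sup>2 = 0"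
    using assms unfolding circle_poly_def eval2_simps power2_eq_square .
  have "Const2 ((p $ 1 - c $ 1) * (p $ 1 - c $ 1) + (p $ 2 - c $ 2) * (p $ 2 - c $ 2) - r\<^sup>2) = 0"
    unfolding on by (rule Const2_hom)
  then have "(Const2 (p $ 1) - Const2 (c $ 1)) * (Const2 (p $ 1) - Const2 (c $ 1))
    + (Const2 (p $ 2) - Const2 (c $ 2)) * (Const2 (p $ 2) - Const2 (c $ 2)) - Const2 (r\<^sup>2) = 0"
    by (simp only: Const2_hom)
  moreover have "(x - k)\<^sup>2 + (y - l)\<^sup>2 - R = ((x - k) + (u - k)) * (x - u) + ((y - l) + (v - l)) * (y - v)"
    if "(u - k) * (u - k) + (v - l) * (v - l) - R = 0" for x y k l u v R :: poly2
    using that by algebra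
  ultimately show ?thesis
    unfolding circle_poly_def Const2_hom by blast
qed

lemma ellipse_poly_linear:
  fixes a b \<theta> :: real and m p :: "real^2"
  defines "M \<equiv> Const2 (cos \<theta>) * (X2 - Const2 (m $ 1)) + Const2 (sin \<theta>) * (Y2 - Const2 (m $ 2))"
    and "N \<equiv> Const2 (- sin \<theta>) * (X2 - Const2 (m $ 1)) + Const2 (cos \<theta>) * (Y2 - Const2 (m $ 2))"
    and "M0 \<equiv> Const2 (major_coord \<theta> m p)" and "N0 \<equiv> Const2 (minor_coord \<theta> m p)"
  assumes "eval2 (ellipse_poly a b \<theta> m) p = 0"
  shows "ellipse_poly a b \<theta> m
    = (Const2 (1 / a\<^sup>2) * (M + M0) * Const2 (cos \<theta>) + Const2 (1 / b\<^sup>2) * (N + N0) * Const2 (- sin \<theta>)) * (X2 - Const2 (p $ 1))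
    + (Const2 (1 / a\<^sup>2) * (M + M0) * Const2 (sin \<theta>) + Const2 (1 / b\<^sup>2) * (N + N0) * Const2 (cos \<theta>)) * (Y2 - Const2 (p $ 2))"
proof -
  have M0: "M0 = Const2 (cos \<theta>) * (Const2 (p $ 1) - Const2 (m $ 1)) + Const2 (sin \<theta>) * (Const2 (p $ 2) - Const2 (m $ 2))"
    and N0: "N0 = Const2 (- sin \<theta>) * (Const2 (p $ 1) - Const2 (m $ 1)) + Const2 (cos \<theta>) * (Const2 (p $ 2) - Const2 (m $ 2))"
    unfolding M0_def N0_def major_coord_def minor_coord_def by (simp_all only: Const2_hom)
  have "eval2 (ellipse_poly a b \<theta> m) p = 1 / a\<^sup>2 * (major_coord \<theta> m p * major_coord \<theta> m p)
      + 1 / b\<^sup>2 * (minor_coord \<theta> m p * minor_coord \<theta> m p) - 1"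
    unfolding ellipse_poly_def major_coord_def minor_coord_def eval2_simps power2_eq_square ..
  then have "Const2 (1 / a\<^sup>2 * (major_coord \<theta> m p * major_coord \<theta> m p)
      + 1 / b\<^sup>2 * (minor_coord \<theta> m p * minor_coord \<theta> m p) - 1) = 0"
    using assms by (simp only: Const2_hom)
  then have on: "Const2 (1 / a\<^sup>2) * (M0 * M0) + Const2 (1 / b\<^sup>2) * (N0 * N0) - 1 = 0"
    unfolding M0_def N0_def by (simp only: Const2_hom)
  have "i * (k * (x - m1) + l * (y - m2))\<^sup>2 + j * (n * (x - m1) + o' * (y - m2))\<^sup>2 - 1
    = (i * ((k * (x - m1) + l * (y - m2)) + (k * (u - m1) + l * (v - m2))) * k
       + j * ((n * (x - m1) + o' * (y - m2)) + (n * (u - m1) + o' * (v - m2))) * n) * (x - u)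
    + (i * ((k * (x - m1) + l * (y - m2)) + (k * (u - m1) + l * (v - m2))) * l
       + j * ((n * (x - m1) + o' * (y - m2)) + (n * (u - m1) + o' * (v - m2))) * o') * (y - v)"
    if "i * ((k * (u - m1) + l * (v - m2)) * (k * (u - m1) + l * (v - m2)))
      + j * ((n * (u - m1) + o' * (v - m2)) * (n * (u - m1) + o' * (v - m2))) - 1 = 0"
    for i j k l n o' x y u v m1 m2 :: poly2
    using that by algebra
  from this [OF on [unfolded M0 N0]] show ?thesis
    unfolding ellipse_poly_def M_def N_def M0 N0 .
qed

definition ell_position :: "real \<Rightarrow> real^2 \<Rightarrow> real^2 \<Rightarrow> real^2" where
  "ell_position \<theta> c m = vector [major_coord \<theta> c m, minor_coord \<theta> c m]"

text \<open>The angle \<open>s\<close> is measured from the major axis of the ellipse.\<close>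

definition circle_point :: "real \<Rightarrow> real^2 \<Rightarrow> real \<Rightarrow> real \<Rightarrow> real^2" where
  "circle_point \<theta> c r s = vector [c $ 1 + r * cos (\<theta> + s), c $ 2 + r * sin (\<theta> + s)]"

lemma coords_circle_point:
  "major_coord \<theta> m (circle_point \<theta> c r s) = r * cos s - ell_position \<theta> c m $ 1"
  "minor_coord \<theta> m (circle_point \<theta> c r s) = r * sin s - ell_position \<theta> c m $ 2"
proof -
  have 1: "cos \<theta> * cos (\<theta> + s) + sin \<theta> * sin (\<theta> + s) = cos s"
    using cos_diff [of "\<theta> + s" \<theta>] by (simp add: mult.commute)
  have 2: "cos \<theta> * sin (\<theta> + s) - sin \<theta> * cos (\<theta> + s) = sin s"
    using sin_diff [of "\<theta> + s" \<theta>] by (simp add: mult.commute)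
  show "major_coord \<theta> m (circle_point \<theta> c r s) = r * cos s - ell_position \<theta> c m $ 1"
    unfolding major_coord_def circle_point_def ell_position_def vector_2 1 [symmetric]
    by (simp only: distrib_left right_diff_distrib mult_minus_left mult.left_commute [of r])
  show "minor_coord \<theta> m (circle_point \<theta> c r s) = r * sin s - ell_position \<theta> c m $ 2"
    unfolding minor_coord_def circle_point_def ell_position_def vector_2 2 [symmetric]
    by (simp only: distrib_left right_diff_distrib mult_minus_left mult.left_commute [of r])
qed

lemma circle_point_in_sphere:
  assumes "0 < r"
  shows "circle_point \<theta> c r s \<in> sphere c r"
proof -
  have "eval2 (circle_poly c r) (circle_point \<theta> c r s) = r\<^sup>2 * (cos (\<theta> + s))\<^sup>2 + r\<^sup>2 * (sin (\<theta> + s))\<^sup>2 - r\<^sup>2"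
    unfolding circle_poly_def eval2_simps circle_point_def vector_2 by (simp add: power_mult_distrib)
  also have "\<dots> = 0"
    by (simp add: cos_sq_sin_sq algebra_simps)
  finally show ?thesis
    using zero_set_circle_poly [OF assms, of c] by auto
qed

lemma circle_point_surj:
  assumes "0 < r" and "p \<in> sphere c r"
  obtains s where "-pi < s" "s \<le> pi" "p = circle_point \<theta> c r s"
proof -
  have "eval2 (circle_poly c r) p = 0"
    using assms(2) unfolding zero_set_circle_poly [OF assms(1), symmetric] mem_Collect_eq .
  then have "(p $ 1 - c $ 1)\<^sup>2 + (p $ 2 - c $ 2)\<^sup>2 = r\<^sup>2"
    unfolding circle_poly_def eval2_simps right_minus_eq .
  then have "((p $ 1 - c $ 1) / r)\<^sup>2 + ((p $ 2 - c $ 2) / r)\<^sup>2 = 1"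
    using assms(1) by (simp add: power_divide add_divide_distrib [symmetric])
  then obtain u where "(p $ 1 - c $ 1) / r = cos u" "(p $ 2 - c $ 2) / r = sin u"
    using sincos_total_2pi by metis
  moreover obtain s where "-pi < s" "s \<le> pi" "cos s = cos (u - \<theta>)" "sin s = sin (u - \<theta>)"
    using sincos_principal_value [of "u - \<theta>"] by metis
  moreover from this have "cos (\<theta> + s) = cos (\<theta> + (u - \<theta>))" "sin (\<theta> + s) = sin (\<theta> + (u - \<theta>))"
    by (simp_all only: cos_add sin_add)
  ultimately have "p = circle_point \<theta> c r s"
    using assms(1) by (simp add: circle_point_def vec_eq_iff forall_2 field_simps)
  then show thesis
    using that \<open>-pi < s\<close> \<open>s \<le> pi\<close> by blast
qed

text \<open>
  At a contact, the Jacobian of the two polynomials is a nonzero multiple of that of the map from the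
  torus, so every intersection is transversal.
\<close>

theorem num_real_intersections_generic:
  assumes ab: "0 < b" "0 < a" and r: "0 < r"
    and w: "ell_position \<theta> c m \<notin> exceptional a b r"
  shows "num_real_intersections (circle_poly c r) (ellipse_poly a b \<theta> m)
    = enat (card (contacts a b r (ell_position \<theta> c m)))"
proof -
  define w where "w = ell_position \<theta> c m"
  define Z where "Z = contacts a b r w"
  define T where "T = {p. eval2 (circle_poly c r) p = 0 \<and> eval2 (ellipse_poly a b \<theta> m) p = 0}"
  define P where "P z = circle_point \<theta> c r (z $ 1)" for z :: "real^2"
  have T: "T = sphere c r \<inter> ellipse a b \<theta> m"
    unfolding T_def zero_set_circle_poly [OF r, symmetric] zero_set_ellipse_poly [symmetric] by blast
  have in_ellipse: "circle_point \<theta> c r s \<in> ellipse a b \<theta> m \<longleftrightarrow>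
      ((r * cos s - w $ 1) / a)\<^sup>2 + ((r * sin s - w $ 2) / b)\<^sup>2 = 1" for s
    unfolding ellipse_def mem_Collect_eq coords_circle_point w_def ..
  have bij: "bij_betw P Z T"
    unfolding bij_betw_def
  proof (intro conjI inj_onI equalityI subsetI)
    fix z z' assume z: "z \<in> Z" "z' \<in> Z" and eq: "P z = P z'"
    then have "major_coord \<theta> m (P z) = major_coord \<theta> m (P z')" "minor_coord \<theta> m (P z) = minor_coord \<theta> m (P z')"
      by simp_all
    then have "r * cos (z $ 1) = r * cos (z' $ 1)" "r * sin (z $ 1) = r * sin (z' $ 1)"
      unfolding P_def coords_circle_point by linarith+
    then have "cos (z $ 1) = cos (z' $ 1)" "sin (z $ 1) = sin (z' $ 1)"
      using r by simp_all
    moreover have "-pi < z $ 1" "z $ 1 \<le> pi" "-pi < z' $ 1" "z' $ 1 \<le> pi"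
      using contacts_bounds(1,2) [OF z(1) [unfolded Z_def]] contacts_bounds(1,2) [OF z(2) [unfolded Z_def]] by simp_all
    ultimately have "z $ 1 = z' $ 1"
      by (rule cos_sin_inj)
    then show "z = z'"
      using z contacts_inj [OF ab] by (auto simp: Z_def)
  next
    fix p assume "p \<in> P ` Z"
    then obtain z where z: "z \<in> Z" "p = circle_point \<theta> c r (z $ 1)"
      by (auto simp: P_def)
    moreover have "torus_map a b r z = w"
      using z(1) by (simp add: Z_def contacts_def)
    ultimately show "p \<in> T"
      using torus_map_ellipse [OF ab] circle_point_in_sphere [OF r] unfolding T by (simp only: in_ellipse Int_iff simp_thms)
  next
    fix p assume p: "p \<in> T"
    then obtain s where s: "-pi < s" "s \<le> pi" "p = circle_point \<theta> c r s"
      using circle_point_surj [OF r] unfolding T by blast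
    then obtain t where t: "vector [s, t] \<in> Z"
      using contacts_of_ellipse [OF ab assms(4) [folded w_def], of s] p in_ellipse by (auto simp: T Z_def)
    then show "p \<in> P ` Z"
      using s(3) by (auto simp: P_def intro!: image_eqI [OF _ t])
  qed
  have fin: "finite Z"
    unfolding Z_def w_def by (rule card_contacts [OF ab w])
  then have finT: "finite T"
    using bij bij_betw_finite by blast
  have mult: "intersection_mult (circle_poly c r) (ellipse_poly a b \<theta> m) p = 1" if p: "p \<in> T" for p
  proof -
    obtain z where z: "z \<in> Z" "p = circle_point \<theta> c r (z $ 1)"
      using bij p by (auto simp: bij_betw_def P_def)
    have zw: "torus_map a b r z = w"
      using z by (simp add: Z_def contacts_def)
    define s t where "s = z $ 1" and "t = z $ 2"
    have M: "major_coord \<theta> m p = a * cos t"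
      unfolding z(2) coords_circle_point w_def [symmetric] zw [symmetric] torus_map_def vector_2 t_def by simp
    have N: "minor_coord \<theta> m p = b * sin t"
      unfolding z(2) coords_circle_point w_def [symmetric] zw [symmetric] torus_map_def vector_2 t_def by simp
    have pc: "p $ 1 - c $ 1 = r * cos (\<theta> + s)" "p $ 2 - c $ 2 = r * sin (\<theta> + s)"
      by (simp_all add: z(2) circle_point_def s_def)
    have jac: "torus_jac a b r z \<noteq> 0"
      using contacts_jac_nonzero [OF w, of z] z by (simp add: Z_def w_def)
    have e: "eval2 (circle_poly c r) p = 0" "eval2 (ellipse_poly a b \<theta> m) p = 0"
      using p by (auto simp: T_def)
    have sc: "cos (\<theta> + s) * sin \<theta> - sin (\<theta> + s) * cos \<theta> = - sin s"
      "cos (\<theta> + s) * cos \<theta> + sin (\<theta> + s) * sin \<theta> = cos s"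
      using sin_diff [of "\<theta> + s" \<theta>] cos_diff [of "\<theta> + s" \<theta>] by simp_all
    have "r * cos (\<theta> + s) * (1 / a\<^sup>2 * (a * cos t) * sin \<theta> + 1 / b\<^sup>2 * (b * sin t) * cos \<theta>)
        - r * sin (\<theta> + s) * (1 / a\<^sup>2 * (a * cos t) * cos \<theta> + 1 / b\<^sup>2 * (b * sin t) * - sin \<theta>)
        = r * (cos t / a * (cos (\<theta> + s) * sin \<theta> - sin (\<theta> + s) * cos \<theta>)
          + sin t / b * (cos (\<theta> + s) * cos \<theta> + sin (\<theta> + s) * sin \<theta>))"
      using ab by (simp add: power2_eq_square divide_simps) (simp add: algebra_simps)
    also have "\<dots> = - torus_jac a b r z / (a * b)"
      unfolding sc torus_jac_def s_def [symmetric] t_def [symmetric] using ab by (simp add: field_simps)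
    finally have det: "r * cos (\<theta> + s) * (1 / a\<^sup>2 * (a * cos t) * sin \<theta> + 1 / b\<^sup>2 * (b * sin t) * cos \<theta>)
        - r * sin (\<theta> + s) * (1 / a\<^sup>2 * (a * cos t) * cos \<theta> + 1 / b\<^sup>2 * (b * sin t) * - sin \<theta>) \<noteq> 0"
      using jac ab by simp
    have double: "(x + x) * (i * (y + y) * k + j * (n + n) * l) - (u + u) * (i * (y + y) * l' + j * (n + n) * k')
        = 4 * (x * (i * y * k + j * n * l) - u * (i * y * l' + j * n * k'))" for x y i j k l k' l' n u :: real
      by (simp add: algebra_simps)
    show ?thesis
      by (rule intersection_mult_transversal [OF circle_poly_linear [OF e(1)] ellipse_poly_linear [OF e(2)]],
          unfold eval2_simps major_coord_def [symmetric] minor_coord_def [symmetric] M N pc double)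
        (use det in \<open>simp only: mult_eq_0_iff, simp\<close>)
  qed
  have "num_real_intersections (circle_poly c r) (ellipse_poly a b \<theta> m) = (\<Sum>p\<in>T. 1)"
    unfolding num_real_intersections_def Let_def T_def [symmetric] using finT mult by simp
  also have "\<dots> = enat (card T)"
    by (simp add: of_nat_eq_enat)
  also have "card T = card Z"
    using bij_betw_same_card [OF bij] by simp
  finally show ?thesis
    by (simp add: Z_def w_def)
qed

section \<open>The mean number of contacts\<close>

lemma has_integral_reflect_about:
  fixes f :: "real \<Rightarrow> real"
  assumes "(f has_integral I) {u..v}"
  shows "((\<lambda>x. f (c - x)) has_integral I) {c - v..c - u}"
proof (cases "u \<le> v")
  case True
  have "((\<lambda>x. f ((-1) *\<^sub>R x + c)) has_integral (1 / \<bar>-1\<bar> ^ DIM(real)) *\<^sub>R I)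
      ((\<lambda>x. (1 / (-1)) *\<^sub>R x + - ((1 / (-1)) *\<^sub>R c)) ` cbox u v)"
    using assms by (intro has_integral_affinity) auto
  moreover have "(\<lambda>x. (1 / (-1)) *\<^sub>R x + - ((1 / (-1)) *\<^sub>R c)) ` cbox u v = {c - v..c - u}"
    using image_diff_atLeastAtMost [of c u v] by (simp add: add.commute)
  ultimately show ?thesis
    by (simp add: add.commute)
next
  case False
  with assms show ?thesis
    by simp
qed

lemma integral_ell_support_period:
  assumes ab: "0 < b" "b \<le> a"
  shows "((\<lambda>t. ell_support a b (pi / 2 - t)) has_integral 4 * a * complete_ell_E (eccentricity a b)) {-pi..pi}"
proof -
  define h where "h = ell_support a b"
  define I where "I = a * complete_ell_E (eccentricity a b)"
  \<comment> \<open>Reflections carry the first quadrant to the other three.\<close>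
  have h: "h (0 - x) = h x" "h (pi - x) = h x" "h (2 * pi - x) = h x" for x
    by (simp_all add: h_def ell_support_def)
  have "(h has_integral integral {0..pi / 2} h) {0..pi / 2}"
    unfolding h_def by (intro integrable_integral integrable_continuous_real continuous_on_ell_support)
  then have 1: "(h has_integral I) {0..pi / 2}"
    unfolding I_def complete_ell_E_def mult_ell_E [OF ab] h_def .
  have 2: "(h has_integral I) {pi / 2..pi}"
    using has_integral_reflect_about [OF 1, of pi] by (simp add: h)
  have 3: "(h has_integral I) {- (pi / 2)..0}"
    using has_integral_reflect_about [OF 1, of 0] by (simp add: h [simplified])
  have 4: "(h has_integral I) {pi..3 * pi / 2}"
    using has_integral_reflect_about [OF 2, of "2 * pi"] by (simp add: h)
  have "(h has_integral I + I) {- (pi / 2)..pi / 2}"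
    by (rule has_integral_combine [OF _ _ 3 1]) auto
  from has_integral_combine [OF _ _ this 2] have "(h has_integral I + I + I) {- (pi / 2)..pi}"
    by simp
  from has_integral_combine [OF _ _ this 4] have "(h has_integral I + I + I + I) {- (pi / 2)..3 * pi / 2}"
    by simp
  from has_integral_reflect_about [OF this, of "pi / 2"] show ?thesis
    by (simp add: h_def I_def mult.assoc)
qed

text \<open>The sinusoid is \<open>k sin (s - \<sigma>)\<close> with \<open>0 \<le> \<sigma> \<le> \<pi>\<close>; its zeros are \<open>\<sigma> - \<pi>\<close> and \<open>\<sigma>\<close>.\<close>

lemma has_integral_abs_sinusoid:
  "((\<lambda>s. \<bar>\<alpha> * sin s - \<beta> * cos s\<bar>) has_integral 4 * sqrt (\<alpha>\<^sup>2 + \<beta>\<^sup>2)) {-pi..pi}"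
proof -
  obtain k \<sigma> where \<sigma>: "0 \<le> \<sigma>" "\<sigma> \<le> pi" and k: "\<alpha> = k * cos \<sigma>" "\<beta> = k * sin \<sigma>"
  proof -
    define l where "l = sqrt (\<alpha>\<^sup>2 + \<beta>\<^sup>2)"
    show thesis
    proof (cases "l = 0")
      case True
      then show thesis
        using that [of 0 0] by (simp add: l_def)
    next
      case False
      have "(\<alpha> / l)\<^sup>2 + (\<beta> / l)\<^sup>2 = (\<alpha>\<^sup>2 + \<beta>\<^sup>2) / l\<^sup>2"
        by (simp add: power_divide add_divide_distrib)
      also have "\<dots> = 1"
        using False by (simp add: l_def)
      finally obtain t where t: "-pi < t" "t \<le> pi" "\<alpha> / l = cos t" "\<beta> / l = sin t"
        using cos_sin_angle by metis
      then have "\<alpha> = l * cos t" "\<beta> = l * sin t"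
        using False by (simp_all add: field_simps)
      then show thesis
        using that [of t l] that [of "t + pi" "- l"] t by (cases "0 \<le> t") auto
    qed
  qed
  have "\<alpha>\<^sup>2 + \<beta>\<^sup>2 = k\<^sup>2"
    unfolding k power_mult_distrib cos_squared_eq by (simp add: algebra_simps)
  then have k': "sqrt (\<alpha>\<^sup>2 + \<beta>\<^sup>2) = \<bar>k\<bar>"
    by simp
  have piece: "((\<lambda>s. \<bar>sin (s - \<sigma>)\<bar>) has_integral e * (cos (u - \<sigma>) - cos (v - \<sigma>))) {u..v}"
    if "u \<le> v" and e: "\<And>s. s \<in> {u..v} \<Longrightarrow> \<bar>sin (s - \<sigma>)\<bar> = e * sin (s - \<sigma>)" for u v e
  proof -
    have "((\<lambda>s. e * sin (s - \<sigma>)) has_integral (- e * cos (v - \<sigma>) - - e * cos (u - \<sigma>))) {u..v}"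
      by (rule fundamental_theorem_of_calculus [OF \<open>u \<le> v\<close>])
        (auto intro!: derivative_eq_intros simp: has_real_derivative_iff_has_vector_derivative [symmetric])
    then have "((\<lambda>s. \<bar>sin (s - \<sigma>)\<bar>) has_integral (- e * cos (v - \<sigma>) - - e * cos (u - \<sigma>))) {u..v}"
      by (rule has_integral_eq [rotated]) (simp add: e)
    then show ?thesis
      by (simp add: algebra_simps)
  qed
  have 1: "((\<lambda>s. \<bar>sin (s - \<sigma>)\<bar>) has_integral 1 * (cos (- pi - \<sigma>) - cos (\<sigma> - pi - \<sigma>))) {-pi..\<sigma> - pi}"
  proof (rule piece)
    fix s assume "s \<in> {-pi..\<sigma> - pi}"
    then have "0 \<le> sin (s - \<sigma> + 2 * pi)"
      using \<sigma> by (intro sin_ge_zero) auto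
    then show "\<bar>sin (s - \<sigma>)\<bar> = 1 * sin (s - \<sigma>)" by simp
  qed (use \<sigma> in auto)
  have 2: "((\<lambda>s. \<bar>sin (s - \<sigma>)\<bar>) has_integral (-1) * (cos (\<sigma> - pi - \<sigma>) - cos (\<sigma> - \<sigma>))) {\<sigma> - pi..\<sigma>}"
  proof (rule piece)
    fix s assume "s \<in> {\<sigma> - pi..\<sigma>}"
    then have "0 \<le> sin (\<sigma> - s)"
      using \<sigma> by (intro sin_ge_zero) auto
    then show "\<bar>sin (s - \<sigma>)\<bar> = -1 * sin (s - \<sigma>)"
      using sin_minus [of "s - \<sigma>"] by simp
  qed (use \<sigma> in auto)
  have 3: "((\<lambda>s. \<bar>sin (s - \<sigma>)\<bar>) has_integral 1 * (cos (\<sigma> - \<sigma>) - cos (pi - \<sigma>))) {\<sigma>..pi}"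
  proof (rule piece)
    fix s assume "s \<in> {\<sigma>..pi}"
    then have "0 \<le> sin (s - \<sigma>)"
      using \<sigma> by (intro sin_ge_zero) auto
    then show "\<bar>sin (s - \<sigma>)\<bar> = 1 * sin (s - \<sigma>)" by simp
  qed (use \<sigma> in auto)
  have c: "cos (- pi - \<sigma>) = - cos \<sigma>" "cos (\<sigma> - pi - \<sigma>) = -1" "cos (pi - \<sigma>) = - cos \<sigma>"
    by (simp_all add: cos_diff)
  have "((\<lambda>s. \<bar>sin (s - \<sigma>)\<bar>) has_integral 1 * (- cos \<sigma> - -1) + (-1) * (-1 - 1)) {-pi..\<sigma>}"
    using has_integral_combine [OF _ _ 1 2] \<sigma> unfolding c by simp
  from has_integral_combine [OF _ _ this 3] have "((\<lambda>s. \<bar>sin (s - \<sigma>)\<bar>) has_integral 4) {-pi..pi}"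
    using \<sigma> unfolding c by simp
  from has_integral_mult_right [OF this, of "\<bar>k\<bar>"]
  have "((\<lambda>s. \<bar>k\<bar> * \<bar>sin (s - \<sigma>)\<bar>) has_integral \<bar>k\<bar> * 4) {-pi..pi}" .
  moreover have "\<bar>k\<bar> * \<bar>sin (s - \<sigma>)\<bar> = \<bar>\<alpha> * sin s - \<beta> * cos s\<bar>" for s
    unfolding abs_mult [symmetric] k sin_diff by (simp add: algebra_simps)
  ultimately show ?thesis
    unfolding k' by (simp add: mult.commute)
qed

lemma has_integral_torus_jac:
  assumes ab: "0 < b" "b \<le> a" and r: "0 < r"
  shows "((\<lambda>z. \<bar>torus_jac a b r z\<bar>) has_integral 16 * r * a * complete_ell_E (eccentricity a b)) open_square"
  unfolding open_square_def torus_jac_def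
proof (rule has_integral_Tonelli_vector_2 [where k = "\<lambda>t. 4 * r * ell_support a b (pi / 2 - t)"
      and f = "\<lambda>s t. \<bar>r * (b * cos t * sin s - a * sin t * cos s)\<bar>"])
  have "continuous_on UNIV (\<lambda>z::real^2. \<bar>r * (b * cos (z $ 2) * sin (z $ 1) - a * sin (z $ 2) * cos (z $ 1))\<bar>)"
    by (intro continuous_intros)
  then show "(\<lambda>z::real^2. \<bar>r * (b * cos (z $ 2) * sin (z $ 1) - a * sin (z $ 2) * cos (z $ 1))\<bar>) \<in> borel_measurable borel"
    by (rule borel_measurable_continuous_onI)
  show "((\<lambda>s. \<bar>r * (b * cos t * sin s - a * sin t * cos s)\<bar>) has_integral 4 * r * ell_support a b (pi / 2 - t)) {-pi<..<pi}" for t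
  proof -
    have h: "ell_support a b (pi / 2 - t) = sqrt ((b * cos t)\<^sup>2 + (a * sin t)\<^sup>2)"
      by (simp add: ell_support_def power_mult_distrib cos_diff sin_diff add.commute)
    from has_integral_mult_right [OF has_integral_abs_sinusoid [of "b * cos t" "a * sin t"], of r]
    have "((\<lambda>s. r * \<bar>b * cos t * sin s - a * sin t * cos s\<bar>) has_integral 4 * r * ell_support a b (pi / 2 - t)) {-pi..pi}"
      unfolding h by (simp only: mult.assoc mult.left_commute [of r])
    then show ?thesis
      using r by (simp add: abs_mult has_integral_Icc_iff_Ioo)
  qed
  from has_integral_mult_right [OF integral_ell_support_period [OF ab], of "4 * r"]
  show "((\<lambda>t. 4 * r * ell_support a b (pi / 2 - t)) has_integral 16 * r * a * complete_ell_E (eccentricity a b)) {-pi<..<pi}"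
    by (simp add: has_integral_Icc_iff_Ioo mult.assoc)
qed auto

text \<open>
  This is the area formula for the map from the torus. The integral is \<open>2/\<pi>\<close> times the product of
  the two perimeters \<open>2\<pi>r\<close> and \<open>4aE(\<epsilon>)\<close>, as in Poincare's formula for moving curves.
\<close>

lemma nn_integral_card_contacts:
  assumes ab: "0 < b" "b \<le> a" and r: "0 < r"
  obtains N :: "real^2 \<Rightarrow> ennreal" where "N \<in> borel_measurable lebesgue"
    "(\<integral>\<^sup>+w. N w \<partial>lebesgue) = ennreal (16 * r * a * complete_ell_E (eccentricity a b))"
    "\<And>w. w \<notin> exceptional a b r \<Longrightarrow> N w = of_nat (card (contacts a b r w))"
proof -
  define U where "U = open_square \<inter> {z. torus_jac a b r z \<noteq> 0}"
  have jac_cont: "continuous_on UNIV (torus_jac a b r)"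
    unfolding torus_jac_def by (intro continuous_intros)
  have "open U"
  proof -
    have sq: "open_square = {z. -pi < z $ 1} \<inter> {z. z $ 1 < pi} \<inter> {z. -pi < z $ 2} \<inter> {z. z $ 2 < pi}"
      by (auto simp: open_square_def)
    show ?thesis
      unfolding U_def sq using jac_cont
      by (intro open_Int open_Collect_less open_Collect_neq continuous_intros)
  qed
  moreover have "continuous_on U (\<lambda>z. matrix (torus_map' a b r z))"
  proof -
    have "continuous_on U (\<lambda>z. matrix (torus_map' a b r z) $ i $ j)" for i j
      unfolding torus_map'_def matrix_def
      using exhaust_2 [of i] exhaust_2 [of j] by (auto intro!: continuous_intros simp: axis_def vector_2_eq_basis)
    then show ?thesis
      by (metis (no_types) continuous_on_vec_lambda vec_lambda_eta ext)
  qed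
  moreover have "((\<lambda>z. \<bar>det (matrix (torus_map' a b r z))\<bar>) has_integral 16 * r * a * complete_ell_E (eccentricity a b)) U"
  proof -
    have "{z \<in> open_square - U. \<bar>torus_jac a b r z\<bar> \<noteq> 0} = {}" "{z \<in> U - open_square. \<bar>torus_jac a b r z\<bar> \<noteq> 0} = {}"
      by (auto simp: U_def)
    then show ?thesis
      unfolding det_torus_map' using has_integral_torus_jac [OF ab r]
      by (subst (asm) has_integral_spike_set_eq [where T = U]) (simp_all only: negligible_empty)
  qed
  ultimately have *: "(\<lambda>w. emeasure (count_space UNIV) {z \<in> U. torus_map a b r z = w}) \<in> borel_measurable lebesgue"
    "(\<integral>\<^sup>+w. emeasure (count_space UNIV) {z \<in> U. torus_map a b r z = w} \<partial>lebesgue)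
      = ennreal (16 * r * a * complete_ell_E (eccentricity a b))"
    using area_formula [of U "torus_map a b r" "torus_map' a b r"] torus_map_derivative
    by (auto simp: det_torus_map' U_def)
  have "emeasure (count_space UNIV) {z \<in> U. torus_map a b r z = w} = of_nat (card (contacts a b r w))"
    if w: "w \<notin> exceptional a b r" for w
  proof -
    have "{z \<in> U. torus_map a b r z = w} = contacts a b r w"
      using contacts_jac_nonzero [OF w] by (auto simp: U_def contacts_def)
    then show ?thesis
      using card_contacts(1) [OF ab(1) _ w] ab by simp
  qed
  with * show thesis
    by (rule that)
qed

section \<open>Positions without contacts\<close>

lemma ellipse_support_le:
  assumes "0 < b" "0 < a" and "(x / a)\<^sup>2 + (y / b)\<^sup>2 \<le> 1"
  shows "x * cos \<phi> + y * sin \<phi> \<le> ell_support a b \<phi>"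
proof (rule power2_le_imp_le)
  define p q u v where "p = x / a" and "q = y / b" and "u = a * cos \<phi>" and "v = b * sin \<phi>"
  have h: "(ell_support a b \<phi>)\<^sup>2 = u\<^sup>2 + v\<^sup>2"
    by (simp add: ell_support_sq u_def v_def power_mult_distrib)
  have "x * cos \<phi> + y * sin \<phi> = p * u + q * v"
    using assms(1,2) by (simp add: p_def q_def u_def v_def)
  moreover have "(p * u + q * v)\<^sup>2 \<le> (p\<^sup>2 + q\<^sup>2) * (u\<^sup>2 + v\<^sup>2)"
  proof -
    have "(p\<^sup>2 + q\<^sup>2) * (u\<^sup>2 + v\<^sup>2) - (p * u + q * v)\<^sup>2 = (p * v - q * u)\<^sup>2"
      by algebra
    then show ?thesis
      using zero_le_power2 [of "p * v - q * u"] by linarith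
  qed
  moreover have "(p\<^sup>2 + q\<^sup>2) * (u\<^sup>2 + v\<^sup>2) \<le> 1 * (u\<^sup>2 + v\<^sup>2)"
    using assms(3) by (intro mult_right_mono) (auto simp: p_def q_def)
  ultimately show "(x * cos \<phi> + y * sin \<phi>)\<^sup>2 \<le> (ell_support a b \<phi>)\<^sup>2"
    by (simp add: h)
qed (simp add: ell_support_def)

lemma polar_direction:
  obtains k \<phi> where "0 \<le> k" "x = k * cos \<phi>" "y = k * sin \<phi>" "k\<^sup>2 = x\<^sup>2 + (y::real)\<^sup>2"
proof -
  define k where "k = sqrt (x\<^sup>2 + y\<^sup>2)"
  show thesis
  proof (cases "k = 0")
    case True
    then show thesis
      using that [of 0 0] by (simp add: k_def)
  next
    case False
    have k2: "k\<^sup>2 = x\<^sup>2 + y\<^sup>2"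
      by (simp add: k_def)
    have "(x / k)\<^sup>2 + (y / k)\<^sup>2 = (x\<^sup>2 + y\<^sup>2) / k\<^sup>2"
      by (simp add: power_divide add_divide_distrib)
    also have "\<dots> = 1"
      using False by (simp flip: k2)
    finally obtain t where "x / k = cos t" "y / k = sin t"
      using cos_sin_angle by metis
    then have "x = k * cos t" "y = k * sin t"
      using False by (simp_all add: field_simps)
    moreover have "0 \<le> k"
      by (simp add: k_def)
    ultimately show thesis
      using k2 by (intro that)
  qed
qed

lemma ellipse_support_leD:
  assumes ab: "0 < b" "0 < a" and le: "\<And>\<phi>. x * cos \<phi> + y * sin \<phi> \<le> ell_support a b \<phi>"
  shows "(x / a)\<^sup>2 + (y / b)\<^sup>2 \<le> 1"
proof -
  define Q where "Q = (x / a)\<^sup>2 + (y / b)\<^sup>2"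
  \<comment> \<open>The direction of the gradient of the quadratic form at the point.\<close>
  obtain k \<phi> where k: "0 \<le> k" "x / a\<^sup>2 = k * cos \<phi>" "y / b\<^sup>2 = k * sin \<phi>"
    by (rule polar_direction)
  have "Q = x * (x / a\<^sup>2) + y * (y / b\<^sup>2)"
    by (simp add: Q_def power2_eq_square)
  also have "\<dots> = k * (x * cos \<phi> + y * sin \<phi>)"
    unfolding k by (simp add: algebra_simps)
  also have "\<dots> \<le> k * ell_support a b \<phi>"
    using le k(1) by (rule mult_left_mono)
  finally have 1: "Q \<le> k * ell_support a b \<phi>" .
  have "(k * ell_support a b \<phi>)\<^sup>2 = a\<^sup>2 * (k * cos \<phi>)\<^sup>2 + b\<^sup>2 * (k * sin \<phi>)\<^sup>2"
    by (simp add: power_mult_distrib ell_support_sq algebra_simps)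
  also have "\<dots> = Q"
    unfolding k(2,3) [symmetric] Q_def using ab by (simp add: power2_eq_square)
  finally have "(k * ell_support a b \<phi>)\<^sup>2 = Q" .
  moreover have "0 \<le> Q"
    by (simp add: Q_def)
  ultimately have Q_sq: "Q\<^sup>2 \<le> Q"
    using 1 power_mono [of Q "k * ell_support a b \<phi>" 2] by simp
  have "Q \<le> 1"
  proof (rule ccontr)
    assume "\<not> Q \<le> 1"
    then have "Q * 1 < Q * Q"
      by (intro mult_strict_left_mono) auto
    with Q_sq show False
      by (simp add: power2_eq_square)
  qed
  then show ?thesis
    by (simp add: Q_def)
qed

lemma parallel_body_inner_iff:
  assumes ab: "0 < b" "0 < a" and r: "0 \<le> r"
  shows "w \<in> parallel_body 1 a b r \<longleftrightarrow> (\<forall>s. ((r * cos s - w $ 1) / a)\<^sup>2 + ((r * sin s - w $ 2) / b)\<^sup>2 \<le> 1)"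
  (is "?S \<longleftrightarrow> ?Q")
proof
  assume w: ?S
  have "(r * cos s - w $ 1) * cos \<phi> + (r * sin s - w $ 2) * sin \<phi> \<le> ell_support a b \<phi>" for s \<phi>
  proof -
    have "r * cos (s - \<phi>) \<le> r * 1"
      using r by (intro mult_left_mono) auto
    moreover have "w $ 1 * cos (\<phi> + pi) + w $ 2 * sin (\<phi> + pi) \<le> ell_support a b (\<phi> + pi) - r"
      using w by (simp add: parallel_body_def del: cos_periodic_pi sin_periodic_pi)
    ultimately show ?thesis
      by (simp add: ell_support_def cos_diff algebra_simps)
  qed
  then show ?Q
    using ellipse_support_leD [OF ab] by blast
next
  assume q: ?Q
  have "w $ 1 * cos \<phi> + w $ 2 * sin \<phi> \<le> ell_support a b \<phi> - r" for \<phi>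
  proof -
    have "(r * cos (\<phi> + pi) - w $ 1) * cos (\<phi> + pi) + (r * sin (\<phi> + pi) - w $ 2) * sin (\<phi> + pi)
        \<le> ell_support a b (\<phi> + pi)"
      using q by (intro ellipse_support_le [OF ab]) blast
    then have "r * ((cos \<phi>)\<^sup>2 + (sin \<phi>)\<^sup>2) + (w $ 1 * cos \<phi> + w $ 2 * sin \<phi>) \<le> ell_support a b \<phi>"
      by (simp add: ell_support_def power2_eq_square algebra_simps
          del: sin_cos_squared_add sin_cos_squared_add2 sin_cos_squared_add3)
    then show ?thesis
      by simp
  qed
  then show ?S
    by (simp add: parallel_body_def)
qed


lemma ellipse_support_attained:
  assumes ab: "0 < b" "b \<le> a"
  obtains t where "a * cos t * cos \<phi> + b * sin t * sin \<phi> = ell_support a b \<phi>"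
proof -
  define h where "h = ell_support a b \<phi>"
  have h: "0 < h"
    unfolding h_def by (rule ell_support_bounds [OF ab])
  have h2: "h * h = a * a * (cos \<phi> * cos \<phi>) + b * b * (sin \<phi> * sin \<phi>)"
    using ell_support_sq [of a b \<phi>] by (simp add: h_def power2_eq_square)
  have "(a * cos \<phi> / h)\<^sup>2 + (b * sin \<phi> / h)\<^sup>2 = (h * h) / h\<^sup>2"
    unfolding h2 by (simp add: power2_eq_square add_divide_distrib algebra_simps)
  also have "\<dots> = 1"
    using h by (simp add: power2_eq_square)
  finally obtain t where t: "a * cos \<phi> / h = cos t" "b * sin \<phi> / h = sin t"
    using cos_sin_angle by metis
  have "a * cos t * cos \<phi> + b * sin t * sin \<phi> = (h * h) / h"
    unfolding t [symmetric] h2 by (simp add: add_divide_distrib algebra_simps)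
  then show thesis
    using that [of t] h by (simp add: h_def)
qed

lemma ellipse_param_support_le:
  assumes ab: "0 < b" "0 < a"
  shows "a * cos t * cos \<phi> + b * sin t * sin \<phi> \<le> ell_support a b \<phi>"
  using ellipse_support_le [OF ab, of "a * cos t" "b * sin t" \<phi>] ab by simp

lemma parallel_body_outer_iff:
  assumes ab: "0 < b" "b \<le> a" and r: "0 \<le> r"
  shows "w \<in> parallel_body (-1) a b r \<longleftrightarrow> (\<forall>t. (w $ 1 + a * cos t)\<^sup>2 + (w $ 2 + b * sin t)\<^sup>2 \<le> r\<^sup>2)"
  (is "?T \<longleftrightarrow> ?P")
proof
  assume w: ?T
  show ?P
  proof
    fix t
    obtain k \<phi> where k: "0 \<le> k" "w $ 1 + a * cos t = k * cos \<phi>" "w $ 2 + b * sin t = k * sin \<phi>"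
      "k\<^sup>2 = (w $ 1 + a * cos t)\<^sup>2 + (w $ 2 + b * sin t)\<^sup>2"
      by (rule polar_direction)
    have "k * ((cos \<phi>)\<^sup>2 + (sin \<phi>)\<^sup>2) = (k * cos \<phi>) * cos \<phi> + (k * sin \<phi>) * sin \<phi>"
      by (simp add: power2_eq_square distrib_left
          del: sin_cos_squared_add sin_cos_squared_add2 sin_cos_squared_add3)
    then have "k = (k * cos \<phi>) * cos \<phi> + (k * sin \<phi>) * sin \<phi>"
      by simp
    also have "\<dots> = (w $ 1 * cos \<phi> + w $ 2 * sin \<phi>) + (a * cos t * cos \<phi> + b * sin t * sin \<phi>)"
      unfolding k(2,3) [symmetric] by (simp add: algebra_simps)
    also have "\<dots> \<le> (r - ell_support a b \<phi>) + ell_support a b \<phi>"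
      using w ab by (intro add_mono ellipse_param_support_le) (auto simp: parallel_body_def)
    finally show "(w $ 1 + a * cos t)\<^sup>2 + (w $ 2 + b * sin t)\<^sup>2 \<le> r\<^sup>2"
      unfolding k(4) [symmetric] using k(1) by (intro power_mono) auto
  qed
next
  assume p: ?P
  have "w $ 1 * cos \<phi> + w $ 2 * sin \<phi> \<le> r - ell_support a b \<phi>" for \<phi>
  proof -
    obtain t where t: "a * cos t * cos \<phi> + b * sin t * sin \<phi> = ell_support a b \<phi>"
      by (rule ellipse_support_attained [OF ab])
    define x y where "x = w $ 1 + a * cos t" and "y = w $ 2 + b * sin t"
    have "(x * cos \<phi> + y * sin \<phi>)\<^sup>2 + (x * sin \<phi> - y * cos \<phi>)\<^sup>2 = x\<^sup>2 + y\<^sup>2"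
      using sin_cos_squared_add [of \<phi>] by algebra
    then have "(x * cos \<phi> + y * sin \<phi>)\<^sup>2 \<le> r\<^sup>2"
      using p [THEN spec, of t] zero_le_power2 [of "x * sin \<phi> - y * cos \<phi>"] unfolding x_def y_def by linarith
    then have "x * cos \<phi> + y * sin \<phi> \<le> r"
      using r by (rule power2_le_imp_le)
    then show ?thesis
      using t by (simp add: x_def y_def algebra_simps)
  qed
  then show ?T
    by (simp add: parallel_body_def)
qed

lemma contact_imp_outer_body:
  assumes ab: "0 < b" "b \<le> a" and r: "0 < r" and z: "torus_map a b r z = w"
  shows "w \<in> parallel_body 1 a b (- r)"
proof -
  have "w $ 1 * cos \<phi> + w $ 2 * sin \<phi> \<le> ell_support a b \<phi> + r" for \<phi>
  proof -
    have "r * cos (z $ 1 - \<phi>) \<le> r * 1"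
      using r by (intro mult_left_mono) auto
    moreover have "a * cos (z $ 2) * cos (\<phi> + pi) + b * sin (z $ 2) * sin (\<phi> + pi) \<le> ell_support a b (\<phi> + pi)"
      using ab by (intro ellipse_param_support_le) auto
    ultimately show ?thesis
      by (simp add: z [symmetric] torus_map_def ell_support_def cos_diff algebra_simps)
  qed
  then show ?thesis
    by (simp add: parallel_body_def)
qed

text \<open>
  If one of the curves lies on one side of the other, then any contact is a local extremum and
  hence tangential.
\<close>

lemma contact_not_inner_body:
  assumes ab: "0 < b" "b \<le> a" and r: "0 < r" and z: "torus_map a b r z = w" "torus_jac a b r z \<noteq> 0"
  shows "w \<notin> parallel_body 1 a b r"
proof
  assume w: "w \<in> parallel_body 1 a b r"
  define q where "q s = ((r * cos s - w $ 1) / a)\<^sup>2 + ((r * sin s - w $ 2) / b)\<^sup>2" for s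
  have a: "0 < a" using ab by simp
  have deriv: "(q has_real_derivative - 2 * torus_jac a b r z / (a * b)) (at (z $ 1))"
    using ellipse_form_DERIV [OF ab(1) a z(1)] unfolding q_def [abs_def] .
  have max: "\<forall>s. \<bar>z $ 1 - s\<bar> < 1 \<longrightarrow> q s \<le> q (z $ 1)"
    using parallel_body_inner_iff [OF ab(1) a, of r w] w r torus_map_ellipse [OF ab(1) a z(1)]
    by (simp add: q_def)
  have "- 2 * torus_jac a b r z / (a * b) = 0"
    by (rule DERIV_local_max [OF deriv _ max]) simp
  then show False
    using z(2) ab by simp
qed

lemma contact_not_outer_body:
  assumes ab: "0 < b" "b \<le> a" and r: "0 < r" and z: "torus_map a b r z = w" "torus_jac a b r z \<noteq> 0"
  shows "w \<notin> parallel_body (-1) a b r"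
proof
  assume w: "w \<in> parallel_body (-1) a b r"
  define p where "p t = (w $ 1 + a * cos t)\<^sup>2 + (w $ 2 + b * sin t)\<^sup>2" for t
  have c: "w $ 1 + a * cos (z $ 2) = r * cos (z $ 1)" "w $ 2 + b * sin (z $ 2) = r * sin (z $ 1)"
    by (simp_all add: z(1) [symmetric] torus_map_def)
  have "(p has_real_derivative 2 * (w $ 1 + a * cos (z $ 2)) * (- (a * sin (z $ 2)))
      + 2 * (w $ 2 + b * sin (z $ 2)) * (b * cos (z $ 2))) (at (z $ 2))"
    unfolding p_def [abs_def] by (auto intro!: derivative_eq_intros simp: algebra_simps)
  also have "2 * (w $ 1 + a * cos (z $ 2)) * (- (a * sin (z $ 2)))
      + 2 * (w $ 2 + b * sin (z $ 2)) * (b * cos (z $ 2)) = 2 * torus_jac a b r z"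
    unfolding c torus_jac_def by (simp add: algebra_simps)
  finally have deriv: "(p has_real_derivative 2 * torus_jac a b r z) (at (z $ 2))" .
  have max: "\<forall>t. \<bar>z $ 2 - t\<bar> < 1 \<longrightarrow> p t \<le> p (z $ 2)"
  proof -
    have "p (z $ 2) = r\<^sup>2 * ((cos (z $ 1))\<^sup>2 + (sin (z $ 1))\<^sup>2)"
      unfolding p_def c by (simp add: power_mult_distrib distrib_left
          del: sin_cos_squared_add sin_cos_squared_add2 sin_cos_squared_add3)
    then show ?thesis
      using parallel_body_outer_iff [OF ab, of r w] w r by (simp add: p_def)
  qed
  have "2 * torus_jac a b r z = 0"
    by (rule DERIV_local_max [OF deriv _ max]) simp
  then show False
    using z(2) by simp
qed

lemma continuous_avoids_value:
  fixes f :: "'a::topological_space \<Rightarrow> real"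
  assumes "connected S" "continuous_on S f" "\<And>x. x \<in> S \<Longrightarrow> f x \<noteq> v"
  shows "(\<forall>x\<in>S. f x < v) \<or> (\<forall>x\<in>S. v < f x)"
proof (rule ccontr)
  assume "\<not> ?thesis"
  then obtain x y where xy: "x \<in> S" "v < f x" "y \<in> S" "f y < v"
    using assms(3) by (meson linorder_neqE_linordered_idom)
  have "connected (f ` S)"
    using assms(1,2) by (rule connected_continuous_image [rotated])
  then have "v \<in> f ` S"
    using xy connectedD_interval [of "f ` S" "f y" "f x" v] by (meson imageI less_imp_le)
  then show False
    using assms(3) by auto
qed

text \<open>
  Without contacts, connectedness leaves three cases: the circle lies inside the ellipse, the
  ellipse lies inside the circle, or each lies outside the other. In the last case, the
  disk and the elliptic region are disjoint, and a line separates them.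
\<close>

lemma no_contact_cases:
  assumes ab: "0 < b" "b \<le> a" and r: "0 < r" and none: "\<And>z. torus_map a b r z \<noteq> w"
    and outer: "w \<in> parallel_body 1 a b (- r)"
  shows "w \<in> parallel_body 1 a b r \<or> w \<in> parallel_body (-1) a b r"
proof -
  have a: "0 < a" using ab by simp
  define Q where "Q x = ((x $ 1 - w $ 1) / a)\<^sup>2 + ((x $ 2 - w $ 2) / b)\<^sup>2" for x :: "real^2"
  define q where "q s = ((r * cos s - w $ 1) / a)\<^sup>2 + ((r * sin s - w $ 2) / b)\<^sup>2" for s
  define p where "p t = (w $ 1 + a * cos t)\<^sup>2 + (w $ 2 + b * sin t)\<^sup>2" for t
  have "q s \<noteq> 1" for s
    using ellipse_angle [OF ab(1) a, of r s w] none unfolding q_def by metis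
  then have q_cases: "(\<forall>s\<in>UNIV. q s < 1) \<or> (\<forall>s\<in>UNIV. 1 < q s)"
    unfolding q_def [abs_def] by (intro continuous_avoids_value continuous_intros) (use ab a in auto)
  have "p t \<noteq> r\<^sup>2" for t
  proof
    assume "p t = r\<^sup>2"
    then have "((w $ 1 + a * cos t) / r)\<^sup>2 + ((w $ 2 + b * sin t) / r)\<^sup>2 = 1"
      using r by (simp add: p_def power_divide add_divide_distrib [symmetric])
    then obtain s where "(w $ 1 + a * cos t) / r = cos s" "(w $ 2 + b * sin t) / r = sin s"
      using cos_sin_angle by metis
    then have "torus_map a b r (vector [s, t]) = w"
      using r by (simp add: torus_map_def vec_eq_iff forall_2 field_simps)
    then show False using none by blast
  qed
  then have p_cases: "(\<forall>t\<in>UNIV. p t < r\<^sup>2) \<or> (\<forall>t\<in>UNIV. r\<^sup>2 < p t)"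
    unfolding p_def [abs_def] by (intro continuous_avoids_value continuous_intros) auto
  have disjoint_False: False if q1: "\<forall>s. 1 < q s" and p1: "\<forall>t. r\<^sup>2 < p t"
  proof -
    \<comment> \<open>The elliptic region; the disk is \<open>cball 0 r\<close>.\<close>
    define K where "K = {x. Q x \<le> 1}"
    have Q_cont: "continuous_on A Q" for A
      unfolding Q_def [abs_def] using ab a by (intro continuous_intros) auto
    have "closed K"
      unfolding K_def by (intro closed_Collect_le Q_cont continuous_intros)
    have K_param: "\<exists>t. x $ 1 = w $ 1 + a * cos t \<and> x $ 2 = w $ 2 + b * sin t" if "Q x = 1" for x
    proof -
      obtain t where "(x $ 1 - w $ 1) / a = cos t" "(x $ 2 - w $ 2) / b = sin t"
        using cos_sin_angle [of "(x $ 1 - w $ 1) / a" "(x $ 2 - w $ 2) / b"] \<open>Q x = 1\<close> unfolding Q_def by metis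
      then show ?thesis
        using ab a by (intro exI [of _ t]) (simp add: field_simps)
    qed
    have norm_sq: "(norm x)\<^sup>2 = (x $ 1)\<^sup>2 + (x $ 2)\<^sup>2" for x :: "real^2"
      unfolding power2_norm_eq_inner by (simp add: inner_vec_def sum_2 power2_eq_square)
    have "Q x \<noteq> 1" if x: "x \<in> cball 0 r" for x
    proof
      assume "Q x = 1"
      then obtain t where "x $ 1 = w $ 1 + a * cos t" "x $ 2 = w $ 2 + b * sin t"
        using K_param by blast
      then have "r\<^sup>2 < (norm x)\<^sup>2"
        using p1 by (simp add: norm_sq p_def)
      moreover have "(norm x)\<^sup>2 \<le> r\<^sup>2"
        using x by (intro power_mono) auto
      ultimately show False by simp
    qed
    then have "(\<forall>x\<in>cball 0 r. Q x < 1) \<or> (\<forall>x\<in>cball 0 r. 1 < Q x)"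
      by (intro continuous_avoids_value Q_cont convex_connected convex_cball)
    moreover have "vector [r, 0] \<in> cball (0 :: real^2) r" "1 < Q (vector [r, 0])"
    proof -
      have "(norm (vector [r, 0] :: real^2))\<^sup>2 = r\<^sup>2"
        by (simp add: norm_sq)
      then show "vector [r, 0] \<in> cball (0 :: real^2) r"
        using r by (simp add: power2_eq_iff_nonneg)
      show "1 < Q (vector [r, 0])"
        using q1 [THEN spec, of 0] by (simp add: Q_def q_def)
    qed
    ultimately have disj: "K \<inter> cball 0 r = {}"
      by (force simp: K_def)
    have K_iff: "x \<in> K \<longleftrightarrow> (\<forall>\<phi>. (x $ 1 - w $ 1) * cos \<phi> + (x $ 2 - w $ 2) * sin \<phi> \<le> ell_support a b \<phi>)" for x
      using ellipse_support_le [OF ab(1) a] ellipse_support_leD [OF ab(1) a] unfolding K_def Q_def by blast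
    have "convex K"
    proof (rule convexI)
      fix x y and u v :: real
      assume xy: "x \<in> K" "y \<in> K" and uv: "0 \<le> u" "0 \<le> v" "u + v = 1"
      have "((u *\<^sub>R x + v *\<^sub>R y) $ 1 - w $ 1) * cos \<phi> + ((u *\<^sub>R x + v *\<^sub>R y) $ 2 - w $ 2) * sin \<phi> \<le> ell_support a b \<phi>" for \<phi>
      proof -
        have v: "v = 1 - u" using uv by simp
        have "((u *\<^sub>R x + v *\<^sub>R y) $ 1 - w $ 1) * cos \<phi> + ((u *\<^sub>R x + v *\<^sub>R y) $ 2 - w $ 2) * sin \<phi>
            = u * ((x $ 1 - w $ 1) * cos \<phi> + (x $ 2 - w $ 2) * sin \<phi>)
            + v * ((y $ 1 - w $ 1) * cos \<phi> + (y $ 2 - w $ 2) * sin \<phi>)"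
          unfolding v by (simp add: algebra_simps)
        also have "\<dots> \<le> u * ell_support a b \<phi> + v * ell_support a b \<phi>"
          using xy uv by (intro add_mono mult_left_mono) (auto simp: K_iff)
        also have "\<dots> = ell_support a b \<phi>"
          unfolding v by (simp add: algebra_simps)
        finally show ?thesis .
      qed
      then show "u *\<^sub>R x + v *\<^sub>R y \<in> K"
        by (simp add: K_iff)
    qed
    have "cball (0 :: real^2) r \<noteq> {}"
      using r by simp
    then obtain d e where sep: "\<And>x. x \<in> K \<Longrightarrow> d \<bullet> x < e" "\<And>x. x \<in> cball 0 r \<Longrightarrow> e < d \<bullet> x"
      using separating_hyperplane_closed_compact [OF \<open>convex K\<close> \<open>closed K\<close> convex_cball compact_cball _ disj]
      by blast
    obtain k \<phi> where k: "0 \<le> k" "d $ 1 = k * cos \<phi>" "d $ 2 = k * sin \<phi>"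
      by (rule polar_direction)
    have d: "d \<bullet> x = k * (x $ 1 * cos \<phi> + x $ 2 * sin \<phi>)" for x
      by (simp add: inner_vec_def sum_2 k algebra_simps)
    obtain t where t: "a * cos t * cos \<phi> + b * sin t * sin \<phi> = ell_support a b \<phi>"
      by (rule ellipse_support_attained [OF ab])
    have "d \<bullet> vector [w $ 1 + a * cos t, w $ 2 + b * sin t] < e"
      using ab a by (intro sep(1)) (simp add: K_def Q_def)
    moreover have "e < d \<bullet> vector [r * cos (\<phi> + pi), r * sin (\<phi> + pi)]"
    proof (rule sep(2))
      have "(norm (vector [r * cos (\<phi> + pi), r * sin (\<phi> + pi)] :: real^2))\<^sup>2
          = r\<^sup>2 * ((cos \<phi>)\<^sup>2 + (sin \<phi>)\<^sup>2)"
        unfolding norm_sq by (simp add: power_mult_distrib distrib_left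
          del: sin_cos_squared_add sin_cos_squared_add2 sin_cos_squared_add3)
      then show "vector [r * cos (\<phi> + pi), r * sin (\<phi> + pi)] \<in> cball (0 :: real^2) r"
        using r by (simp add: power2_eq_iff_nonneg)
    qed
    ultimately have "k * ((w $ 1 * cos \<phi> + w $ 2 * sin \<phi>) + ell_support a b \<phi>) < k * - (r * ((cos \<phi>)\<^sup>2 + (sin \<phi>)\<^sup>2))"
      unfolding d t [symmetric] by (simp add: power2_eq_square algebra_simps
          del: sin_cos_squared_add sin_cos_squared_add2 sin_cos_squared_add3)
    then have lt: "k * ((w $ 1 * cos \<phi> + w $ 2 * sin \<phi>) + ell_support a b \<phi>) < k * - r"
      by simp
    have "(w $ 1 * cos \<phi> + w $ 2 * sin \<phi>) + ell_support a b \<phi> < - r"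
      using mult_left_less_imp_less [OF lt k(1)] .
    moreover have "w $ 1 * cos (\<phi> + pi) + w $ 2 * sin (\<phi> + pi) \<le> ell_support a b (\<phi> + pi) + r"
      using outer by (simp add: parallel_body_def del: cos_periodic_pi sin_periodic_pi)
    ultimately show False
      by (simp add: ell_support_def)
  qed
  show ?thesis
    using q_cases
  proof
    assume "\<forall>s\<in>UNIV. q s < 1"
    then have "w \<in> parallel_body 1 a b r"
      using parallel_body_inner_iff [OF ab(1) a, of r w] r by (auto simp: q_def less_imp_le)
    then show ?thesis ..
  next
    assume q1: "\<forall>s\<in>UNIV. 1 < q s"
    then have "\<forall>t\<in>UNIV. p t < r\<^sup>2"
      using p_cases disjoint_False by auto
    then have "w \<in> parallel_body (-1) a b r"
      using parallel_body_outer_iff [OF ab, of r w] r by (auto simp: p_def less_imp_le)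
    then show ?thesis ..
  qed
qed

section \<open>Areas of the sets of generic positions\<close>

lemma lmeasurable_parallel_body_inner:
  assumes ab: "0 < b" "b \<le> a"
  shows "parallel_body 1 a b r \<in> lmeasurable"
proof (cases "r < b")
  case True
  then show ?thesis
    using measure_parallel_body_inner_full(1) [OF ab, of r] measure_parallel_body_inner_partial(1) [OF ab, of r]
    by (cases "r * a \<le> b\<^sup>2") auto
next
  case False
  then show ?thesis
    using negligible_parallel_body_inner [OF ab(1), of r a] by (simp add: negligible_imp_measurable)
qed

lemma lmeasurable_parallel_body_outer:
  assumes ab: "0 < b" "b \<le> a"
  shows "parallel_body (-1) a b r \<in> lmeasurable"
proof (cases "a < r")
  case True
  then show ?thesis
    using measure_parallel_body_outer_full(1) [OF ab, of r] measure_parallel_body_outer_partial(1) [OF ab, of r]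
    by (cases "a\<^sup>2 \<le> r * b") auto
next
  case False
  then show ?thesis
    using negligible_parallel_body_outer [of a r b] ab by (simp add: negligible_imp_measurable)
qed

lemma torus_map_imp_contacts:
  assumes ab: "0 < b" "0 < a" and w: "w \<notin> exceptional a b r" and z: "torus_map a b r z = w"
  shows "contacts a b r w \<noteq> {}"
proof -
  obtain s where s: "-pi < s" "s \<le> pi" "sin s = sin (z $ 1)" "cos s = cos (z $ 1)"
    using sincos_principal_value [of "z $ 1"] by metis
  have "((r * cos s - w $ 1) / a)\<^sup>2 + ((r * sin s - w $ 2) / b)\<^sup>2 = 1"
    unfolding s(3,4) by (rule torus_map_ellipse [OF ab z])
  then obtain t where "vector [s, t] \<in> contacts a b r w"
    by (rule contacts_of_ellipse [OF ab w s(1,2)])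
  then show ?thesis by blast
qed

definition generic_positions :: "real \<Rightarrow> real \<Rightarrow> real \<Rightarrow> nat \<Rightarrow> (real^2) set" where
  "generic_positions a b r k = {w. w \<notin> exceptional a b r \<and> card (contacts a b r w) = k}"

lemma generic_positions_Un:
  assumes ab: "0 < b" "b \<le> a" and r: "0 < r"
  shows "generic_positions a b r 2 \<union> generic_positions a b r 4
    = parallel_body 1 a b (- r) - (parallel_body 1 a b r \<union> parallel_body (-1) a b r) - exceptional a b r"
proof -
  have a: "0 < a" using ab by simp
  have "card (contacts a b r w) = 2 \<or> card (contacts a b r w) = 4 \<longleftrightarrow>
      w \<in> parallel_body 1 a b (- r) - (parallel_body 1 a b r \<union> parallel_body (-1) a b r)"
    if w: "w \<notin> exceptional a b r" for w
  proof -
    have "card (contacts a b r w) = 2 \<or> card (contacts a b r w) = 4 \<longleftrightarrow> contacts a b r w \<noteq> {}"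
      using card_contacts [OF ab(1) a w] by auto
    also have "\<dots> \<longleftrightarrow> w \<in> parallel_body 1 a b (- r) - (parallel_body 1 a b r \<union> parallel_body (-1) a b r)"
    proof
      assume "contacts a b r w \<noteq> {}"
      then obtain z where z: "z \<in> contacts a b r w" by blast
      then have zw: "torus_map a b r z = w"
        by (simp add: contacts_def)
      have jac: "torus_jac a b r z \<noteq> 0"
        by (rule contacts_jac_nonzero [OF w z])
      show "w \<in> parallel_body 1 a b (- r) - (parallel_body 1 a b r \<union> parallel_body (-1) a b r)"
        using contact_imp_outer_body [OF ab r zw] contact_not_inner_body [OF ab r zw jac]
          contact_not_outer_body [OF ab r zw jac] by blast
    next
      assume "w \<in> parallel_body 1 a b (- r) - (parallel_body 1 a b r \<union> parallel_body (-1) a b r)"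
      then show "contacts a b r w \<noteq> {}"
        using no_contact_cases [OF ab r, of w] torus_map_imp_contacts [OF ab(1) a w] by blast
    qed
    finally show ?thesis .
  qed
  then show ?thesis
    unfolding generic_positions_def by blast
qed

text \<open>
  Up to the exceptional positions, the first equation is the area of all positions with a contact,
  and the second the integral of the number of contacts.
\<close>

lemma measure_generic_positions:
  assumes ab: "0 < b" "b \<le> a" and r: "0 < r"
  shows "generic_positions a b r 2 \<in> lmeasurable" "generic_positions a b r 4 \<in> lmeasurable"
    "measure lebesgue (generic_positions a b r 2) + measure lebesgue (generic_positions a b r 4)
      = A_star a b (- r) - (measure lebesgue (parallel_body 1 a b r) + measure lebesgue (parallel_body (-1) a b r))"
    "2 * measure lebesgue (generic_positions a b r 2) + 4 * measure lebesgue (generic_positions a b r 4)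
      = 16 * r * a * complete_ell_E (eccentricity a b)"
proof -
  have a: "0 < a" using ab by simp
  define V where "V = generic_positions a b r"
  define X where "X = exceptional a b r"
  define K where "K = parallel_body 1 a b (- r)"
  define S where "S = parallel_body 1 a b r"
  define T where "T = parallel_body (-1) a b r"
  obtain N :: "real^2 \<Rightarrow> ennreal" where N_meas: "N \<in> borel_measurable lebesgue"
    and N_int: "(\<integral>\<^sup>+w. N w \<partial>lebesgue) = ennreal (16 * r * a * complete_ell_E (eccentricity a b))"
    and N: "\<And>w. w \<notin> exceptional a b r \<Longrightarrow> N w = of_nat (card (contacts a b r w))"
    using nn_integral_card_contacts [OF ab r] by blast
  have X: "negligible X"
    unfolding X_def by (rule negligible_exceptional)
  have "- r * a \<le> 0"
    using r a by simp
  then have "- r * a \<le> b\<^sup>2" "- r < b"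
    using r ab zero_le_power2 [of b] by linarith+
  then have K: "K \<in> lmeasurable" "measure lebesgue K = A_star a b (- r)"
    unfolding K_def by (rule measure_parallel_body_inner_full [OF ab])+
  have ST: "S \<in> lmeasurable" "T \<in> lmeasurable"
    unfolding S_def T_def using lmeasurable_parallel_body_inner [OF ab] lmeasurable_parallel_body_outer [OF ab] by auto
  have VK: "V 2 \<union> V 4 = K - (S \<union> T) - X"
    unfolding V_def K_def S_def T_def X_def by (rule generic_positions_Un [OF ab r])
  have V: "V k \<in> sets lebesgue" for k
  proof -
    have "V k = {w \<in> space lebesgue. N w = of_nat k} - X"
      using N by (auto simp: V_def generic_positions_def X_def)
    moreover have "{w \<in> space lebesgue. N w = of_nat k} \<in> sets lebesgue"
      using N_meas by measurable
    ultimately show ?thesis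
      using negligible_imp_sets [OF X] by simp
  qed
  have V2: "V 2 \<in> lmeasurable" and V4: "V 4 \<in> lmeasurable"
    by (rule fmeasurableI2 [OF K(1) _ V], use VK in blast)+
  then show "generic_positions a b r 2 \<in> lmeasurable" "generic_positions a b r 4 \<in> lmeasurable"
    by (simp_all add: V_def)
  have disj: "V 2 \<inter> V 4 = {}"
    by (auto simp: V_def generic_positions_def)
  have sub: "S \<union> T \<subseteq> K"
  proof -
    have "w \<in> K" if "w \<in> S \<union> T" for w
    proof -
      have "w $ 1 * cos \<phi> + w $ 2 * sin \<phi> \<le> ell_support a b \<phi> + r" for \<phi>
      proof -
        have "w $ 1 * cos \<phi> + w $ 2 * sin \<phi> \<le> ell_support a b \<phi> - r
            \<or> w $ 1 * cos \<phi> + w $ 2 * sin \<phi> \<le> r - ell_support a b \<phi>"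
          using that by (auto simp: S_def T_def parallel_body_def)
        then show ?thesis
          using r ell_support_bounds(3) [OF ab, of \<phi>] by linarith
      qed
      then show ?thesis
        by (simp add: K_def parallel_body_def)
    qed
    then show ?thesis by blast
  qed
  have null: "measure lebesgue (S \<inter> T) = 0"
  proof -
    have "negligible S \<or> negligible T"
      unfolding S_def T_def
      using negligible_parallel_body_inner [OF ab(1), of r a] negligible_parallel_body_outer [OF a, of r b] ab
      by linarith
    then have "negligible (S \<inter> T)"
      by (auto intro: negligible_subset)
    then show ?thesis
      by (rule negligible_imp_measure0)
  qed
  have "measure lebesgue (V 2) + measure lebesgue (V 4) = measure lebesgue (V 2 \<union> V 4)"
    using measure_Un3 [OF V2 V4] disj by simp
  also have "\<dots> = measure lebesgue (K - (S \<union> T))"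
  proof (rule measure_negligible_symdiff)
    show "K - (S \<union> T) \<in> lmeasurable"
      using K(1) ST by (intro fmeasurable.Diff fmeasurable.Un)
    show "negligible (K - (S \<union> T) - (V 2 \<union> V 4) \<union> (V 2 \<union> V 4 - (K - (S \<union> T))))"
      unfolding VK by (rule negligible_subset [OF X]) blast
  qed
  also have "\<dots> = measure lebesgue K - measure lebesgue (S \<union> T)"
    using K(1) ST sub by (intro measurable_measure_Diff) (auto intro: fmeasurable.Un)
  also have "measure lebesgue (S \<union> T) = measure lebesgue S + measure lebesgue T"
    using measure_Un3 [OF ST] null by simp
  finally show "measure lebesgue (generic_positions a b r 2) + measure lebesgue (generic_positions a b r 4)
      = A_star a b (- r) - (measure lebesgue (parallel_body 1 a b r) + measure lebesgue (parallel_body (-1) a b r))"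
    by (simp add: V_def K(2) S_def T_def)
  have "ennreal (16 * r * a * complete_ell_E (eccentricity a b)) = (\<integral>\<^sup>+w. N w \<partial>lebesgue)"
    using N_int by simp
  also have "\<dots> = (\<integral>\<^sup>+w. 2 * indicator (V 2) w + 4 * indicator (V 4) w \<partial>lebesgue)"
  proof (rule nn_integral_cong_AE)
    have "AE w in lebesgue. w \<notin> X"
      using X by (intro AE_not_in) (simp add: negligible_iff_null_sets)
    then show "AE w in lebesgue. N w = 2 * indicator (V 2) w + 4 * indicator (V 4) w"
    proof (rule AE_mp, intro AE_I2 impI)
      fix w assume "w \<notin> X"
      then have w: "w \<notin> exceptional a b r"
        by (simp add: X_def)
      show "N w = 2 * indicator (V 2) w + 4 * indicator (V 4) w"
        using card_contacts(2) [OF ab(1) a w] w by (auto simp: N V_def generic_positions_def)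
    qed
  qed
  also have "\<dots> = 2 * emeasure lebesgue (V 2) + 4 * emeasure lebesgue (V 4)"
    using V by (simp add: nn_integral_add nn_integral_cmult)
  also have "\<dots> = ennreal (2 * measure lebesgue (V 2) + 4 * measure lebesgue (V 4))"
    using emeasure_eq_ennreal_measure [OF fmeasurableD2 [OF V2]] emeasure_eq_ennreal_measure [OF fmeasurableD2 [OF V4]]
    by (simp add: ennreal_plus ennreal_mult)
  finally have "ennreal (16 * r * a * complete_ell_E (eccentricity a b))
      = ennreal (2 * measure lebesgue (V 2) + 4 * measure lebesgue (V 4))" .
  moreover have "0 \<le> 16 * r * a * complete_ell_E (eccentricity a b)"
    using has_integral_torus_jac [OF ab r] by (rule has_integral_nonneg) simp
  ultimately show "2 * measure lebesgue (generic_positions a b r 2) + 4 * measure lebesgue (generic_positions a b r 4)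
      = 16 * r * a * complete_ell_E (eccentricity a b)"
    by (subst (asm) ennreal_inj) (simp_all add: V_def)
qed


section \<open>Sets of positions in the coordinates of the ellipse\<close>

lemma measure_ell_position_vimage:
  assumes "V \<in> lmeasurable"
  shows "{m. ell_position \<theta> c m \<in> V} \<in> lmeasurable"
    "measure lebesgue {m. ell_position \<theta> c m \<in> V} = measure lebesgue V"
proof -
  define g where "g w = (vector [c $ 1 + (cos \<theta> * w $ 1 + - sin \<theta> * w $ 2), c $ 2 + (sin \<theta> * w $ 1 + cos \<theta> * w $ 2)] :: real^2)" for w :: "real^2"
  define g' where "g' w h = (vector [cos \<theta> * h $ 1 + - sin \<theta> * h $ 2, sin \<theta> * h $ 1 + cos \<theta> * h $ 2] :: real^2)" for w h :: "real^2"
  have gl: "ell_position \<theta> c (g w) = w" for w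
  proof -
    have "cos \<theta> * (cos \<theta> * x + - sin \<theta> * y) + sin \<theta> * (sin \<theta> * x + cos \<theta> * y) = x"
      "- sin \<theta> * (cos \<theta> * x + - sin \<theta> * y) + cos \<theta> * (sin \<theta> * x + cos \<theta> * y) = y" for x y
      using sin_cos_squared_add [of \<theta>] by algebra+
    then show ?thesis
      by (simp add: ell_position_def major_coord_def minor_coord_def g_def vec_eq_iff forall_2)
  qed
  have gr: "g (ell_position \<theta> c m) = m" for m
  proof -
    have "cos \<theta> * (cos \<theta> * x + sin \<theta> * y) + - sin \<theta> * (- sin \<theta> * x + cos \<theta> * y) = x"
      "sin \<theta> * (cos \<theta> * x + sin \<theta> * y) + cos \<theta> * (- sin \<theta> * x + cos \<theta> * y) = y" for x y
      using sin_cos_squared_add [of \<theta>] by algebra+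
    from this [of "m $ 1 - c $ 1" "m $ 2 - c $ 2"] show ?thesis
      by (simp add: ell_position_def major_coord_def minor_coord_def g_def vec_eq_iff forall_2)
  qed
  have image: "g ` V = {m. ell_position \<theta> c m \<in> V}"
    using gl gr by (auto simp: image_iff) metis
  have "(g has_derivative g' w) (at w within V)" for w
    unfolding g_def g'_def
    by (rule has_derivative_eq_rhs [OF has_derivative_vector_2])
      (auto intro!: derivative_eq_intros vec_nth_has_derivative)
  moreover have "inj_on g V"
    by (rule inj_onI) (metis gl)
  moreover have "det (matrix (g' w)) = 1" for w
    unfolding g'_def det_matrix_vector_2 by (simp flip: power2_eq_square)
  moreover have "((\<lambda>w. 1) has_integral measure lebesgue V) V"
    using assms by (simp add: lmeasure_integral has_integral_iff lmeasurable_iff_integrable_on [symmetric])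
  ultimately show "{m. ell_position \<theta> c m \<in> V} \<in> lmeasurable"
    "measure lebesgue {m. ell_position \<theta> c m \<in> V} = measure lebesgue V"
    using has_measure_differentiable_image [of V g g' "measure lebesgue V"] assms unfolding image
    by (auto simp: fmeasurableD)
qed

lemma positions_circle_inside_eq:
  assumes ab: "0 < b" "0 < a" and r: "0 < r"
  shows "positions_circle_inside a b \<theta> c r = {m. ell_position \<theta> c m \<in> parallel_body 1 a b r}"
proof -
  have "sphere c r = range (circle_point \<theta> c r)"
    using circle_point_in_sphere [OF r] circle_point_surj [OF r] by blast
  then have "sphere c r \<subseteq> ellipse_region a b \<theta> m \<longleftrightarrow> (\<forall>s. circle_point \<theta> c r s \<in> ellipse_region a b \<theta> m)" for m
    by auto
  then show ?thesis
    using r by (simp add: positions_circle_inside_def parallel_body_inner_iff [OF ab] ellipse_region_def coords_circle_point)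
qed

lemma positions_ellipse_inside_eq:
  assumes ab: "0 < b" "b \<le> a" and r: "0 < r"
  shows "positions_ellipse_inside a b \<theta> c r = {m. ell_position \<theta> c m \<in> parallel_body (-1) a b r}"
proof -
  have a: "0 < a" using ab by simp
  have "ellipse a b \<theta> m \<subseteq> cball c r \<longleftrightarrow> ell_position \<theta> c m \<in> parallel_body (-1) a b r" for m
  proof -
    define w where "w = ell_position \<theta> c m"
    have dist_sq: "(dist c x)\<^sup>2 = (w $ 1 + major_coord \<theta> m x)\<^sup>2 + (w $ 2 + minor_coord \<theta> m x)\<^sup>2" for x
    proof -
      have "w $ 1 + major_coord \<theta> m x = cos \<theta> * (x $ 1 - c $ 1) + sin \<theta> * (x $ 2 - c $ 2)"
        "w $ 2 + minor_coord \<theta> m x = - sin \<theta> * (x $ 1 - c $ 1) + cos \<theta> * (x $ 2 - c $ 2)"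
        by (simp_all add: w_def ell_position_def major_coord_def minor_coord_def algebra_simps)
      moreover have "(dist c x)\<^sup>2 = (x $ 1 - c $ 1)\<^sup>2 + (x $ 2 - c $ 2)\<^sup>2"
        by (simp add: dist_vec_def L2_set_def sum_2 dist_real_def power2_commute)
      moreover have "(C * u + S * v)\<^sup>2 + (- S * u + C * v)\<^sup>2 = u\<^sup>2 + v\<^sup>2" if "S\<^sup>2 + C\<^sup>2 = 1" for C S u v :: real
        using that by algebra
      ultimately show ?thesis
        by (simp only: sin_cos_squared_add)
    qed
    have "ellipse a b \<theta> m \<subseteq> cball c r \<longleftrightarrow> (\<forall>x\<in>ellipse a b \<theta> m. (dist c x)\<^sup>2 \<le> r\<^sup>2)"
      using r by (auto simp: subset_iff power2_le_iff_abs_le)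
    also have "\<dots> \<longleftrightarrow> (\<forall>t. (w $ 1 + a * cos t)\<^sup>2 + (w $ 2 + b * sin t)\<^sup>2 \<le> r\<^sup>2)"
    proof (intro iffI allI ballI)
      fix t assume *: "\<forall>x\<in>ellipse a b \<theta> m. (dist c x)\<^sup>2 \<le> r\<^sup>2"
      define x where "x = (vector [m $ 1 + (cos \<theta> * (a * cos t) - sin \<theta> * (b * sin t)),
          m $ 2 + (sin \<theta> * (a * cos t) + cos \<theta> * (b * sin t))] :: real^2)"
      have "C * (C * u - S * v) + S * (S * u + C * v) = u \<and> - S * (C * u - S * v) + C * (S * u + C * v) = v"
        if "S\<^sup>2 + C\<^sup>2 = 1" for C S u v :: real
        using that by algebra
      from this [OF sin_cos_squared_add] have x: "major_coord \<theta> m x = a * cos t" "minor_coord \<theta> m x = b * sin t"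
        by (simp_all only: major_coord_def minor_coord_def x_def vector_2 add_diff_cancel_left')
      then have "x \<in> ellipse a b \<theta> m"
        using ab a by (simp add: ellipse_def)
      then show "(w $ 1 + a * cos t)\<^sup>2 + (w $ 2 + b * sin t)\<^sup>2 \<le> r\<^sup>2"
        using * dist_sq x by metis
    next
      fix x assume *: "\<forall>t. (w $ 1 + a * cos t)\<^sup>2 + (w $ 2 + b * sin t)\<^sup>2 \<le> r\<^sup>2" and "x \<in> ellipse a b \<theta> m"
      then have "(major_coord \<theta> m x / a)\<^sup>2 + (minor_coord \<theta> m x / b)\<^sup>2 = 1"
        by (simp add: ellipse_def)
      then obtain t where "major_coord \<theta> m x / a = cos t" "minor_coord \<theta> m x / b = sin t"
        using cos_sin_angle by metis
      then have "major_coord \<theta> m x = a * cos t" "minor_coord \<theta> m x = b * sin t"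
        using ab a by (simp_all add: field_simps)
      then show "(dist c x)\<^sup>2 \<le> r\<^sup>2"
        using * by (simp add: dist_sq)
    qed
    also have "\<dots> \<longleftrightarrow> w \<in> parallel_body (-1) a b r"
      using parallel_body_outer_iff [OF ab, of r w] r by simp
    finally show ?thesis
      by (simp add: w_def)
  qed
  then show ?thesis
    by (simp add: positions_ellipse_inside_def)
qed

lemma measure_positions_intersections:
  assumes ab: "0 < b" "b \<le> a" and r: "0 < r" and V: "generic_positions a b r k \<in> lmeasurable"
  shows "positions_intersections a b \<theta> c r k \<in> lmeasurable"
    "measure lebesgue (positions_intersections a b \<theta> c r k) = measure lebesgue (generic_positions a b r k)"
proof -
  have a: "0 < a" using ab by simp
  define G where "G = {m. ell_position \<theta> c m \<in> generic_positions a b r k}"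
  define P where "P = positions_intersections a b \<theta> c r k"
  have G: "G \<in> lmeasurable" "measure lebesgue G = measure lebesgue (generic_positions a b r k)"
    unfolding G_def using measure_ell_position_vimage [OF V] by auto
  have "negligible {m. ell_position \<theta> c m \<in> exceptional a b r}"
    using measure_ell_position_vimage [of "exceptional a b r" \<theta> c] negligible_exceptional [of a b r]
    by (simp add: negligible_iff_measure)
  moreover have "G - P \<union> (P - G) \<subseteq> {m. ell_position \<theta> c m \<in> exceptional a b r}"
    using num_real_intersections_generic [OF ab(1) a r, of \<theta> c]
    by (auto simp: G_def P_def positions_intersections_def generic_positions_def)
  ultimately have neg: "negligible (G - P \<union> (P - G))"
    by (rule negligible_subset)
  show "P \<in> lmeasurable"
    using G(1) neg by (rule lmeasurable_negligible_symdiff)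
  show "measure lebesgue P = measure lebesgue (generic_positions a b r k)"
    using measure_negligible_symdiff [OF G(1) neg] G(2) by simp
qed

section \<open>The areas in the five cases\<close>

theorem lemma3p1:
  fixes a b r \<theta> :: real and c :: "real ^ 2"
  assumes "0 < b" and "b \<le> a" and "0 < r"
  defines "\<epsilon> \<equiv> eccentricity a b"
    and "P01 \<equiv> positions_circle_inside a b \<theta> c r"
    and "P10 \<equiv> positions_ellipse_inside a b \<theta> c r"
    and "P2 \<equiv> positions_intersections a b \<theta> c r 2"
    and "P4 \<equiv> positions_intersections a b \<theta> c r 4"
  defines "Ai01 \<equiv> measure lebesgue P01"
    and "Ai10 \<equiv> measure lebesgue P10"
    and "A2 \<equiv> measure lebesgue P2"
    and "A4 \<equiv> measure lebesgue P4"
    and "As \<equiv> A_star a b r"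
    and "Ft \<equiv> F_tilde a b r"
    and "\<alpha> \<equiv> alpha a b r"
    and "\<beta> \<equiv> beta a b r"
  shows "P01 \<in> lmeasurable \<and> P10 \<in> lmeasurable \<and> P2 \<in> lmeasurable \<and> P4 \<in> lmeasurable \<and>
    As = pi * r\<^sup>2 + pi * a * b - 4 * r * a * complete_ell_E \<epsilon> \<and>
    (r \<le> b\<^sup>2 / a \<longrightarrow>
       Ai01 = As \<and> Ai10 = 0 \<and> A2 = 8 * r * a * complete_ell_E \<epsilon> \<and> A4 = 0) \<and>
    (b\<^sup>2 / a < r \<and> r < b \<longrightarrow>
       Ai01 = Ft \<alpha> \<and> Ai10 = 0 \<and>
       A2 = 2 * pi * r\<^sup>2 + 2 * pi * a * b - 2 * Ft \<alpha> \<and> A4 = Ft \<alpha> - As) \<and>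
    (b \<le> r \<and> r \<le> a \<longrightarrow>
       Ai01 = 0 \<and> Ai10 = 0 \<and> A2 = 2 * pi * r\<^sup>2 + 2 * pi * a * b \<and> A4 = - As) \<and>
    (a < r \<and> r < a\<^sup>2 / b \<longrightarrow>
       Ai01 = 0 \<and> Ai10 = F a b r \<beta> \<and>
       A2 = 2 * pi * r\<^sup>2 + 2 * pi * a * b - 2 * F a b r \<beta> \<and> A4 = F a b r \<beta> - As) \<and>
    (a\<^sup>2 / b \<le> r \<longrightarrow>
       Ai01 = 0 \<and> Ai10 = As \<and> A2 = 8 * r * a * complete_ell_E \<epsilon> \<and> A4 = 0)"
proof -
  note ab = \<open>0 < b\<close> \<open>b \<le> a\<close> and r = \<open>0 < r\<close>
  have a: "0 < a" using ab by simp
  define E where "E = complete_ell_E \<epsilon>"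
  note defs = Ai01_def Ai10_def A2_def A4_def P01_def P10_def P2_def P4_def
  have generic: "generic_positions a b r 2 \<in> lmeasurable" "generic_positions a b r 4 \<in> lmeasurable"
    by (rule measure_generic_positions [OF ab r])+
  have meas: "P01 \<in> lmeasurable" "P10 \<in> lmeasurable" "P2 \<in> lmeasurable" "P4 \<in> lmeasurable"
    unfolding defs positions_circle_inside_eq [OF ab(1) a r] positions_ellipse_inside_eq [OF ab r]
    by (intro measure_ell_position_vimage(1) lmeasurable_parallel_body_inner lmeasurable_parallel_body_outer
        measure_positions_intersections(1) generic ab r)+
  have Ai01: "Ai01 = measure lebesgue (parallel_body 1 a b r)"
    unfolding defs positions_circle_inside_eq [OF ab(1) a r]
    by (intro measure_ell_position_vimage(2) lmeasurable_parallel_body_inner ab)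
  have Ai10: "Ai10 = measure lebesgue (parallel_body (-1) a b r)"
    unfolding defs positions_ellipse_inside_eq [OF ab r]
    by (intro measure_ell_position_vimage(2) lmeasurable_parallel_body_outer ab)
  have A24: "A2 = measure lebesgue (generic_positions a b r 2)" "A4 = measure lebesgue (generic_positions a b r 4)"
    unfolding defs by (rule measure_positions_intersections(2) [OF ab r], rule generic)+
  have As: "As = pi * r\<^sup>2 + pi * a * b - 4 * r * a * E"
    unfolding As_def E_def \<epsilon>_def by (rule A_star_eq)
  have sum: "A2 + A4 = (pi * r\<^sup>2 + pi * a * b + 4 * r * a * E) - (Ai01 + Ai10)"
    using measure_generic_positions(3) [OF ab r] unfolding A24 Ai01 Ai10 A_star_eq by (simp add: E_def \<epsilon>_def)
  have mean: "2 * A2 + 4 * A4 = 16 * r * a * E"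
    using measure_generic_positions(4) [OF ab r] unfolding A24 by (simp add: E_def \<epsilon>_def)
  have solve: "x = 2 * p + 2 * q - 2 * i \<and> y = i - (p + q - 4 * e)"
    if "x + y = p + q + 4 * e - i" "2 * x + 4 * y = 16 * e" for x y p q e i :: real
    using that by (intro conjI) linarith+
  have A2: "A2 = 2 * pi * r\<^sup>2 + 2 * pi * a * b - 2 * (Ai01 + Ai10)"
    using solve [OF sum [unfolded mult.assoc] mean [unfolded mult.assoc]] unfolding mult.assoc by blast
  have A4: "A4 = Ai01 + Ai10 - As"
    using solve [OF sum [unfolded mult.assoc] mean [unfolded mult.assoc]] unfolding As mult.assoc by blast
  have Ai01_0: "Ai01 = 0" if "b \<le> r"
    unfolding Ai01 by (rule negligible_imp_measure0 [OF negligible_parallel_body_inner [OF ab(1) that]])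
  have Ai10_0: "Ai10 = 0" if "r \<le> a"
    unfolding Ai10 by (rule negligible_imp_measure0 [OF negligible_parallel_body_outer [OF a that]])
  have circle: "As = 0" if "a = b" "r = b"
    unfolding As_def that by (rule A_star_circle [OF ab(1)])
  have case1: "Ai01 = As" "Ai10 = 0" if "r \<le> b\<^sup>2 / a"
  proof -
    have ra: "r * a \<le> b\<^sup>2"
      using that a by (simp add: pos_le_divide_eq)
    have "r * b \<le> r * a"
      using ab r by simp
    then have "r * b \<le> b * b"
      using ra by (simp add: power2_eq_square)
    then have "r \<le> b"
      using ab by simp
    then show "Ai10 = 0"
      using ab by (intro Ai10_0) simp
    show "Ai01 = As"
    proof (cases "r < b")
      case True
      then show ?thesis
        unfolding Ai01 As_def using measure_parallel_body_inner_full(2) [OF ab ra] by simp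
    next
      case False
      then have "r = b" using \<open>r \<le> b\<close> by simp
      moreover from this have "a = b"
        using ra ab by (simp add: power2_eq_square)
      ultimately show ?thesis
        using Ai01_0 circle by simp
    qed
  qed
  have case2: "Ai01 = Ft \<alpha>" "Ai10 = 0" if "b\<^sup>2 / a < r" "r < b"
  proof -
    have "b\<^sup>2 < r * a"
      using that a by (simp add: pos_divide_less_eq)
    then show "Ai01 = Ft \<alpha>"
      unfolding Ai01 Ft_def \<alpha>_def by (rule measure_parallel_body_inner_partial(2) [OF ab _ that(2)])
    show "Ai10 = 0"
      using that ab by (intro Ai10_0) simp
  qed
  have case4: "Ai10 = F a b r \<beta>" "Ai01 = 0" if "a < r" "r < a\<^sup>2 / b"
  proof -
    have "r * b < a\<^sup>2"
      using that ab by (simp add: pos_less_divide_eq)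
    then show "Ai10 = F a b r \<beta>"
      unfolding Ai10 \<beta>_def by (rule measure_parallel_body_outer_partial(2) [OF ab _ that(1)])
    show "Ai01 = 0"
      using that ab by (intro Ai01_0) simp
  qed
  have case5: "Ai10 = As" "Ai01 = 0" if "a\<^sup>2 / b \<le> r"
  proof -
    have rb: "a\<^sup>2 \<le> r * b"
      using that ab by (simp add: pos_divide_le_eq)
    have "r * b \<le> r * a"
      using ab r by simp
    then have "a * a \<le> r * a"
      using rb by (simp add: power2_eq_square)
    then have "a \<le> r"
      using a by simp
    then show "Ai01 = 0"
      using ab by (intro Ai01_0) simp
    show "Ai10 = As"
    proof (cases "a < r")
      case True
      then show ?thesis
        unfolding Ai10 As_def using measure_parallel_body_outer_full(2) [OF ab rb] by simp
    next
      case False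
      then have "r = a" using \<open>a \<le> r\<close> by simp
      moreover from this have "a = b"
        using rb ab by (simp add: power2_eq_square)
      ultimately show ?thesis
        using Ai10_0 circle by simp
    qed
  qed
  show ?thesis
    unfolding E_def [symmetric]
    using meas As A2 A4 case1 case2 case4 case5 Ai01_0 Ai10_0 by auto
qed

end
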